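(* For arbitrary fields the following implications hold: (K) $\Rightarrow$ (SP) $\Rightarrow$ (P); ($\overline{\mathrm{P}}$) $\Rightarrow$ (P); (R) $\Rightarrow$ (P). Moreover, every subfield of $\overline{\mathbb{Q}}$ having the Northcott property has all of the properties (K), (SP), ($\overline{\mathrm{P}}$), (R) and (P).
   Context: Let $K$ be a field with algebraic closure $\overline{K}$. A polynomial mapping $f=(f_1,\dots,f_n):K^n\to K^n$ with $f_i\in K[x_1,\dots,x_n]$ is admissible if no $f_i$ is linear (linear polynomials include constants, i.e. every $f_i$ has degree at least $2$) and the leading forms (highest-degree homogeneous parts) of $f_1,\dots,f_n$ have no common nontrivial zero in $\overline{K}^n$. Property (SP): for every $n$ and every admissible polynomial mapping $f:K^n\to K^n$, any $X\subseteq K^n$ with $f(X)=X$ is finite. Property (P): the same implication for $n=1$. Property (K): for every $n$, if $\Phi:K^n\to K^n$ is an admissible polynomial mapping, $\Psi:K^n\to K^n$ is a polynomial mapping, $d$ is the minimum of the degrees of the polynomials defining $\Phi$, $D$ the maximum of the degrees of the polynomials defining $\Psi$, $d>D$, and $X\subseteq K^n$ satisfies $\Psi(X)\subseteq\Phi(X)$ with $\Psi|_X$ injective, then $X$ is finite. Property ($\overline{\mathrm{P}}$) (Liardet): for every non-linear polynomial $f\in\overline{K}[x]$ and every subset $X\subseteq\overline{K}$ consisting of elements of uniformly bounded degree over $K$, the inclusion $X\subseteq f(X)$ implies that $X$ is finite. Property (R): if $f\in K(x)$ and there is an infinite $X\subseteq K$ with $f(X)=X$, then $f(x)=(\alpha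 x+\beta)/(\gamma x+\delta)$ for some $\alpha,\beta,\gamma,\delta\in K$. With $h$ the absolute logarithmic Weil height on $\overline{\mathbb{Q}}$, a subset $A\subseteq\overline{\mathbb{Q}}$ has the Northcott property if $\{x\in A: h(x)<T\}$ is finite for every real $T>0$. *)

theory Defs
  imports
    "HOL-Analysis.Analysis"
    "HOL-Library.Poly_Mapping"
    "HOL-Library.FuncSet"
    "HOL-Computational_Algebra.Computational_Algebra"
begin

section \<open>Fields and algebraic elements\<close>

text \<open>
  A field \<open>K\<close> is given as a subfield of an algebraically closed field (a type of class
  \<open>alg_closed_field\<close>), so that the algebraic closure of \<open>K\<close> is the set of elements of the ambient
  field that are algebraic over \<open>K\<close>.  This is no restriction: an arbitrary field \<open>'k\<close> is
  isomorphic to the range of the embedding \<open>to_ac :: 'k \<Rightarrow> 'k alg_closure\<close> (theory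
  \<open>HOL-Algebra.Algebraic_Closure_Type\<close>).  It also covers, without change, subfields of the field of
  algebraic numbers inside the type \<open>complex\<close>.
\<close>

definition is_subfield :: "'a::field set \<Rightarrow> bool" where
  "is_subfield K \<longleftrightarrow> 0 \<in> K \<and> 1 \<in> K \<and>
     (\<forall>x\<in>K. \<forall>y\<in>K. x + y \<in> K \<and> x * y \<in> K) \<and> (\<forall>x\<in>K. - x \<in> K \<and> inverse x \<in> K)"

definition polys_over :: "'a::field set \<Rightarrow> 'a poly set" where
  "polys_over K = {p. \<forall>i. coeff p i \<in> K}"

definition alg_closure_of :: "'a::alg_closed_field set \<Rightarrow> 'a set" where
  "alg_closure_of K = {x. \<exists>p\<in>polys_over K. p \<noteq> 0 \<and> poly p x = 0}"

text \<open>The degree of the minimal polynomial; only meaningful if \<open>x\<close> is algebraic over \<open>K\<close>.\<close>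

definition degree_over :: "'a::field set \<Rightarrow> 'a \<Rightarrow> nat" where
  "degree_over K x = (LEAST d. \<exists>p\<in>polys_over K. p \<noteq> 0 \<and> degree p = d \<and> poly p x = 0)"


section \<open>Polynomial mappings in several variables\<close>

text \<open>
  Polynomials are finitely supported families of coefficients indexed by monomials, which in turn
  are finitely supported families of exponents indexed by the variables \<open>0, 1, 2, \<dots>\<close>.
\<close>

type_synonym 'a mpoly = "(nat \<Rightarrow>\<^sub>0 nat) \<Rightarrow>\<^sub>0 'a"

definition mpolys_over :: "'a::field set \<Rightarrow> nat \<Rightarrow> 'a mpoly set" where
  "mpolys_over K n =
     {p. (\<forall>m. Poly_Mapping.lookup p m \<in> K) \<and>
         (\<forall>m\<in>Poly_Mapping.keys p. Poly_Mapping.keys m \<subseteq> {..<n})}"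

definition monom_degree :: "(nat \<Rightarrow>\<^sub>0 nat) \<Rightarrow> nat" where
  "monom_degree m = (\<Sum>i\<in>Poly_Mapping.keys m. Poly_Mapping.lookup m i)"

definition total_degree :: "'a::zero mpoly \<Rightarrow> nat" where
  "total_degree p = Max (insert 0 (monom_degree ` Poly_Mapping.keys p))"

definition leading_form :: "'a::comm_monoid_add mpoly \<Rightarrow> 'a mpoly" where
  "leading_form p =
     (\<Sum>m\<in>{m \<in> Poly_Mapping.keys p. monom_degree m = total_degree p}.
        Poly_Mapping.single m (Poly_Mapping.lookup p m))"

definition eval_mpoly :: "'a::comm_semiring_1 mpoly \<Rightarrow> (nat \<Rightarrow> 'a) \<Rightarrow> 'a" where
  "eval_mpoly p x =
     (\<Sum>m\<in>Poly_Mapping.keys p.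
        Poly_Mapping.lookup p m * (\<Prod>i\<in>Poly_Mapping.keys m. x i ^ Poly_Mapping.lookup m i))"

definition affine_space :: "'a set \<Rightarrow> nat \<Rightarrow> (nat \<Rightarrow> 'a) set" where
  "affine_space K n = ({..<n} \<rightarrow>\<^sub>E K)"

text \<open>
  An \<open>n\<close>-tuple of polynomials is a function on \<open>nat\<close> of which only the values at indices below
  \<open>n\<close> matter.
\<close>

definition polynomial_tuple :: "'a::field set \<Rightarrow> nat \<Rightarrow> (nat \<Rightarrow> 'a mpoly) \<Rightarrow> bool" where
  "polynomial_tuple K n f \<longleftrightarrow> (\<forall>i<n. f i \<in> mpolys_over K n)"

definition polynomial_map ::
    "nat \<Rightarrow> (nat \<Rightarrow> 'a::comm_semiring_1 mpoly) \<Rightarrow> (nat \<Rightarrow> 'a) \<Rightarrow> (nat \<Rightarrow> 'a)" where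
  "polynomial_map n f x = (\<lambda>i\<in>{..<n}. eval_mpoly (f i) x)"

definition admissible ::
    "'a::alg_closed_field set \<Rightarrow> nat \<Rightarrow> (nat \<Rightarrow> 'a mpoly) \<Rightarrow> bool" where
  "admissible K n f \<longleftrightarrow> polynomial_tuple K n f \<and> (\<forall>i<n. total_degree (f i) \<ge> 2) \<and>
     (\<forall>z\<in>affine_space (alg_closure_of K) n.
        (\<forall>i<n. eval_mpoly (leading_form (f i)) z = 0) \<longrightarrow> (\<forall>i<n. z i = 0))"


section \<open>The five properties\<close>

definition property_SP_dim :: "'a::alg_closed_field set \<Rightarrow> nat \<Rightarrow> bool" where
  "property_SP_dim K n \<longleftrightarrow>
     (\<forall>f X. admissible K n f \<longrightarrow> X \<subseteq> affine_space K n \<longrightarrow> polynomial_map n f ` X = X \<longrightarrow>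
        finite X)"

definition property_SP :: "'a::alg_closed_field set \<Rightarrow> bool" where
  "property_SP K \<longleftrightarrow> (\<forall>n\<ge>1. property_SP_dim K n)"

definition property_P :: "'a::alg_closed_field set \<Rightarrow> bool" where
  "property_P K \<longleftrightarrow> property_SP_dim K 1"

definition property_K :: "'a::alg_closed_field set \<Rightarrow> bool" where
  "property_K K \<longleftrightarrow>
     (\<forall>n\<ge>1. \<forall>\<Phi> \<Psi> X. admissible K n \<Phi> \<longrightarrow> polynomial_tuple K n \<Psi> \<longrightarrow>
        Min ((\<lambda>i. total_degree (\<Phi> i)) ` {..<n}) > Max ((\<lambda>i. total_degree (\<Psi> i)) ` {..<n}) \<longrightarrow>
        X \<subseteq> affine_space K n \<longrightarrow>
        polynomial_map n \<Psi> ` X \<subseteq> polynomial_map n \<Phi> ` X \<longrightarrow>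
        inj_on (polynomial_map n \<Psi>) X \<longrightarrow>
        finite X)"

definition property_Pbar :: "'a::alg_closed_field set \<Rightarrow> bool" where
  "property_Pbar K \<longleftrightarrow>
     (\<forall>f\<in>polys_over (alg_closure_of K). degree f \<ge> 2 \<longrightarrow>
        (\<forall>X \<subseteq> alg_closure_of K. (\<exists>B. \<forall>x\<in>X. degree_over K x \<le> B) \<longrightarrow> X \<subseteq> poly f ` X \<longrightarrow>
           finite X))"

text \<open>
  A rational function over \<open>K\<close> is written in lowest terms as \<open>a / b\<close>.  Since \<open>X\<close> and its image lie
  in \<open>K\<close>, the function must not have a pole on \<open>X\<close>.  The conclusion is an equality of rational
  functions, that is of elements of the fraction field of the polynomial ring.
\<close>

definition property_R :: "'a::alg_closed_field set \<Rightarrow> bool" where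
  "property_R K \<longleftrightarrow>
     (\<forall>a\<in>polys_over K. \<forall>b\<in>polys_over K. b \<noteq> 0 \<longrightarrow> coprime a b \<longrightarrow>
        (\<exists>X \<subseteq> K. infinite X \<and> (\<forall>x\<in>X. poly b x \<noteq> 0) \<and> (\<lambda>x. poly a x / poly b x) ` X = X) \<longrightarrow>
        (\<exists>\<alpha>\<in>K. \<exists>\<beta>\<in>K. \<exists>\<gamma>\<in>K. \<exists>\<delta>\<in>K.
           [:\<delta>, \<gamma>:] \<noteq> 0 \<and> Fract a b = Fract [:\<beta>, \<alpha>:] [:\<delta>, \<gamma>:]))"


section \<open>The absolute logarithmic Weil height\<close>

definition algebraic_numbers :: "complex set" where
  "algebraic_numbers = {x. algebraic x}"

definition padic_abs :: "nat \<Rightarrow> rat \<Rightarrow> real" where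
  "padic_abs p q = (if q = 0 then 0 else
     real p powi (int (multiplicity (int p) (snd (quotient_of q)))
                  - int (multiplicity (int p) (fst (quotient_of q)))))"

definition rational_places :: "(rat \<Rightarrow> real) set" where
  "rational_places = insert (\<lambda>q. real_of_rat \<bar>q\<bar>) (padic_abs ` {p. prime p})"

definition absolute_values :: "complex set \<Rightarrow> (complex \<Rightarrow> real) set" where
  "absolute_values F = {w. w \<in> extensional F \<and>
     (\<forall>x\<in>F. w x \<ge> 0 \<and> (w x = 0 \<longleftrightarrow> x = 0)) \<and>
     (\<forall>x\<in>F. \<forall>y\<in>F. w (x * y) = w x * w y \<and> w (x + y) \<le> w x + w y)}"

definition place_below :: "(complex \<Rightarrow> real) \<Rightarrow> rat \<Rightarrow> real" where
  "place_below w = (\<lambda>q. w (of_rat q))"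

text \<open>
  The places of a number field \<open>F\<close> are represented by the absolute values extending one of the
  standard absolute values of the rationals.
\<close>

definition places :: "complex set \<Rightarrow> (complex \<Rightarrow> real) set" where
  "places F = {w \<in> absolute_values F. place_below w \<in> rational_places}"

text \<open>
  An arbitrary extension of \<open>v\<close> to the algebraic numbers.  Two such extensions differ by a field
  automorphism, so that nothing below depends on the choice.
\<close>

definition extended_place :: "(rat \<Rightarrow> real) \<Rightarrow> complex \<Rightarrow> real" where
  "extended_place v = (SOME w. w \<in> absolute_values algebraic_numbers \<and> place_below w = v)"

definition embeddings :: "complex set \<Rightarrow> (complex \<Rightarrow> complex) set" where
  "embeddings F = {\<sigma>. \<sigma> \<in> F \<rightarrow>\<^sub>E algebraic_numbers \<and> \<sigma> 1 = 1 \<and>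
     (\<forall>x\<in>F. \<forall>y\<in>F. \<sigma> (x + y) = \<sigma> x + \<sigma> y \<and> \<sigma> (x * y) = \<sigma> x * \<sigma> y)}"

text \<open>
  The local degree of \<open>w\<close> over the rational place \<open>v\<close> below it, i.e. the degree over \<open>\<rat>\<^sub>v\<close> of the
  completion \<open>F\<^sub>w\<close>.  It is the number of \<open>\<rat>\<^sub>v\<close>-embeddings of \<open>F\<^sub>w\<close> into an algebraic closure of
  \<open>\<rat>\<^sub>v\<close>; by restriction to \<open>F\<close> these correspond to the embeddings of \<open>F\<close> into the algebraic
  numbers that induce \<open>w\<close>.  (For archimedean \<open>w\<close> this is 1 for real and 2 for complex places.)
\<close>

definition local_degree :: "complex set \<Rightarrow> (complex \<Rightarrow> real) \<Rightarrow> nat" where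
  "local_degree F w =
     card {\<sigma> \<in> embeddings F. \<forall>x\<in>F. w x = extended_place (place_below w) (\<sigma> x)}"

definition rationals_adjoin :: "complex \<Rightarrow> complex set" where
  "rationals_adjoin x = \<Inter>{F. is_subfield F \<and> x \<in> F}"

text \<open>
  The usual sum over the places of a number field containing \<open>x\<close>, here \<open>F = \<rat>(x)\<close>; only finitely
  many terms are nonzero.
\<close>

definition weil_height :: "complex \<Rightarrow> real" where
  "weil_height x =
     (\<Sum>\<^sub>\<infinity>w\<in>places (rationals_adjoin x).
        real (local_degree (rationals_adjoin x) w) / real (degree_over \<rat> x) * ln (max 1 (w x)))"

definition northcott :: "complex set \<Rightarrow> bool" where
  "northcott A \<longleftrightarrow> A \<subseteq> algebraic_numbers \<and> (\<forall>T>0. finite {x \<in> A. weil_height x < T})"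

end

theory Submission
  imports Defs "HOL-Library.Function_Algebras"
begin

text \<open>
  The implications over an arbitrary field are formal. For a field \<open>L\<close> with the Northcott property one
  compares heights. A Northcott field meets every set of points of bounded height in a finite set, so
  an infinite set \<open>X\<close> with an injective map \<open>T : X \<rightarrow> X\<close> cannot satisfy
  \<open>a h(T x) \<le> b h(x) + c\<close> with \<open>a > b\<close>: below a certain bound \<open>T\<close> permutes the finitely many points
  available, and above it \<open>T\<close> strictly decreases the height. For (K) the map is \<open>\<Psi> x = \<Phi> (T x)\<close> and
  the inequality is \<open>d h(T x) - c \<le> h(\<Phi> (T x)) = h(\<Psi> x) \<le> D h(x) + c\<close>, whose left half comes from
  the homogeneous Nullstellensatz for the leading forms. For (R) and (\<open>P\<close> bar) it is \<open>f (T x) = x\<close> with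
  \<open>(deg f) h(T x) - c \<le> h(f (T x))\<close>, which also uses the product formula.

  Heights are handled without number fields. Fix for every rational place \<open>v\<close> one extension \<open>|.|\<^sub>v\<close> to
  the algebraic numbers; the height of a finite set \<open>S\<close> is the mean over the automorphisms \<open>\<sigma>\<close> of the
  field of algebraic numbers of \<open>\<Sum>\<^sub>v ln max (1, |\<sigma> x|\<^sub>v)\<close>, the maximum being over \<open>x \<in> S\<close>. Only the
  finitely many restrictions of \<open>\<sigma>\<close> to \<open>S\<close> matter. Every local inequality for all absolute values that
  extend a rational place then passes to heights, and the Weil height of \<open>x\<close> is at most the height of
  \<open>{x}\<close>.
\<close>

section \<open>Algebraic numbers\<close>

text \<open>A Northcott field may have infinite degree over the rationals, and the points of
  \<open>X\<close> need not lie in a common number field, so there is no single set of places over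
  which their heights could be compared. Averaging over the automorphisms of all algebraic numbers
  removes the field of definition. The comparison with the Weil height goes in the direction that
  Northcott requires: a bound for the mean must bound the Weil height. It rests on pairing a place
  with the embeddings that induce it, which is how the local degree counts.

  A constant in a local inequality must be 1 at almost all places to have a finite effect after
  summation. Hence every constant has the form \<open>arch_const w N * max_abs w S\<close>: the
  number of summands is felt at the archimedean place only, and the coefficients are collected in a
  finite set \<open>S\<close>.

  In (P bar) the points lie outside \<open>L\<close>. All roots of a minimal polynomial over
  \<open>L\<close> are conjugate over the rationals and have the same height, which bounds the
  heights of its coefficients and carries finiteness over to bounded degree.\<close>

lemma linear_dependence:
  fixes c :: "'i \<Rightarrow> 'j \<Rightarrow> 'a::field"
  assumes K: "is_subfield K" and "finite J" "finite I" "card J < card I"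
    and "\<And>i j. i \<in> I \<Longrightarrow> j \<in> J \<Longrightarrow> c i j \<in> K"
  shows "\<exists>a. (\<forall>i\<in>I. a i \<in> K) \<and> (\<exists>i\<in>I. a i \<noteq> 0) \<and> (\<forall>j\<in>J. (\<Sum>i\<in>I. a i * c i j) = 0)"
  using assms(2-)
proof (induction J arbitrary: I c rule: finite_induct)
  case empty
  then show ?case using K by (intro exI[of _ "\<lambda>_. 1"]) (auto simp: is_subfield_def card_gt_0_iff)
next
  case (insert j0 J)
  show ?case
  proof (cases "\<forall>i\<in>I. c i j0 = 0")
    case True
    then show ?thesis using insert.IH[of I c] insert by auto
  next
    case False
    then obtain i0 where i0: "i0 \<in> I" "c i0 j0 \<noteq> 0" by auto
    define I' where "I' = I - {i0}"
    \<comment> \<open>Gaussian elimination: equation \<open>j0\<close>, with pivot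
      \<open>c i0 j0\<close>, removes the unknown \<open>i0\<close> from the other
      equations.\<close>
    define c' where "c' = (\<lambda>i j. c i j - c i j0 / c i0 j0 * c i0 j)"
    have dK: "x - y * z * u \<in> K" if "x \<in> K" "y \<in> K" "z \<in> K" "u \<in> K" for x y z u
      using K that by (metis is_subfield_def diff_conv_add_uminus)
    have c'K: "c' i j \<in> K" if "i \<in> I'" "j \<in> J" for i j
      unfolding c'_def divide_inverse using that insert.prems i0 K 
      by (intro dK) (auto simp: I'_def is_subfield_def)
    have "card J < card I'" using insert i0 by (simp add: I'_def)
    then obtain a where a: "\<forall>i\<in>I'. a i \<in> K" "\<exists>i\<in>I'. a i \<noteq> 0" "\<forall>j\<in>J. (\<Sum>i\<in>I'. a i * c' i j) = 0"
      using insert.IH[of I' c'] c'K insert.prems by (auto simp: I'_def)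
    \<comment> \<open>The value at \<open>i0\<close> that equation \<open>j0\<close> forces.\<close>
    define a0 where "a0 = - (\<Sum>i\<in>I'. a i * (c i j0 / c i0 j0))"
    define b where "b = a(i0 := a0)"
    have sumK: "(\<Sum>i\<in>S. f i) \<in> K" if "\<forall>i\<in>S. f i \<in> K" for f and S :: "'i set"
      using that K by (induction S rule: infinite_finite_induct) (auto simp: is_subfield_def)
    have "a0 \<in> K"
    proof -
      have "(\<Sum>i\<in>I'. a i * (c i j0 / c i0 j0)) \<in> K"
        using a insert.prems i0 K by (intro sumK) (auto simp: is_subfield_def I'_def divide_inverse)
      then show ?thesis using K by (auto simp: a0_def is_subfield_def)
    qed
    have split: "(\<Sum>i\<in>I. b i * c i j) = a0 * c i0 j + (\<Sum>i\<in>I'. a i * c i j)" for j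
    proof -
      have "(\<Sum>i\<in>I. b i * c i j) = b i0 * c i0 j + (\<Sum>i\<in>I'. b i * c i j)"
        unfolding I'_def using i0 insert.prems by (intro sum.remove) auto
      also have "(\<Sum>i\<in>I'. b i * c i j) = (\<Sum>i\<in>I'. a i * c i j)"
        by (intro sum.cong) (auto simp: b_def I'_def)
      finally show ?thesis by (simp add: b_def)
    qed
    have "(\<Sum>i\<in>I. b i * c i j) = 0" if "j \<in> insert j0 J" for j
    proof (cases "j = j0")
      case True
      then show ?thesis using i0 unfolding split a0_def by (simp add: sum_distrib_right)
    next
      case False
      then have "0 = (\<Sum>i\<in>I'. a i * c' i j)" using a that by auto
      also have "\<dots> = (\<Sum>i\<in>I'. a i * c i j) - (\<Sum>i\<in>I'. a i * (c i j0 / c i0 j0)) * c i0 j"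
        by (simp add: c'_def sum_subtractf sum_distrib_right sum_distrib_left algebra_simps)
      finally show ?thesis unfolding split a0_def by simp
    qed
    then show ?thesis using a \<open>a0 \<in> K\<close> i0 
      by (intro exI[of _ b]) (auto simp: b_def I'_def)
  qed
qed

lemma is_subfield_Rats: "is_subfield (\<rat> :: 'a::field_char_0 set)"
  by (auto simp: is_subfield_def)

section \<open>Algebras of finite dimension over the rationals\<close>

definition rat_span :: "'a::field_char_0 set \<Rightarrow> 'a set" where
  "rat_span B = {\<Sum>y\<in>B. q y * y |q. q \<in> B \<rightarrow> \<rat>}"

lemma rat_span_add: "x \<in> rat_span B \<Longrightarrow> y \<in> rat_span B \<Longrightarrow> x + y \<in> rat_span B"
proof -
  assume "x \<in> rat_span B" "y \<in> rat_span B"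
  then obtain q r where "x = (\<Sum>y\<in>B. q y * y)" "y = (\<Sum>y\<in>B. r y * y)" "q \<in> B \<rightarrow> \<rat>" "r \<in> B \<rightarrow> \<rat>"
    by (auto simp: rat_span_def)
  then show ?thesis unfolding rat_span_def
    by (intro CollectI exI[of _ "\<lambda>y. q y + r y"]) (auto simp: ring_distribs sum.distrib Pi_iff)
qed

lemma rat_span_0: "0 \<in> rat_span B"
  unfolding rat_span_def by (intro CollectI exI[of _ "\<lambda>y. 0"]) auto

lemma rat_span_sum: "(\<And>i. i \<in> I \<Longrightarrow> f i \<in> rat_span B) \<Longrightarrow> (\<Sum>i\<in>I. f i) \<in> rat_span B"
  by (induction I rule: infinite_finite_induct) (auto intro: rat_span_0 rat_span_add)

lemma rat_span_scale_base: "finite B \<Longrightarrow> b \<in> B \<Longrightarrow> c \<in> \<rat> \<Longrightarrow> c * b \<in> rat_span B"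
  unfolding rat_span_def
  by (intro CollectI exI[of _ "\<lambda>y. if y = b then c else 0"]) (auto simp: if_distrib[of "\<lambda>z. z * _"] cong: if_cong)

text \<open>A substitute for a number field: its elements are automatically algebraic, and adjoining
  one more algebraic element preserves the finite spanning set. Closure of the algebraic elements
  under sums, products and roots follows from these two facts.\<close>

definition finite_algebra :: "'a::field_char_0 set \<Rightarrow> bool" where
  "finite_algebra A \<longleftrightarrow> \<rat> \<subseteq> A \<and> (\<forall>x\<in>A. \<forall>y\<in>A. x + y \<in> A \<and> x * y \<in> A) \<and>
     (\<exists>B. finite B \<and> A \<subseteq> rat_span B)"

lemma finite_algebra_power: "finite_algebra A \<Longrightarrow> x \<in> A \<Longrightarrow> x ^ n \<in> A"
  by (induction n) (auto simp: finite_algebra_def)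

text \<open>The powers of \<open>x\<close> up to exponent \<open>card B\<close> are
  \<open>card B + 1\<close> elements with only \<open>card B\<close> coordinates each, so they
  satisfy a nontrivial rational relation.\<close>

lemma finite_algebra_algebraic:
  assumes "finite_algebra A" "x \<in> A"
  shows "algebraic x"
proof -
  obtain B where B: "finite B" "A \<subseteq> rat_span B" using assms by (auto simp: finite_algebra_def)
  have "\<forall>i. \<exists>q. q \<in> B \<rightarrow> \<rat> \<and> x ^ i = (\<Sum>y\<in>B. q y * y)"
  proof
    fix i
    have "x ^ i \<in> rat_span B" using finite_algebra_power[OF assms] B(2) by blast
    then show "\<exists>q. q \<in> B \<rightarrow> \<rat> \<and> x ^ i = (\<Sum>y\<in>B. q y * y)" unfolding rat_span_def by blast
  qed
  then obtain c where c: "\<And>i. c i \<in> B \<rightarrow> \<rat>" "\<And>i. x ^ i = (\<Sum>y\<in>B. c i y * y)" by metis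
  obtain a where a: "\<forall>i\<in>{..card B}. a i \<in> \<rat>" "\<exists>i\<in>{..card B}. a i \<noteq> 0"
     "\<forall>j\<in>B. (\<Sum>i\<in>{..card B}. a i * c i j) = 0"
    using linear_dependence[OF is_subfield_Rats B(1), of "{..card B}" c] c by auto
  define p where "p = (\<Sum>i\<le>card B. monom (a i) i)"
  have co: "coeff p i = (if i \<le> card B then a i else 0)" for i
    by (simp add: p_def coeff_sum)
  have "poly p x = (\<Sum>i\<le>card B. a i * (\<Sum>y\<in>B. c i y * y))"
    by (simp add: p_def poly_sum poly_monom c(2))
  also have "\<dots> = (\<Sum>y\<in>B. (\<Sum>i\<le>card B. a i * c i y) * y)"
    by (simp add: sum_distrib_left sum_distrib_right mult.assoc) (rule sum.swap)
  also have "\<dots> = 0" using a by simp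
  finally have "poly p x = 0" .
  moreover have "p \<noteq> 0" using a(2) co by (metis atMost_iff coeff_0)
  moreover have "coeff p i \<in> \<rat>" for i using a(1) by (simp add: co)
  ultimately show ?thesis unfolding algebraic_altdef by blast
qed

text \<open>The combinations over \<open>A\<close> of the powers below \<open>d\<close> already form
  a ring, because the relation rewrites \<open>x ^ d\<close>. Products of a spanning set of
  \<open>A\<close> with these powers span it over the rationals.\<close>

lemma finite_algebra_adjoin:
  assumes A: "finite_algebra A" and a: "\<And>i. i < d \<Longrightarrow> a i \<in> A" and x: "x ^ d = (\<Sum>i<d. a i * x ^ i)"
  shows "\<exists>A'. finite_algebra A' \<and> A \<subseteq> A' \<and> x \<in> A'"
proof -
  have A_add: "u + v \<in> A" and A_mult: "u * v \<in> A" if "u \<in> A" "v \<in> A" for u v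
    using A that by (auto simp: finite_algebra_def)
  have A_0: "0 \<in> A" and A_1: "1 \<in> A" using A by (auto simp: finite_algebra_def)
  have "d > 0" using x by (cases d) auto
  define A' where "A' = {\<Sum>i<d. f i * x ^ i |f. \<forall>i<d. f i \<in> A}"
  have A'I: "(\<Sum>i<d. f i * x ^ i) \<in> A'" if "\<And>i. i < d \<Longrightarrow> f i \<in> A" for f
    using that by (auto simp: A'_def)
  have add: "u + v \<in> A'" if uv: "u \<in> A'" "v \<in> A'" for u v
  proof -
    obtain f g where "u = (\<Sum>i<d. f i * x ^ i)" "v = (\<Sum>i<d. g i * x ^ i)" 
      "\<forall>i<d. f i \<in> A" "\<forall>i<d. g i \<in> A" using uv by (auto simp: A'_def)
    then show ?thesis using A'I[of "\<lambda>i. f i + g i"] A_add by (simp add: ring_distribs sum.distrib)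
  qed
  have scale: "c * u \<in> A'" if cu: "c \<in> A" "u \<in> A'" for c u
  proof -
    obtain f where "u = (\<Sum>i<d. f i * x ^ i)" "\<forall>i<d. f i \<in> A" using cu by (auto simp: A'_def)
    then show ?thesis using A'I[of "\<lambda>i. c * f i"] A_mult cu by (simp add: sum_distrib_left mult.assoc)
  qed
  have small: "x ^ i \<in> A'" if "i < d" for i
    using A'I[of "\<lambda>j. if j = i then 1 else 0"] that A_0 A_1 by (auto simp: if_distrib[of "\<lambda>z. z * _"] cong: if_cong)
  have zero: "0 \<in> A'" using A'I[of "\<lambda>j. 0"] A_0 by simp
  have sm: "(\<Sum>i\<in>I. f i) \<in> A'" if "\<And>i. i \<in> I \<Longrightarrow> f i \<in> A'" for f and I :: "nat set"
    using that by (induction I rule: infinite_finite_induct) (auto intro: zero add)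
  have xd: "x ^ d \<in> A'" using A'I[of a] a x by auto
  \<comment> \<open>Stability under multiplication by \<open>x\<close> is where the relation for
    \<open>x ^ d\<close> enters; general products follow by iterating it.\<close>
  have shift: "x * u \<in> A'" if u: "u \<in> A'" for u
  proof -
    obtain f where f: "u = (\<Sum>i<d. f i * x ^ i)" "\<forall>i<d. f i \<in> A" using u by (auto simp: A'_def)
    have "x * u = (\<Sum>i<d. f i * x ^ Suc i)" by (simp add: f sum_distrib_left mult_ac)
    also have "\<dots> \<in> A'"
    proof (intro sm scale)
      fix i assume "i \<in> {..<d}"
      then show "f i \<in> A" "x ^ Suc i \<in> A'" using f small[of "Suc i"] xd by (auto, cases "Suc i = d", auto)
    qed
    finally show ?thesis .
  qed
  have pow: "x ^ i * u \<in> A'" if "u \<in> A'" for i u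
    by (induction i) (use that shift in \<open>auto simp: mult.assoc\<close>)
  have mult: "u * v \<in> A'" if uv: "u \<in> A'" "v \<in> A'" for u v
  proof -
    obtain f where f: "u = (\<Sum>i<d. f i * x ^ i)" "\<forall>i<d. f i \<in> A" using uv by (auto simp: A'_def)
    have "u * v = (\<Sum>i<d. f i * (x ^ i * v))" by (simp add: f sum_distrib_right mult.assoc)
    also have "\<dots> \<in> A'" using f uv by (intro sm scale pow) auto
    finally show ?thesis .
  qed
  have sub: "A \<subseteq> A'" using scale[OF _ small[of 0]] \<open>d > 0\<close> by auto
  obtain B where B: "finite B" "A \<subseteq> rat_span B" using A by (auto simp: finite_algebra_def)
  define B' where "B' = (\<lambda>(y,i). y * x ^ i) ` (B \<times> {..<d})"
  have "finite B'" using B by (simp add: B'_def)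
  have "A' \<subseteq> rat_span B'"
  proof
    fix u assume "u \<in> A'"
    then obtain f where f: "u = (\<Sum>i<d. f i * x ^ i)" "\<forall>i<d. f i \<in> A" by (auto simp: A'_def)
    show "u \<in> rat_span B'" unfolding f
    proof (intro rat_span_sum)
      fix i assume i: "i \<in> {..<d}"
      then have "f i \<in> rat_span B" using f B by auto
      then obtain q where q: "q \<in> B \<rightarrow> \<rat>" "f i = (\<Sum>y\<in>B. q y * y)" unfolding rat_span_def by blast
      have "f i * x ^ i = (\<Sum>y\<in>B. q y * (y * x ^ i))" by (simp add: q sum_distrib_right mult.assoc)
      also have "\<dots> \<in> rat_span B'" using q i \<open>finite B'\<close>
        by (intro rat_span_sum rat_span_scale_base) (auto simp: B'_def)
      finally show "f i * x ^ i \<in> rat_span B'" .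
    qed
  qed
  then have "finite_algebra A'" using A add mult sub \<open>finite B'\<close> 
    unfolding finite_algebra_def by (meson order_trans)
  moreover have "x \<in> A'" using shift[OF small[of 0]] \<open>d > 0\<close> by simp
  ultimately show ?thesis using sub by blast
qed

lemma finite_algebra_Rats: "finite_algebra \<rat>"
proof -
  have "\<rat> \<subseteq> rat_span {1}" using rat_span_scale_base[of "{1}" 1] by auto
  then show ?thesis unfolding finite_algebra_def by (intro conjI exI[of _ "{1}"]) auto
qed

lemma monic_relation:
  fixes p :: "'a::field poly"
  assumes "poly p x = 0" "p \<noteq> 0"
  shows "x ^ degree p = (\<Sum>i<degree p. (- (coeff p i / lead_coeff p)) * x ^ i)"
proof -
  have "0 = poly p x / lead_coeff p" using assms by simp
  also have "poly p x = lead_coeff p * x ^ degree p + (\<Sum>i<degree p. coeff p i * x ^ i)"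
    unfolding poly_altdef by (simp flip: lessThan_Suc_atMost)
  also have "\<dots> / lead_coeff p = x ^ degree p + (\<Sum>i<degree p. coeff p i / lead_coeff p * x ^ i)"
    using assms by (simp add: add_divide_distrib sum_divide_distrib)
  finally show ?thesis by (simp add: sum_negf eq_neg_iff_add_eq_0)
qed

lemma algebraic_finite_algebra:
  assumes "finite S" "\<And>x. x \<in> S \<Longrightarrow> algebraic x"
  shows "\<exists>A. finite_algebra A \<and> S \<subseteq> A"
  using assms
proof (induction S rule: finite_induct)
  case empty then show ?case using finite_algebra_Rats by auto
next
  case (insert x S)
  then obtain A where A: "finite_algebra A" "S \<subseteq> A" by auto
  obtain p where p: "\<And>i. coeff p i \<in> \<rat>" "p \<noteq> 0" "poly p x = 0"
    using insert.prems by (auto simp: algebraic_altdef)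
  have "\<exists>A'. finite_algebra A' \<and> A \<subseteq> A' \<and> x \<in> A'"
  proof (rule finite_algebra_adjoin[OF A(1) _ monic_relation[OF p(3,2)]])
    have "- (coeff p i / lead_coeff p) \<in> \<rat>" for i using p(1) by (intro Rats_minus_iff[THEN iffD2] Rats_divide)
    then show "- (coeff p i / lead_coeff p) \<in> A" for i using A(1) by (auto simp: finite_algebra_def)
  qed
  then show ?case using A by blast
qed

lemma algebraic_add: "algebraic x \<Longrightarrow> algebraic y \<Longrightarrow> algebraic (x + y)"
  and algebraic_mult: "algebraic x \<Longrightarrow> algebraic y \<Longrightarrow> algebraic (x * y)"
proof -
  assume "algebraic x" "algebraic y"
  then obtain A where "finite_algebra A" "{x, y} \<subseteq> A" using algebraic_finite_algebra[of "{x,y}"] by auto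
  then show "algebraic (x + y)" "algebraic (x * y)" 
    by (auto simp: finite_algebra_def intro!: finite_algebra_algebraic[of A])
qed

text \<open>The coefficients are algebraic instead of rational. Divided by the leading one they lie
  in a finite algebra, and that algebra can still be enlarged by \<open>x\<close>.\<close>

lemma algebraic_poly_root:
  fixes p :: "'a::field_char_0 poly"
  assumes "\<And>i. algebraic (coeff p i)" "p \<noteq> 0" "poly p x = 0"
  shows "algebraic x"
proof -
  define a where "a = (\<lambda>i. - (coeff p i / lead_coeff p))"
  have "algebraic (a i)" for i unfolding a_def divide_inverse 
    using assms(1) by (intro algebraic_minus algebraic_mult algebraic_inverse)
  then obtain A where A: "finite_algebra A" "a ` {..<degree p} \<subseteq> A" 
    using algebraic_finite_algebra[of "a ` {..<degree p}"] by auto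
  have "\<exists>A'. finite_algebra A' \<and> A \<subseteq> A' \<and> x \<in> A'"
    by (rule finite_algebra_adjoin[OF A(1), of "degree p" a])
      (use A(2) monic_relation[OF assms(3,2)] in \<open>auto simp: a_def\<close>)
  then show ?thesis using finite_algebra_algebraic by blast
qed

lemma is_subfield_algebraic_numbers: "is_subfield algebraic_numbers"
  by (auto simp: is_subfield_def algebraic_numbers_def intro: algebraic_add algebraic_mult)

lemma Rats_subset_subfield:
  assumes "is_subfield (K :: 'a::field_char_0 set)"
  shows "\<rat> \<subseteq> K"
proof
  have nat: "of_nat n \<in> K" for n using assms by (induction n) (auto simp: is_subfield_def)
  have "- of_nat n \<in> K" for n using nat[of n] assms by (auto simp: is_subfield_def)
  with nat have int: "of_int i \<in> K" for i by (cases i) (simp_all del: of_nat_Suc)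
  fix x :: 'a assume "x \<in> \<rat>"
  then obtain a b where "x = of_int a / of_int b" by (auto elim: Rats_cases')
  then show "x \<in> K" using int[of a] int[of b] assms by (auto simp: is_subfield_def divide_inverse)
qed

section \<open>Automorphisms of the field of algebraic numbers\<close>

abbreviation "\<A> \<equiv> algebraic_numbers"

lemma alg_closed_under:
  "0 \<in> \<A>" "1 \<in> \<A>" "x \<in> \<A> \<Longrightarrow> y \<in> \<A> \<Longrightarrow> x + y \<in> \<A>" "x \<in> \<A> \<Longrightarrow> y \<in> \<A> \<Longrightarrow> x * y \<in> \<A>"
  "x \<in> \<A> \<Longrightarrow> - x \<in> \<A>" "x \<in> \<A> \<Longrightarrow> inverse x \<in> \<A>" 
  using is_subfield_algebraic_numbers by (auto simp: is_subfield_def)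

lemma alg_diff: "x \<in> \<A> \<Longrightarrow> y \<in> \<A> \<Longrightarrow> x - y \<in> \<A>"
  using alg_closed_under(3)[of x "-y"] alg_closed_under(5) by simp

lemma alg_divide: "x \<in> \<A> \<Longrightarrow> y \<in> \<A> \<Longrightarrow> x / y \<in> \<A>"
  unfolding divide_inverse by (intro alg_closed_under)

lemma alg_sum: "(\<And>i. i \<in> I \<Longrightarrow> f i \<in> \<A>) \<Longrightarrow> (\<Sum>i\<in>I. f i) \<in> \<A>"
  by (induction I rule: infinite_finite_induct) (auto intro: alg_closed_under)

lemma alg_prod: "(\<And>i. i \<in> I \<Longrightarrow> f i \<in> \<A>) \<Longrightarrow> (\<Prod>i\<in>I. f i) \<in> \<A>"
  by (induction I rule: infinite_finite_induct) (auto intro: alg_closed_under)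

lemma alg_power: "x \<in> \<A> \<Longrightarrow> x ^ n \<in> \<A>"
  by (induction n) (auto intro: alg_closed_under)

lemma alg_Rats: "x \<in> \<rat> \<Longrightarrow> x \<in> \<A>"
  using Rats_subset_subfield[OF is_subfield_algebraic_numbers] by blast

lemma alg_poly_root:
  "(\<And>i. coeff p i \<in> \<A>) \<Longrightarrow> p \<noteq> 0 \<Longrightarrow> poly p x = 0 \<Longrightarrow> x \<in> \<A>"
  using algebraic_poly_root[of p x] by (auto simp: algebraic_numbers_def)

lemma alg_poly: "(\<And>i. coeff p i \<in> \<A>) \<Longrightarrow> x \<in> \<A> \<Longrightarrow> poly p x \<in> \<A>"
  unfolding poly_altdef by (intro alg_sum alg_closed_under alg_power)

lemma alg_rat_poly:
  assumes "x \<in> \<A>"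
  obtains p where "\<And>i. coeff p i \<in> \<rat>" "p \<noteq> 0" "poly p x = 0"
  using assms by (auto simp: algebraic_numbers_def algebraic_altdef)

text \<open>In a minimal relation \<open>c + x * poly q x = 0\<close> the constant \<open>c\<close>
  is nonzero, so \<open>- q / c\<close> evaluates to the inverse. Hence the rational algebra
  generated by one algebraic number is a field.\<close>

lemma alg_inverse_poly:
  assumes "x \<in> \<A>" "x \<noteq> 0"
  obtains p where "\<And>i. coeff p i \<in> \<rat>" "inverse x = poly p x"
proof -
  define Q where "Q = (\<lambda>p. (\<forall>i. coeff p i \<in> \<rat>) \<and> p \<noteq> 0 \<and> poly p x = 0)"
  have ex: "\<exists>p. Q p" using alg_rat_poly[OF assms(1)] unfolding Q_def by metis
  define p where "p = arg_min degree Q"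
  have p: "Q p" and min: "Q q \<Longrightarrow> degree p \<le> degree q" for q
    unfolding p_def using ex arg_min_natI arg_min_nat_le by metis+
  obtain c q where pc: "p = pCons c q" by (cases p)
  have qr: "coeff q i \<in> \<rat>" for i using p unfolding Q_def pc by (metis coeff_pCons_Suc)
  have c: "c \<in> \<rat>" using p unfolding Q_def pc by (metis coeff_pCons_0)
  \<comment> \<open>Otherwise \<open>x\<close> could be cancelled, and \<open>q\<close> would be a
    relation of smaller degree.\<close>
  have "c \<noteq> 0"
  proof
    assume "c = 0"
    then have "Q q" using p qr assms(2) by (auto simp: Q_def pc)
    then show False using min[of q] by (auto simp: pc \<open>c = 0\<close> Q_def split: if_splits)
  qed
  have "c + x * poly q x = 0" using p by (simp add: Q_def pc)
  then have "inverse x = poly (smult (- inverse c) q) x"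
    using assms \<open>c \<noteq> 0\<close> by (simp add: field_simps add_eq_0_iff2)
  moreover have "coeff (smult (- inverse c) q) i \<in> \<rat>" for i using qr c by simp
  ultimately show ?thesis using that by blast
qed

text \<open>Isomorphisms between \<open>\<rat>\<close>-subalgebras are given by their graphs. It suffices to ask for a single value at
  \<open>0\<close>: these algebras are fields, so injectivity is automatic.\<close>
definition partial_iso :: "(complex \<times> complex) set \<Rightarrow> bool" where
  "partial_iso R \<longleftrightarrow> R \<subseteq> \<A> \<times> \<A> \<and> (\<forall>q\<in>\<rat>. (q, q) \<in> R) \<and>
     (\<forall>(x, y)\<in>R. \<forall>(x', y')\<in>R. (x + x', y + y') \<in> R \<and> (x * x', y * y') \<in> R) \<and>
     (\<forall>y. (0, y) \<in> R \<longrightarrow> y = 0)"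

text \<open>\<open>q\<close> is the image of \<open>p\<close> when the map with graph
  \<open>R\<close> acts on coefficients.\<close>

definition poly_rel :: "('a::zero \<times> 'a) set \<Rightarrow> 'a poly \<Rightarrow> 'a poly \<Rightarrow> bool" where
  "poly_rel R p q \<longleftrightarrow> (\<forall>i. (coeff p i, coeff q i) \<in> R)"

context
  fixes R assumes R: "partial_iso R"
begin

lemma partial_iso_add: "(x, y) \<in> R \<Longrightarrow> (x', y') \<in> R \<Longrightarrow> (x + x', y + y') \<in> R"
  and partial_iso_mult: "(x, y) \<in> R \<Longrightarrow> (x', y') \<in> R \<Longrightarrow> (x * x', y * y') \<in> R"
  and partial_iso_Rats: "q \<in> \<rat> \<Longrightarrow> (q, q) \<in> R"
  and partial_iso_0: "(0, y) \<in> R \<Longrightarrow> y = 0"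
  and partial_iso_alg: "(x, y) \<in> R \<Longrightarrow> x \<in> \<A>" "(x, y) \<in> R \<Longrightarrow> y \<in> \<A>"
  using R by (auto simp: partial_iso_def)

lemma partial_iso_sum: 
  "(\<And>i. i \<in> I \<Longrightarrow> (f i, g i) \<in> R) \<Longrightarrow> ((\<Sum>i\<in>I. f i), (\<Sum>i\<in>I. g i)) \<in> R"
  by (induction I rule: infinite_finite_induct) (auto intro: partial_iso_Rats partial_iso_add)

lemma partial_iso_diff: "(x, y) \<in> R \<Longrightarrow> (x', y') \<in> R \<Longrightarrow> (x - x', y - y') \<in> R"
  using partial_iso_add[of x y "- x'" "- y'"] partial_iso_mult[of "-1" "-1" x' y'] partial_iso_Rats[of "-1"]
  by simp

lemma partial_iso_power: "(x, y) \<in> R \<Longrightarrow> (x ^ n, y ^ n) \<in> R"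
  by (induction n) (auto intro: partial_iso_Rats partial_iso_mult)

lemma partial_iso_single_valued: "(x, y) \<in> R \<Longrightarrow> (x, y') \<in> R \<Longrightarrow> y = y'"
  using partial_iso_diff[of x y x y'] partial_iso_0[of "y - y'"] by auto

lemma partial_iso_poly:
  assumes "(x, y) \<in> R" "\<And>i. coeff p i \<in> \<rat>" shows "(poly p x, poly p y) \<in> R"
  unfolding poly_altdef 
  by (intro partial_iso_sum partial_iso_mult partial_iso_power assms(1) partial_iso_Rats assms(2))

text \<open>Since \<open>inverse x\<close> is a rational polynomial in \<open>x\<close>, a partner 0
  of \<open>x\<close> would make 0 a partner of \<open>inverse x * x = 1\<close> as well, while
  rationals are fixed.\<close>

lemma partial_iso_0': assumes "(x, 0) \<in> R" shows "x = 0"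
proof (rule ccontr)
  assume "x \<noteq> 0"
  then obtain p where p: "\<And>i. coeff p i \<in> \<rat>" "inverse x = poly p x" 
    using alg_inverse_poly partial_iso_alg(1)[OF assms] by metis
  have "(poly p x * x, poly p 0 * 0) \<in> R"
    using partial_iso_poly[OF assms p(1)] assms by (intro partial_iso_mult)
  then have "(1, 0) \<in> R" using \<open>x \<noteq> 0\<close> by (simp flip: p(2))
  then show False using partial_iso_single_valued[of 1 0 1] partial_iso_Rats[of 1] by auto
qed

lemma partial_iso_inj: "(x, y) \<in> R \<Longrightarrow> (x', y) \<in> R \<Longrightarrow> x = x'"
  using partial_iso_diff[of x y x' y] partial_iso_0'[of "x - x'"] by auto

lemma partial_iso_0_iff: "(x, y) \<in> R \<Longrightarrow> x = 0 \<longleftrightarrow> y = 0"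
  using partial_iso_0 partial_iso_0' by auto

lemma poly_rel_degree: "poly_rel R p q \<Longrightarrow> degree p = degree q"
proof -
  assume "poly_rel R p q"
  then have eq: "coeff p i = 0 \<longleftrightarrow> coeff q i = 0" for i using partial_iso_0_iff by (auto simp: poly_rel_def)
  have "degree p \<le> degree q" by (intro degree_le allI impI) (simp only: eq coeff_eq_0)
  moreover have "degree q \<le> degree p" by (intro degree_le allI impI) (simp only: eq[symmetric] coeff_eq_0)
  ultimately show "degree p = degree q" by simp
qed

lemma poly_rel_const: "(x, y) \<in> R \<Longrightarrow> poly_rel R [:x:] [:y:]"
  by (auto simp: poly_rel_def coeff_pCons partial_iso_Rats split: nat.split)

lemma poly_rel_X: "poly_rel R [:0, 1:] [:0, 1:]"
  by (auto simp: poly_rel_def coeff_pCons partial_iso_Rats split: nat.split)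

lemma poly_rel_add: "poly_rel R p q \<Longrightarrow> poly_rel R p' q' \<Longrightarrow> poly_rel R (p + p') (q + q')"
  by (auto simp: poly_rel_def intro: partial_iso_add)

lemma poly_rel_diff: "poly_rel R p q \<Longrightarrow> poly_rel R p' q' \<Longrightarrow> poly_rel R (p - p') (q - q')"
  by (auto simp: poly_rel_def intro: partial_iso_diff)

lemma poly_rel_mult: "poly_rel R p q \<Longrightarrow> poly_rel R p' q' \<Longrightarrow> poly_rel R (p * p') (q * q')"
  by (auto simp: poly_rel_def coeff_mult intro!: partial_iso_sum partial_iso_mult)

lemma poly_rel_monom: "(x, y) \<in> R \<Longrightarrow> poly_rel R (monom x n) (monom y n)"
  by (auto simp: poly_rel_def partial_iso_Rats)

text \<open>This makes the assignment of \<open>poly q b\<close> to \<open>poly p a\<close> well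
  defined. A relation \<open>p\<close> for \<open>a\<close> is reduced by the minimal relation
  \<open>m\<close>, and the same reduction is performed on the images.\<close>

lemma poly_rel_root:
  assumes m: "poly_rel R m m'" "m \<noteq> 0" "poly m a = 0" "poly m' b = 0"
    and min: "\<And>p q. poly_rel R p q \<Longrightarrow> p \<noteq> 0 \<Longrightarrow> poly p a = 0 \<Longrightarrow> degree m \<le> degree p"
    and "poly_rel R p q" "poly p a = 0"
  shows "poly q b = 0"
  using assms(6,7)
proof (induction "degree p" arbitrary: p q rule: less_induct)
  case less
  show ?case
  proof (cases "p = 0")
    case True
    then have "coeff q i = 0" for i using less.prems(1) partial_iso_0 by (auto simp: poly_rel_def)
    then show ?thesis by (simp add: poly_altdef)
  next
    case False
    note dm = poly_rel_degree[OF m(1)] and dp = poly_rel_degree[OF less.prems(1)]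
    have le: "degree m \<le> degree p" using min less.prems False by blast
    define k where "k = degree p - degree m"
    \<comment> \<open>Pseudo-division: cross-multiplying with the leading coefficients cancels the
      top term without dividing.\<close>
    define p2 where "p2 = [:lead_coeff m:] * p - monom (lead_coeff p) k * m"
    define q2 where "q2 = [:lead_coeff m':] * q - monom (lead_coeff q) k * m'"
    have lc: "(lead_coeff m, lead_coeff m') \<in> R" "(lead_coeff p, lead_coeff q) \<in> R"
      using m less.prems dm dp by (auto simp: poly_rel_def)
    then have lc0: "lead_coeff m' \<noteq> 0" using partial_iso_0_iff[OF lc(1)] m(2) by (metis leading_coeff_0_iff)
    have rel: "poly_rel R p2 q2" unfolding p2_def q2_def
      by (intro poly_rel_diff poly_rel_mult poly_rel_const poly_rel_monom lc m(1) less.prems(1))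
    have pa: "poly p2 a = 0" using m(3) less.prems(2) by (simp add: p2_def)
    have "poly q2 b = 0"
    proof (cases "degree p = 0")
      case True
      then have "degree m = 0" using le by simp
      then obtain c where "m = [:c:]" by (metis degree_eq_zeroE)
      then show ?thesis using m by simp
    next
      case False
      have "degree p2 \<le> degree p" unfolding p2_def
        using le by (intro degree_diff_le order.trans[OF degree_mult_le] order.trans[OF add_right_mono[OF degree_monom_le]])
          (auto simp: k_def)
      moreover have "coeff p2 (degree p) = 0" 
        using le by (simp add: p2_def k_def coeff_monom_mult)
      ultimately have "degree p2 < degree p"
        using False by (metis degree_0 leading_coeff_0_iff le_neq_implies_less gr0I)
      then show ?thesis using less.hyps rel pa by blast
    qed
    then show ?thesis using m(4) lc0 by (simp add: q2_def)
  qed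
qed

text \<open>The image \<open>m'\<close> of a minimal relation for \<open>a\<close> has a root
  \<open>b\<close>. Sending \<open>a\<close> to \<open>b\<close> extends the isomorphism to all
  polynomial expressions in \<open>a\<close>.\<close>

lemma partial_iso_extend:
  assumes "a \<in> \<A>"
  obtains R' b where "partial_iso R'" "R \<subseteq> R'" "(a, b) \<in> R'"
proof -
  define Q where "Q = (\<lambda>(p, q). poly_rel R p q \<and> p \<noteq> 0 \<and> poly p a = 0)"
  obtain p where p: "\<And>i. coeff p i \<in> \<rat>" "p \<noteq> 0" "poly p a = 0" using alg_rat_poly[OF assms] by blast
  then have "Q (p, p)" by (auto simp: Q_def poly_rel_def partial_iso_Rats)
  then have ex: "\<exists>z. Q z" by blast
  obtain m m' where mm: "Q (m, m')" and min: "\<And>z. Q z \<Longrightarrow> degree m \<le> degree (fst z)"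
    using arg_min_natI[of Q, OF _] arg_min_nat_le[of Q _ "degree \<circ> fst"] ex 
    by (metis comp_apply fst_conv surj_pair)
  then have m: "poly_rel R m m'" "m \<noteq> 0" "poly m a = 0" by (auto simp: Q_def)
  have "degree m > 0" using m(2,3) by (metis degree_eq_zeroE gr0I mult_zero_right pCons_0_0 poly_pCons poly_0 add.right_neutral)
  then have "degree m' > 0" using poly_rel_degree[OF m(1)] by simp
  then obtain b where b: "poly m' b = 0" using alg_closed_imp_poly_has_root by blast
  have "b \<in> \<A>" 
  proof (rule alg_poly_root[OF _ _ b])
    show "coeff m' i \<in> \<A>" for i using m(1) partial_iso_alg(2) unfolding poly_rel_def by blast
  qed (use \<open>degree m' > 0\<close> in auto)
  have root: "poly q b = 0" if "poly_rel R p q" "poly p a = 0" for p q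
    using poly_rel_root[OF m b _ that] min by (auto simp: Q_def)
  define R' where "R' = {(poly p a, poly q b) |p q. poly_rel R p q}"
  have R'I: "(poly p a, poly q b) \<in> R'" if "poly_rel R p q" for p q using that by (auto simp: R'_def)
  have sub: "R \<subseteq> R'" using R'I[OF poly_rel_const] by auto
  have ab: "(a, b) \<in> R'" using R'I[OF poly_rel_X] by simp
  have "partial_iso R'" unfolding partial_iso_def
  proof (intro conjI)
    show "R' \<subseteq> \<A> \<times> \<A>" using alg_poly[of _ a] alg_poly[of _ b] assms \<open>b \<in> \<A>\<close> partial_iso_alg
      by (fastforce simp: R'_def poly_rel_def)
    show "\<forall>q\<in>\<rat>. (q, q) \<in> R'" using sub partial_iso_Rats by blast
    show "\<forall>(x, y)\<in>R'. \<forall>(x', y')\<in>R'. (x + x', y + y') \<in> R' \<and> (x * x', y * y') \<in> R'"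
    proof (safe)
      fix x y x' y' assume "(x, y) \<in> R'" "(x', y') \<in> R'"
      then obtain p q p' q' where pq: "poly_rel R p q" "poly_rel R p' q'" "x = poly p a" "y = poly q b" 
        "x' = poly p' a" "y' = poly q' b" by (auto simp: R'_def)
      show "(x + x', y + y') \<in> R'" using R'I[OF poly_rel_add[OF pq(1,2)]] pq by simp
      show "(x * x', y * y') \<in> R'" using R'I[OF poly_rel_mult[OF pq(1,2)]] pq by simp
    qed
    show "\<forall>y. (0, y) \<in> R' \<longrightarrow> y = 0" using root by (auto simp: R'_def)
  qed
  then show ?thesis using that sub ab by blast
qed

end

section \<open>Automorphisms: extension, inverses, conjugates\<close>

definition alg_auts :: "(complex \<Rightarrow> complex) set" where
  "alg_auts = {\<sigma>. bij_betw \<sigma> \<A> \<A> \<and>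
     (\<forall>x\<in>\<A>. \<forall>y\<in>\<A>. \<sigma> (x + y) = \<sigma> x + \<sigma> y \<and> \<sigma> (x * y) = \<sigma> x * \<sigma> y)}"

text \<open>On a finite invariant set injectivity forces surjectivity. The sets in question will be
  the roots of rational polynomials.\<close>

lemma inj_endo_surj_if_finite_fibres:
  assumes "inj_on f S" "\<And>x. x \<in> S \<Longrightarrow> \<exists>T. finite T \<and> x \<in> T \<and> T \<subseteq> S \<and> f ` T \<subseteq> T"
  shows "f ` S = S"
proof -
  have "x \<in> f ` S" if x: "x \<in> S" for x
  proof -
    obtain T where T: "finite T" "x \<in> T" "T \<subseteq> S" "f ` T \<subseteq> T" using assms(2)[OF x] by auto
    then have "f ` T = T" using endo_inj_surj inj_on_subset[OF assms(1)] by blast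
    then show ?thesis using T by blast
  qed
  then show ?thesis using assms(2) by blast
qed

text \<open>A maximal extension exists by Zorn's lemma and is total by the one-element step. It maps
  the roots of each rational polynomial among themselves, hence is onto.\<close>

lemma partial_iso_extend_aut:
  assumes "partial_iso R0"
  obtains \<sigma> where "\<sigma> \<in> alg_auts" "\<And>x y. (x, y) \<in> R0 \<Longrightarrow> \<sigma> x = y"
proof -
  define \<R> where "\<R> = {R. partial_iso R \<and> R0 \<subseteq> R}"
  have "\<exists>M\<in>\<R>. \<forall>X\<in>\<R>. M \<subseteq> X \<longrightarrow> X = M"
  proof (rule subset_Zorn_nonempty)
    show "\<R> \<noteq> {}" using assms by (auto simp: \<R>_def)
    fix C assume C: "C \<noteq> {}" "subset.chain \<R> C"
    have iso: "partial_iso R" "R0 \<subseteq> R" if "R \<in> C" for R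
      using C that unfolding subset_chain_def \<R>_def by auto
    have "partial_iso (\<Union>C)" unfolding partial_iso_def
    proof (intro conjI)
      show "\<Union>C \<subseteq> \<A> \<times> \<A>" using iso unfolding partial_iso_def by blast
      show "\<forall>q\<in>\<rat>. (q, q) \<in> \<Union>C" using iso C(1) unfolding partial_iso_def by blast
      show "\<forall>y. (0, y) \<in> \<Union>C \<longrightarrow> y = 0" using iso unfolding partial_iso_def by blast
      show "\<forall>(x, y)\<in>\<Union>C. \<forall>(x', y')\<in>\<Union>C. (x + x', y + y') \<in> \<Union>C \<and> (x * x', y * y') \<in> \<Union>C"
      proof safe
        fix x y x' y' R R' assume "R \<in> C" "R' \<in> C" "(x, y) \<in> R" "(x', y') \<in> R'"
        moreover then obtain S where "S \<in> C" "(x, y) \<in> S" "(x', y') \<in> S"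
          using C(2) unfolding subset_chain_def by blast
        ultimately show "(x + x', y + y') \<in> \<Union>C" "(x * x', y * y') \<in> \<Union>C"
          using partial_iso_add[OF iso(1)[of S]] partial_iso_mult[OF iso(1)[of S]] by blast+
      qed
    qed
    then show "\<Union>C \<in> \<R>" using iso C(1) unfolding \<R>_def by blast
  qed
  then obtain M where "M \<in> \<R>" and max: "\<forall>X\<in>\<R>. M \<subseteq> X \<longrightarrow> X = M" by blast
  then have M: "partial_iso M" "R0 \<subseteq> M" by (auto simp: \<R>_def)
  have total: "\<exists>y. (x, y) \<in> M" if x: "x \<in> \<A>" for x
  proof -
    obtain R' y where R': "partial_iso R'" "M \<subseteq> R'" "(x, y) \<in> R'"
      using partial_iso_extend[OF M(1) x] by blast
    then have "R' \<in> \<R>" using M(2) by (auto simp: \<R>_def)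
    then show ?thesis using max R' by blast
  qed
  then obtain \<sigma> where \<sigma>: "\<And>x. x \<in> \<A> \<Longrightarrow> (x, \<sigma> x) \<in> M" by metis
  have eq: "\<sigma> x = y" if "(x, y) \<in> M" for x y
    using \<sigma> that partial_iso_single_valued[OF M(1)] partial_iso_alg[OF M(1)] by blast
  have inj: "inj_on \<sigma> \<A>" using \<sigma> partial_iso_inj[OF M(1)] by (metis inj_onI)
  have "\<sigma> ` \<A> = \<A>"
  proof (rule inj_endo_surj_if_finite_fibres[OF inj])
    fix x assume "x \<in> \<A>"
    then obtain p where p: "\<And>i. coeff p i \<in> \<rat>" "p \<noteq> 0" "poly p x = 0" using alg_rat_poly by blast
    let ?T = "{z. poly p z = 0}"
    have "?T \<subseteq> \<A>" using alg_poly_root[OF _ p(2)] p(1) alg_Rats by blast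
    moreover have "\<sigma> z \<in> ?T" if "z \<in> ?T" for z
      using partial_iso_poly[OF M(1) \<sigma> p(1), of z] partial_iso_0[OF M(1)] that \<open>?T \<subseteq> \<A>\<close> by auto
    ultimately show "\<exists>T. finite T \<and> x \<in> T \<and> T \<subseteq> \<A> \<and> \<sigma> ` T \<subseteq> T"
      using poly_roots_finite[OF p(2)] p(3) by (intro exI[of _ ?T]) auto
  qed
  moreover have "\<sigma> (x + y) = \<sigma> x + \<sigma> y" "\<sigma> (x * y) = \<sigma> x * \<sigma> y" if "x \<in> \<A>" "y \<in> \<A>" for x y
    using eq[OF partial_iso_add[OF M(1) \<sigma> \<sigma>]] eq[OF partial_iso_mult[OF M(1) \<sigma> \<sigma>]] that by simp_all
  ultimately have "\<sigma> \<in> alg_auts" using inj by (auto simp: alg_auts_def bij_betw_def)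
  then show ?thesis using that eq M(2) by blast
qed

context
  fixes \<sigma> assumes \<sigma>: "\<sigma> \<in> alg_auts"
begin

lemma aut_alg: "x \<in> \<A> \<Longrightarrow> \<sigma> x \<in> \<A>"
  and aut_add: "x \<in> \<A> \<Longrightarrow> y \<in> \<A> \<Longrightarrow> \<sigma> (x + y) = \<sigma> x + \<sigma> y"
  and aut_mult: "x \<in> \<A> \<Longrightarrow> y \<in> \<A> \<Longrightarrow> \<sigma> (x * y) = \<sigma> x * \<sigma> y"
  and aut_inj: "inj_on \<sigma> \<A>"
  using \<sigma> by (auto simp: alg_auts_def bij_betw_def)

lemma aut_0: "\<sigma> 0 = 0"
  using aut_add[of 0 0] alg_closed_under by simp

lemma aut_eq_0_iff: "x \<in> \<A> \<Longrightarrow> \<sigma> x = 0 \<longleftrightarrow> x = 0"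
  using aut_0 aut_inj alg_closed_under(1) by (metis inj_onD)

lemma aut_1: "\<sigma> 1 = 1"
  using aut_mult[of 1 1] aut_eq_0_iff[of 1] alg_closed_under by simp

lemma aut_minus: "x \<in> \<A> \<Longrightarrow> \<sigma> (- x) = - \<sigma> x"
  using aut_add[of x "-x"] aut_0 alg_closed_under by (simp add: eq_neg_iff_add_eq_0 add.commute)

lemma aut_inverse: "x \<in> \<A> \<Longrightarrow> \<sigma> (inverse x) = inverse (\<sigma> x)"
  using aut_mult[of x "inverse x"] aut_0 aut_1 alg_closed_under
  by (cases "x = 0") (auto simp: inverse_unique)

lemma aut_Rats: assumes "q \<in> \<rat>" shows "\<sigma> q = q"
proof -
  have nat: "\<sigma> (of_nat n) = of_nat n" for n
    by (induction n) (auto simp: aut_0 aut_1 aut_add alg_closed_under alg_Rats)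
  have int: "\<sigma> (of_int n) = of_int n" for n
    by (cases n) (simp_all add: nat aut_minus alg_Rats del: of_nat_Suc)
  obtain a b where "q = of_int a / of_int b" using assms by (auto elim: Rats_cases')
  then show ?thesis by (simp add: divide_inverse aut_mult aut_inverse int alg_Rats alg_closed_under)
qed

lemma aut_sum: "(\<And>i. i \<in> I \<Longrightarrow> f i \<in> \<A>) \<Longrightarrow> \<sigma> (\<Sum>i\<in>I. f i) = (\<Sum>i\<in>I. \<sigma> (f i))"
  by (induction I rule: infinite_finite_induct) (auto simp: aut_0 aut_add alg_sum)

lemma aut_power: "x \<in> \<A> \<Longrightarrow> \<sigma> (x ^ n) = \<sigma> x ^ n"
  by (induction n) (auto simp: aut_1 aut_mult alg_power)

lemma aut_rat_poly: "(\<And>i. coeff p i \<in> \<rat>) \<Longrightarrow> x \<in> \<A> \<Longrightarrow> \<sigma> (poly p x) = poly p (\<sigma> x)"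
  unfolding poly_altdef 
  by (subst aut_sum) (auto simp: aut_mult aut_power aut_Rats alg_power alg_Rats intro!: alg_closed_under)

end

lemma aut_comp: "\<sigma> \<in> alg_auts \<Longrightarrow> \<tau> \<in> alg_auts \<Longrightarrow> \<sigma> \<circ> \<tau> \<in> alg_auts"
  by (auto simp: alg_auts_def bij_betwE intro: bij_betw_trans)

lemma aut_id: "id \<in> alg_auts"
  by (auto simp: alg_auts_def)

lemma aut_inv: assumes "\<sigma> \<in> alg_auts"
  shows "\<exists>\<tau>\<in>alg_auts. \<forall>x\<in>\<A>. \<tau> (\<sigma> x) = x \<and> \<sigma> (\<tau> x) = x"
proof -
  define \<tau> where "\<tau> = inv_into \<A> \<sigma>"
  have bij: "bij_betw \<sigma> \<A> \<A>" using assms by (auto simp: alg_auts_def)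
  have 1: "\<tau> (\<sigma> x) = x" and 2: "\<sigma> (\<tau> x) = x" and 3: "\<tau> x \<in> \<A>" if "x \<in> \<A>" for x
    using bij that unfolding \<tau>_def
    by (auto simp: bij_betw_inv_into_left bij_betw_inv_into_right bij_betwE[OF bij_betw_inv_into])
  have "\<tau> (x + y) = \<tau> x + \<tau> y" "\<tau> (x * y) = \<tau> x * \<tau> y" if "x \<in> \<A>" "y \<in> \<A>" for x y
    using that 1[of "\<tau> x + \<tau> y"] 1[of "\<tau> x * \<tau> y"]  2 3
    by (simp_all add: aut_add[OF assms] aut_mult[OF assms] alg_closed_under)
  then have "\<tau> \<in> alg_auts" using bij_betw_inv_into[OF bij] by (auto simp: alg_auts_def \<tau>_def)
  then show ?thesis using 1 2 by blast
qed

text \<open>The second assumption says that sending \<open>poly p x\<close> to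
  \<open>poly p y\<close> is well defined on rational polynomials \<open>p\<close>; this partial
  isomorphism is then extended.\<close>

lemma conjugate_aut:
  assumes "x \<in> \<A>" and "\<And>p. (\<And>i. coeff p i \<in> \<rat>) \<Longrightarrow> poly p x = 0 \<Longrightarrow> poly p y = 0"
  obtains \<sigma> where "\<sigma> \<in> alg_auts" "\<sigma> x = y"
proof -
  define R where "R = {(poly p x, poly p y) |p. \<forall>i. coeff p i \<in> \<rat>}"
  have RI: "(poly p x, poly p y) \<in> R" if "\<And>i. coeff p i \<in> \<rat>" for p using that by (auto simp: R_def)
  have "y \<in> \<A>" using alg_rat_poly[OF assms(1)] assms(2) alg_poly_root alg_Rats by metis
  have "partial_iso R" unfolding partial_iso_def
  proof (intro conjI)
    show "R \<subseteq> \<A> \<times> \<A>" using alg_poly[of _ x] alg_poly[of _ y] assms \<open>y \<in> \<A>\<close> alg_Rats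
      by (fastforce simp: R_def)
    show "\<forall>q\<in>\<rat>. (q, q) \<in> R" 
    proof
      fix q :: complex assume "q \<in> \<rat>"
      then have "(poly [:q:] x, poly [:q:] y) \<in> R" by (intro RI) (auto simp: coeff_pCons split: nat.split)
      then show "(q, q) \<in> R" by simp
    qed
    show "\<forall>y. (0, y) \<in> R \<longrightarrow> y = 0" using assms(2) by (fastforce simp: R_def)
    show "\<forall>(u, v)\<in>R. \<forall>(u', v')\<in>R. (u + u', v + v') \<in> R \<and> (u * u', v * v') \<in> R"
    proof (safe)
      fix u v u' v' assume "(u, v) \<in> R" "(u', v') \<in> R"
      then obtain p q where pq: "\<And>i. coeff p i \<in> \<rat>" "\<And>i. coeff q i \<in> \<rat>" "u = poly p x" "v = poly p y" 
        "u' = poly q x" "v' = poly q y" by (auto simp: R_def)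
      show "(u + u', v + v') \<in> R" using RI[of "p + q"] pq by simp
      have "coeff (p * q) i \<in> \<rat>" for i unfolding coeff_mult using pq by (intro Rats_sum) auto
      then show "(u * u', v * v') \<in> R" using RI[of "p * q"] pq by simp
    qed
  qed
  then show ?thesis using partial_iso_extend_aut that RI[of "[:0, 1:]"] 
    by (metis (no_types, lifting) Rats_0 Rats_1 coeff_pCons_0 coeff_pCons_Suc coeff_0 mult.right_neutral
      mult_zero_right add.left_neutral add.right_neutral poly_pCons poly_0 not0_implies_Suc)
qed

section \<open>Extending the \<open>p\<close>-adic absolute values\<close>

definition subring_excluding :: "nat \<Rightarrow> complex set \<Rightarrow> bool" where
  "subring_excluding p R \<longleftrightarrow> R \<subseteq> \<A> \<and> 1 \<in> R \<and>
     (\<forall>x\<in>R. \<forall>y\<in>R. x + y \<in> R \<and> x * y \<in> R \<and> - x \<in> R) \<and> inverse (of_nat p) \<notin> R"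

text \<open>A subring of the algebraic numbers that is maximal among those not containing \<open>1 / p\<close> is a
  valuation ring; its value group is torsion modulo the powers of \<open>p\<close>, which yields a real-valued
  extension of the \<open>p\<close>-adic absolute value.\<close>

context
  fixes p :: nat and R :: "complex set"
  assumes p: "prime p" and R: "subring_excluding p R"
    and max: "\<And>R'. subring_excluding p R' \<Longrightarrow> R \<subseteq> R' \<Longrightarrow> R' = R"
begin

lemma vr_1: "1 \<in> R" and vr_add: "x \<in> R \<Longrightarrow> y \<in> R \<Longrightarrow> x + y \<in> R"
  and vr_mult: "x \<in> R \<Longrightarrow> y \<in> R \<Longrightarrow> x * y \<in> R" and vr_uminus: "x \<in> R \<Longrightarrow> - x \<in> R"
  and vr_p: "inverse (of_nat p) \<notin> R" and vr_alg: "x \<in> R \<Longrightarrow> x \<in> \<A>"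
  using R by (auto simp: subring_excluding_def)

lemma vr_0: "0 \<in> R"
  using vr_add[OF vr_1 vr_uminus[OF vr_1]] by simp

lemma vr_diff: "x \<in> R \<Longrightarrow> y \<in> R \<Longrightarrow> x - y \<in> R"
  using vr_add[of x "- y"] vr_uminus by simp

lemma vr_sum: "(\<And>i. i \<in> I \<Longrightarrow> f i \<in> R) \<Longrightarrow> (\<Sum>i\<in>I. f i) \<in> R"
  by (induction I rule: infinite_finite_induct) (auto intro: vr_0 vr_add)

lemma vr_power: "x \<in> R \<Longrightarrow> x ^ n \<in> R"
  by (induction n) (auto intro: vr_1 vr_mult)

lemma vr_of_nat: "of_nat n \<in> R"
  by (induction n) (auto intro: vr_1 vr_0 vr_add)

lemma vr_of_int: "of_int n \<in> R"
  by (cases n) (auto intro: vr_of_nat vr_uminus simp del: of_nat_Suc)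

lemma p_nz: "of_nat p \<noteq> (0 :: complex)"
  using p by (auto simp: prime_gt_0_nat)

text \<open>Adjoining \<open>u\<close> to \<open>R\<close> gives a strictly larger ring, which by
  maximality has to contain \<open>1 / p\<close>.\<close>

lemma vr_maximal:
  assumes "u \<in> \<A>" "u \<notin> R"
  shows "\<exists>f. (\<forall>i. coeff f i \<in> R) \<and> poly f u = inverse (of_nat p)"
proof (rule ccontr)
  assume no: "\<not> ?thesis"
  define R' where "R' = {poly f u |f. \<forall>i. coeff f i \<in> R}"
  have R'I: "poly f u \<in> R'" if "\<And>i. coeff f i \<in> R" for f using that by (auto simp: R'_def)
  have "subring_excluding p R'" unfolding subring_excluding_def
  proof (intro conjI ballI)
    show "R' \<subseteq> \<A>" using alg_poly assms(1) vr_alg by (auto simp: R'_def)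
    show "1 \<in> R'" using R'I[of 1] by (simp add: coeff_1 vr_0 vr_1)
    show "inverse (of_nat p) \<notin> R'" using no by (auto simp: R'_def)
    fix x y assume "x \<in> R'" "y \<in> R'"
    then obtain f g where fg: "x = poly f u" "y = poly g u" "\<And>i. coeff f i \<in> R" "\<And>i. coeff g i \<in> R"
      by (auto simp: R'_def)
    show "x + y \<in> R'" using R'I[of "f + g"] fg by (simp add: vr_add)
    show "- x \<in> R'" using R'I[of "- f"] fg by (simp add: vr_uminus)
    have "coeff (f * g) i \<in> R" for i unfolding coeff_mult using fg by (intro vr_sum vr_mult)
    then show "x * y \<in> R'" using R'I[of "f * g"] fg by simp
  qed
  moreover have "R \<subseteq> R'"
  proof
    fix x assume "x \<in> R"
    then show "x \<in> R'" using R'I[of "[:x:]"] by (auto simp: coeff_pCons vr_0 split: nat.splits)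
  qed
  ultimately have "R' = R" using max by blast
  moreover have "u \<in> R'" using R'I[of "[:0, 1:]"] by (auto simp: coeff_pCons vr_0 vr_1 split: nat.splits)
  ultimately show False using assms by blast
qed

text \<open>In other words, \<open>p\<close> lies in every maximal ideal of \<open>R\<close>. For
  \<open>t = 1 - p * a\<close>, a representation of \<open>1 / p\<close> as a polynomial in
  \<open>1 / t\<close> is cleared of denominators by a power of \<open>t\<close>. That power is 1
  modulo \<open>p\<close>, so \<open>1 / p\<close> itself would be in \<open>R\<close>.\<close>

lemma vr_unit_1_minus_p:
  assumes "a \<in> R"
  shows "1 - of_nat p * a \<noteq> 0" "inverse (1 - of_nat p * a) \<in> R"
proof -
  let ?P = "of_nat p :: complex" 
  define t where "t = 1 - ?P * a"
  show nz: "1 - ?P * a \<noteq> 0" using assms vr_p p_nz by (metis eq_iff_diff_eq_0 inverse_unique)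
  have tR: "t \<in> R" unfolding t_def using assms by (intro vr_diff vr_mult vr_1 vr_of_nat)
  have pow: "\<exists>b\<in>R. t ^ n = 1 - ?P * b" for n
  proof (induction n)
    case 0 then show ?case using vr_0 by (auto intro!: bexI[of _ 0])
  next
    case (Suc n)
    then obtain b where b: "b \<in> R" "t ^ n = 1 - ?P * b" by auto
    have "a + t * b \<in> R" using assms b tR by (intro vr_add vr_mult)
    moreover have "t ^ Suc n = t * (1 - ?P * b)" by (simp only: b power_Suc)
    then have "t ^ Suc n = 1 - ?P * (a + t * b)" by (simp add: t_def algebra_simps)
    ultimately show ?case by blast
  qed
  have "inverse t \<in> R"
  proof (rule ccontr)
    assume "inverse t \<notin> R"
    then obtain f where f: "\<And>i. coeff f i \<in> R" "poly f (inverse t) = inverse ?P"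
      using vr_maximal alg_closed_under(6)[OF vr_alg[OF tR]] by blast
    obtain b where b: "b \<in> R" "t ^ degree f = 1 - ?P * b" using pow by blast
    have "inverse ?P * t ^ degree f = (\<Sum>i\<le>degree f. coeff f i * t ^ (degree f - i))"
    proof -
      have "inverse t ^ i * t ^ degree f = t ^ (degree f - i)" if "i \<le> degree f" for i
        using that nz unfolding t_def[symmetric] by (simp add: power_diff power_inverse field_simps)
      then show ?thesis 
        by (simp flip: f(2) add: poly_altdef sum_distrib_right mult.assoc)
    qed
    also have "\<dots> \<in> R" by (intro vr_sum vr_mult vr_power f tR)
    finally have "inverse ?P - b \<in> R" using b p_nz by (simp add: field_simps)
    then have "inverse ?P \<in> R" using vr_add[OF _ b(1)] by fastforce
    then show False using vr_p by simp
  qed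
  then show "inverse (1 - ?P * a) \<in> R" by (simp add: t_def)
qed

text \<open>Chevalley's argument. Since \<open>1 - p * coeff g 0\<close> is a unit, the relation for
  \<open>inverse x\<close>, multiplied by a power of \<open>x\<close>, expresses
  \<open>x ^ degree f\<close> through smaller powers. Substituting this into \<open>f\<close> lowers
  its degree.\<close>

lemma vr_valuation_aux:
  assumes x: "x \<noteq> 0"
    and f: "\<And>i. coeff f i \<in> R" "poly f x = inverse (of_nat p)"
    and min: "\<And>h. (\<And>i. coeff h i \<in> R) \<Longrightarrow> poly h x = inverse (of_nat p) \<Longrightarrow> degree f \<le> degree h"
    and g: "\<And>i. coeff g i \<in> R" "poly g (inverse x) = inverse (of_nat p)"
    and le: "degree g \<le> degree f"
  shows False
proof -
  let ?P = "of_nat p :: complex"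
  let ?m = "degree g" and ?n = "degree f"
  define u where "u = inverse (1 - ?P * coeff g 0)"
  note unit = vr_unit_1_minus_p[OF g(1)[of 0]]
  have n: "?n > 0"
  proof (rule ccontr)
    assume "\<not> ?n > 0"
    then obtain c where "f = [:c:]" by (metis degree_eq_zeroE gr0I)
    then show False using f vr_p by (metis coeff_pCons_0 mult_zero_right add.right_neutral poly_pCons poly_0)
  qed
  have "1 = ?P * poly g (inverse x)" using g(2) p_nz by simp
  also have "poly g (inverse x) = coeff g 0 + (\<Sum>j=1..?m. coeff g j * inverse x ^ j)"
    unfolding poly_altdef by (subst sum.atMost_shift) (simp add: sum.atLeast1_atMost_eq lessThan_Suc_atMost)
  finally have eq: "1 - ?P * coeff g 0 = ?P * (\<Sum>j=1..?m. coeff g j * inverse x ^ j)" by (simp add: algebra_simps)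
  have "1 = u * (1 - ?P * coeff g 0)" using unit by (simp add: u_def)
  then have "x ^ ?n = u * (1 - ?P * coeff g 0) * x ^ ?n" by simp
  also have "\<dots> = u * ?P * (\<Sum>j=1..?m. coeff g j * (inverse x ^ j * x ^ ?n))"
    unfolding eq by (simp add: sum_distrib_left sum_distrib_right mult_ac)
  also have "\<dots> = u * ?P * (\<Sum>j=1..?m. coeff g j * x ^ (?n - j))"
    using x le by (intro arg_cong2[of _ _ _ _ "(*)"] sum.cong refl) (auto simp: power_diff field_simps)
  finally have xn: "x ^ ?n = u * ?P * (\<Sum>j=1..?m. coeff g j * x ^ (?n - j))" .
  \<comment> \<open>This is \<open>f\<close> with its top power rewritten by \<open>xn\<close>; all
    exponents are below \<open>?n\<close>, because \<open>j\<close> starts at 1.\<close>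
  define h where "h = (\<Sum>i<?n. monom (coeff f i) i) + (\<Sum>j=1..?m. monom (coeff f ?n * (u * ?P) * coeff g j) (?n - j))"
  have "poly f x = (\<Sum>i<?n. coeff f i * x ^ i) + coeff f ?n * x ^ ?n"
    unfolding poly_altdef by (simp flip: lessThan_Suc_atMost)
  also have "\<dots> = poly h x" unfolding xn h_def
    by (simp add: poly_sum poly_monom sum_distrib_left mult_ac)
  finally have "poly h x = inverse ?P" using f(2) by simp
  moreover have "coeff h i \<in> R" for i unfolding h_def coeff_add coeff_sum
    using f(1) g(1) unit(2) u_def by (intro vr_add vr_sum) (auto intro!: vr_mult vr_of_nat vr_0)
  ultimately have "?n \<le> degree h" using min by blast
  moreover have "degree h \<le> ?n - 1" unfolding h_def
    by (intro degree_add_le degree_sum_le) (auto intro: order_trans[OF degree_monom_le])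
  ultimately show False using n by simp
qed

lemma vr_valuation:
  assumes "x \<in> \<A>" "x \<noteq> 0"
  shows "x \<in> R \<or> inverse x \<in> R"
proof (rule ccontr)
  assume not: "\<not> (x \<in> R \<or> inverse x \<in> R)"
  define Q where "Q = (\<lambda>y f. (\<forall>i. coeff f i \<in> R) \<and> poly f y = inverse (of_nat p))"
  have ex: "\<exists>f. Q x f" "\<exists>f. Q (inverse x) f"
    using vr_maximal[of x] vr_maximal[of "inverse x"] assms not alg_closed_under(6) 
    unfolding Q_def by metis+
  define f where "f = arg_min degree (Q x)"
  define g where "g = arg_min degree (Q (inverse x))"
  have fg: "Q x f" "Q (inverse x) g" and min: "\<And>h. Q x h \<Longrightarrow> degree f \<le> degree h" 
    "\<And>h. Q (inverse x) h \<Longrightarrow> degree g \<le> degree h"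
    unfolding f_def g_def using ex arg_min_natI arg_min_nat_le by metis+
  have x: "x \<noteq> 0" "inverse x \<noteq> 0" using assms by auto
  consider "degree g \<le> degree f" | "degree f \<le> degree g" by linarith
  then show False
  proof cases
    case 1
    then show False using vr_valuation_aux[OF x(1), of f g] fg min(1) unfolding Q_def by blast
  next
    case 2
    then show False using vr_valuation_aux[OF x(2), of g f] fg min(2) unfolding Q_def inverse_inverse_eq by blast
  qed
qed

section \<open>Units and values in the valuation ring\<close>

definition vr_unit :: "complex \<Rightarrow> bool" where
  "vr_unit u \<longleftrightarrow> u \<noteq> 0 \<and> u \<in> R \<and> inverse u \<in> R"

lemma vr_unit_mult: "vr_unit u \<Longrightarrow> vr_unit v \<Longrightarrow> vr_unit (u * v)"
  by (auto simp: vr_unit_def intro!: vr_mult)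

lemma vr_unit_inverse: "vr_unit u \<Longrightarrow> vr_unit (inverse u)"
  by (auto simp: vr_unit_def)

lemma vr_unit_divide: "vr_unit u \<Longrightarrow> vr_unit v \<Longrightarrow> vr_unit (u / v)"
  unfolding divide_inverse by (intro vr_unit_mult vr_unit_inverse)

lemma vr_unit_power: "vr_unit u \<Longrightarrow> vr_unit (u ^ n)"
  by (auto simp: vr_unit_def power_inverse[symmetric] intro!: vr_power)

lemma vr_p_powi_iff: "of_nat p powi k \<in> R \<longleftrightarrow> k \<ge> 0"
proof
  assume a: "of_nat p powi k \<in> R"
  show "k \<ge> 0"
  proof (rule ccontr)
    assume "\<not> k \<ge> 0"
    then have "inverse (of_nat p :: complex) = of_nat p powi k * of_nat p ^ nat (- k - 1)"
      using p_nz by (simp add: power_int_def power_diff field_simps flip: power_Suc) 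
        (smt (verit) Suc_nat_eq_nat_zadd1 power_inverse right_inverse power_not_zero power_Suc mult.commute)
    then show False using vr_p vr_mult[OF a vr_power[OF vr_of_nat]] by metis
  qed
next
  assume "k \<ge> 0"
  then show "of_nat p powi k \<in> R" by (simp add: power_int_def vr_power vr_of_nat)
qed

text \<open>By Bezout some multiple of \<open>a\<close> has the form \<open>1 - p * v\<close>, which
  is a unit of \<open>R\<close>.\<close>

lemma vr_unit_coprime_int:
  assumes "\<not> int p dvd a"
  shows "vr_unit (of_int a)"
proof -
  have "prime (int p)" using p by simp
  then have "coprime a (int p)" using assms prime_imp_coprime by (metis coprime_commute)
  then obtain u v where "u * a + v * int p = 1" using bezout_int[of a "int p"] by (metis coprime_imp_gcd_eq_1)
  then have "of_int (u * a + v * int p) = (1 :: complex)" by simp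
  then have eq: "of_int u * of_int a = (1 - of_nat p * of_int v :: complex)" by (simp add: algebra_simps)
  note unit = vr_unit_1_minus_p[OF vr_of_int[of v]]
  have "of_int a \<noteq> (0 :: complex)" using assms by auto
  then have "inverse (of_int a) = of_int u * inverse (1 - of_nat p * of_int v :: complex)" 
    using unit by (simp flip: eq)
  then have "inverse (of_int a) \<in> R" using vr_mult[OF vr_of_int unit(2)] by metis
  then show ?thesis using \<open>of_int a \<noteq> 0\<close> by (auto simp: vr_unit_def vr_of_int)
qed

lemma vr_of_int_decompose:
  assumes "a \<noteq> 0"
  shows "vr_unit (of_int a / of_nat p ^ multiplicity (int p) a)"
proof -
  obtain b where b: "a = int p ^ multiplicity (int p) a * b" "\<not> int p dvd b"
    by (rule multiplicity_decompose'[of a "int p"]) (use assms p not_prime_unit[of "int p"] in auto)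
  have "of_int a = (of_nat p ^ multiplicity (int p) a * of_int b :: complex)"
    by (subst b(1)) simp
  then show ?thesis using vr_unit_coprime_int[OF b(2)] p_nz by simp
qed

lemma vr_of_rat_decompose:
  assumes "q \<noteq> 0"
  shows "vr_unit (of_rat q / of_nat p powi (int (multiplicity (int p) (fst (quotient_of q)))
                  - int (multiplicity (int p) (snd (quotient_of q)))))"
proof -
  obtain a b where ab: "quotient_of q = (a, b)" by force
  have b: "b > 0" using quotient_of_denom_pos[OF ab] .
  have q: "q = of_int a / of_int b" using quotient_of_div[OF ab] .
  have a: "a \<noteq> 0" using assms q by auto
  have "vr_unit ((of_int a / of_nat p ^ multiplicity (int p) a) / (of_int b / of_nat p ^ multiplicity (int p) b))"
    using a b by (intro vr_unit_divide vr_of_int_decompose) auto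
  moreover have "of_rat q = (of_int a / of_int b :: complex)" by (simp add: q of_rat_divide)
  ultimately show ?thesis using p_nz by (simp add: ab power_int_diff mult.commute)
qed

text \<open>Divisibility in a valuation ring is total, so a finite family has a member that divides
  all the others.\<close>

lemma vr_dominant:
  assumes "finite I" "I \<noteq> {}" "\<And>i. i \<in> I \<Longrightarrow> a i \<in> \<A> \<and> a i \<noteq> 0"
  shows "\<exists>i\<in>I. \<forall>j\<in>I. a j / a i \<in> R"
  using assms
proof (induction I rule: finite_ne_induct)
  case (singleton i) then show ?case using vr_1 by auto
next
  case (insert k I)
  then obtain i where i: "i \<in> I" "\<forall>j\<in>I. a j / a i \<in> R" by auto
  have "a k / a i \<in> R \<or> inverse (a k / a i) \<in> R"
    using insert i by (intro vr_valuation alg_divide) auto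
  then show ?case
  proof
    assume "a k / a i \<in> R" then show ?thesis using i by auto
  next
    assume "inverse (a k / a i) \<in> R"
    then have ik: "a i / a k \<in> R" by simp
    have "a j / a k \<in> R" if "j \<in> I" for j
      using vr_mult[of "a j / a i" "a i / a k"] i that ik insert.prems by auto
    then show ?thesis using vr_1 insert.prems by (intro bexI[of _ k]) auto
  qed
qed

text \<open>A valuation ring is local: of two nonunits one divides the other, hence also their sum,
  and a divisor of a unit is a unit.\<close>

lemma vr_nonunit_sum:
  assumes "finite I" "\<And>i. i \<in> I \<Longrightarrow> b i \<in> R \<and> \<not> vr_unit (b i)"
  shows "(\<Sum>i\<in>I. b i) \<in> R \<and> \<not> vr_unit (\<Sum>i\<in>I. b i)"
  using assms
proof (induction I rule: finite_induct)
  case empty then show ?case by (auto simp: vr_0 vr_unit_def)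
next
  case (insert k I)
  define s where "s = (\<Sum>i\<in>I. b i)"
  have s: "s \<in> R" "\<not> vr_unit s" and k: "b k \<in> R" "\<not> vr_unit (b k)" using insert by (auto simp: s_def)
  have nu: "\<not> vr_unit (y + z)" if "y \<in> R" "z \<in> R" "\<not> vr_unit z" "z \<noteq> 0" "y / z \<in> R" for y z
  proof
    assume "vr_unit (y + z)"
    then have yz: "y + z \<noteq> 0" "inverse (y + z) \<in> R" by (auto simp: vr_unit_def)
    have "y / z + 1 = (y + z) / z" using that by (simp add: add_divide_distrib)
    then have "inverse z = (y / z + 1) * inverse (y + z)" using yz(1) by (simp add: divide_inverse)
    moreover note yz(2)
    ultimately have "inverse z \<in> R" using vr_mult[OF vr_add[OF that(5) vr_1]] by metis
    then show False using that by (auto simp: vr_unit_def)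
  qed
  have "\<not> vr_unit (b k + s)"
  proof (cases "b k = 0 \<or> s = 0")
    case False
    then have "s / b k \<in> R \<or> inverse (s / b k) \<in> R"
      using s k vr_alg by (intro vr_valuation alg_divide) auto
    then show ?thesis using nu[of s "b k"] nu[of "b k" s] s k False by (auto simp: add.commute)
  qed (use s k in auto)
  then show ?case using insert s k by (auto simp: s_def intro: vr_add)
qed

text \<open>The value of \<open>x\<close>, normalised so that \<open>p\<close> has value 1: some
  power of \<open>x\<close> is a power of \<open>p\<close> up to a unit. It is a relation because
  existence and uniqueness of \<open>r\<close> have to be proved first.\<close>

definition vr_val :: "complex \<Rightarrow> real \<Rightarrow> bool" where
  "vr_val x r \<longleftrightarrow> (\<exists>N k. N > 0 \<and> vr_unit (x ^ N / of_nat p powi k) \<and> r = real_of_int k / real N)"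

text \<open>In a rational relation for \<open>x\<close> no term can dominate all the others
  strictly, so two terms differ by a unit. Their quotient is a rational number times a power of
  \<open>x\<close>, and the rational number is a power of \<open>p\<close> up to a unit.\<close>

lemma vr_val_exists:
  assumes "x \<in> \<A>" "x \<noteq> 0"
  shows "\<exists>r. vr_val x r"
proof -
  obtain f where f: "\<And>i. coeff f i \<in> \<rat>" "f \<noteq> 0" "poly f x = 0" using alg_rat_poly[OF assms(1)] by blast
  define I where "I = {i. i \<le> degree f \<and> coeff f i \<noteq> 0}"
  define a where "a = (\<lambda>i. coeff f i * x ^ i)"
  have a: "a i \<in> \<A> \<and> a i \<noteq> 0" if "i \<in> I" for i
    using that assms alg_closed_under(4)[OF alg_Rats[OF f(1)] alg_power[OF assms(1)]] by (auto simp: I_def a_def)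
  have fin: "finite I" by (simp add: I_def)
  have "degree f \<in> I" using f(2) by (simp add: I_def)
  then have "\<exists>i\<in>I. \<forall>j\<in>I. a j / a i \<in> R" by (intro vr_dominant fin a) auto
  then obtain i where i: "i \<in> I" "\<forall>j\<in>I. a j / a i \<in> R" by blast
  have "(\<Sum>j\<in>I. a j) = poly f x" unfolding poly_altdef a_def by (intro sum.mono_neutral_left) (auto simp: I_def)
  then have "0 = (\<Sum>j\<in>I. a j / a i)" by (simp add: f flip: sum_divide_distrib)
  also have "\<dots> = a i / a i + (\<Sum>j\<in>I-{i}. a j / a i)" using fin i by (intro sum.remove)
  finally have sm: "(\<Sum>j\<in>I-{i}. a j / a i) = - 1" using a i by (simp add: eq_neg_iff_add_eq_0 add.commute)
  \<comment> \<open>After division by the dominant term the remaining terms sum to the unit -1, so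
    they cannot all be nonunits.\<close>
  have "\<exists>j\<in>I-{i}. vr_unit (a j / a i)"
  proof (rule ccontr)
    assume "\<not> ?thesis"
    then have "\<not> vr_unit (- 1)" using vr_nonunit_sum[of "I - {i}" "\<lambda>j. a j / a i"] i fin sm by auto
    then show False using vr_uminus[OF vr_1] by (auto simp: vr_unit_def)
  qed
  then obtain j where j: "j \<in> I" "j \<noteq> i" "vr_unit (a j / a i)" by auto
  \<comment> \<open>The two indices are ordered so that the exponent \<open>i - j\<close> of
    \<open>x\<close> is positive.\<close>
  obtain i j where ij: "i \<in> I" "j \<in> I" "j < i" "vr_unit (a i / a j)"
  proof (cases "j < i")
    case True then show ?thesis using that i j vr_unit_inverse[OF j(3)] by auto
  next
    case False then show ?thesis using that[of j i] i j by auto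
  qed
  have "coeff f i / coeff f j \<in> \<rat>" using f(1) by simp
  then obtain q where q: "coeff f i / coeff f j = of_rat q" by (auto elim: Rats_cases)
  have nz: "coeff f i \<noteq> 0" "coeff f j \<noteq> 0" using ij by (auto simp: I_def)
  then have "q \<noteq> 0" using q by auto
  then obtain k where k: "vr_unit (of_rat q / of_nat p powi k)" using vr_of_rat_decompose by blast
  have "a i / a j = (coeff f i / coeff f j) * (x ^ i / x ^ j)" by (simp add: a_def)
  then have "a i / a j = of_rat q * x ^ (i - j)" using ij assms by (simp only: q) (simp add: power_diff)
  then have "x ^ (i - j) / of_nat p powi (- k) = (a i / a j) / (of_rat q / of_nat p powi k)"
    using \<open>q \<noteq> 0\<close> by (simp add: power_int_minus field_simps)
  then have "vr_unit (x ^ (i - j) / of_nat p powi (- k))" using vr_unit_divide[OF ij(4) k] by simp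
  then show ?thesis unfolding vr_val_def using ij by (metis zero_less_diff)
qed

lemma vr_val_nz: "vr_val x r \<Longrightarrow> x \<noteq> 0"
  by (auto simp: vr_val_def vr_unit_def)

lemma vr_val_mult: 
  assumes "vr_val x r" "vr_val y s" shows "vr_val (x * y) (r + s)"
proof -
  obtain N k M l where a: "N > 0" "vr_unit (x ^ N / of_nat p powi k)" "r = real_of_int k / real N"
    "M > 0" "vr_unit (y ^ M / of_nat p powi l)" "s = real_of_int l / real M"
    using assms by (auto simp: vr_val_def)
  have "vr_unit ((x ^ N / of_nat p powi k) ^ M * (y ^ M / of_nat p powi l) ^ N)"
    using a by (intro vr_unit_mult vr_unit_power)
  also have "(x ^ N / of_nat p powi k) ^ M * (y ^ M / of_nat p powi l) ^ N =
     (x * y) ^ (N * M) / of_nat p powi (k * int M + l * int N)"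
    using p_nz by (simp add: power_divide power_mult_distrib power_int_add power_int_mult mult.commute
      flip: power_mult)
  finally show ?thesis unfolding vr_val_def using a
    by (intro exI[of _ "N * M"] exI[of _ "k * int M + l * int N"]) (auto simp: field_simps)
qed

lemma vr_val_inverse: assumes "vr_val x r" shows "vr_val (inverse x) (- r)"
proof -
  obtain N k where a: "N > 0" "vr_unit (x ^ N / of_nat p powi k)" "r = real_of_int k / real N"
    using assms by (auto simp: vr_val_def)
  have "inverse (x ^ N / of_nat p powi k) = inverse x ^ N / of_nat p powi (- k)"
    by (simp add: power_int_minus power_inverse field_simps)
  then show ?thesis using a vr_unit_inverse[OF a(2)] unfolding vr_val_def
    by (intro exI[of _ N] exI[of _ "- k"]) auto
qed

lemma vr_val_ge_0: assumes "vr_val x r" "x \<in> R" shows "r \<ge> 0"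
proof -
  obtain N k where a: "N > 0" "vr_unit (x ^ N / of_nat p powi k)" "r = real_of_int k / real N"
    using assms by (auto simp: vr_val_def)
  have "of_nat p powi k = x ^ N * inverse (x ^ N / of_nat p powi k)"
    using vr_val_nz[OF assms(1)] by (simp add: field_simps)
  also have "\<dots> \<in> R" using a assms by (intro vr_mult vr_power) (auto simp: vr_unit_def)
  finally show ?thesis using vr_p_powi_iff a by simp
qed

text \<open>A valuation ring is integrally closed: \<open>x ^ N\<close> is in \<open>R\<close>, and
  if \<open>x\<close> were not, then \<open>inverse x\<close> would be and
  \<open>x = x ^ N * inverse x ^ (N - 1)\<close>.\<close>

lemma vr_val_in: assumes "vr_val x r" "r \<ge> 0" "x \<in> \<A>" shows "x \<in> R"
proof -
  obtain N k where a: "N > 0" "vr_unit (x ^ N / of_nat p powi k)" "r = real_of_int k / real N"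
    using assms by (auto simp: vr_val_def)
  have "k \<ge> 0" using a assms(2) by (auto simp: zero_le_divide_iff)
  have "x ^ N = (x ^ N / of_nat p powi k) * of_nat p powi k" using p_nz by simp
  also have "\<dots> \<in> R" using a \<open>k \<ge> 0\<close> by (intro vr_mult) (auto simp: vr_unit_def vr_p_powi_iff)
  finally have xN: "x ^ N \<in> R" .
  show ?thesis
  proof (cases "x \<in> R")
    case False
    then have "inverse x \<in> R" using vr_valuation assms vr_val_nz by blast
    then have "x ^ N * inverse x ^ (N - 1) \<in> R" using vr_mult[OF xN vr_power] by blast
    also have "x ^ N * inverse x ^ (N - 1) = x" using a(1) vr_val_nz[OF assms(1)] 
      by (cases N) (simp_all add: power_inverse field_simps)
    finally show ?thesis .
  qed
qed

lemma vr_val_unique: assumes "vr_val x r" "vr_val x s" shows "r = s"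
proof -
  have rs: "vr_val 1 (r - s)" "vr_val 1 (s - r)"
    using vr_val_mult[OF assms(1) vr_val_inverse[OF assms(2)]] 
      vr_val_mult[OF assms(2) vr_val_inverse[OF assms(1)]] vr_val_nz[OF assms(1)] by simp_all
  show ?thesis using vr_val_ge_0[OF rs(1) vr_1] vr_val_ge_0[OF rs(2) vr_1] by simp
qed

text \<open>The base \<open>p\<close> matches the normalisation of \<open>padic_abs\<close>; 0 has
  no value and is treated separately.\<close>

definition vr_abs :: "complex \<Rightarrow> real" where
  "vr_abs x = (if x = 0 then 0 else real p powr (- (THE r. vr_val x r)))"

lemma vr_abs_eq: "vr_val x r \<Longrightarrow> vr_abs x = real p powr (- r)"
  using vr_val_unique vr_val_nz unfolding vr_abs_def by (auto simp: the_equality)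

lemma real_p: "real p > 1"
  using prime_gt_1_nat[OF p] by simp

lemma vr_abs_mult: assumes "x \<in> \<A>" "y \<in> \<A>" shows "vr_abs (x * y) = vr_abs x * vr_abs y"
proof (cases "x = 0 \<or> y = 0")
  case False
  then obtain r s where "vr_val x r" "vr_val y s" using vr_val_exists assms by blast
  then show ?thesis using real_p by (simp add: vr_abs_eq[OF vr_val_mult] vr_abs_eq flip: powr_add)
qed (auto simp: vr_abs_def)

lemma vr_abs_nonneg: "vr_abs x \<ge> 0"
  by (simp add: vr_abs_def)

text \<open>The ultrametric inequality: \<open>y\<close> has the smaller value and divides
  \<open>x\<close>, so \<open>(x + y) / y\<close> lies in \<open>R\<close> and has nonnegative
  value.\<close>

lemma vr_abs_add_aux:
  assumes "x \<in> \<A>" "y \<in> \<A>" "vr_val x r" "vr_val y s" "r \<ge> s"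
  shows "vr_abs (x + y) \<le> vr_abs y"
proof (cases "x + y = 0")
  case False
  then obtain t where t: "vr_val (x + y) t" using vr_val_exists[OF alg_closed_under(3)[OF assms(1,2)] False] by blast
  have y: "y \<noteq> 0" using vr_val_nz assms(4) by simp
  have "vr_val (x / y) (r - s)" using vr_val_mult[OF assms(3) vr_val_inverse[OF assms(4)]] by (simp add: divide_inverse)
  then have "x / y \<in> R" using assms alg_divide by (intro vr_val_in[of _ "r - s"]) auto
  then have "x / y + 1 \<in> R" by (rule vr_add[OF _ vr_1])
  moreover have "vr_val (x / y + 1) (t - s)" 
    using vr_val_mult[OF t vr_val_inverse[OF assms(4)]] y by (simp add: field_simps)
  ultimately have "t \<ge> s" using vr_val_ge_0[of "x / y + 1" "t - s"] by simp
  then show ?thesis using real_p by (simp add: vr_abs_eq[OF t] vr_abs_eq[OF assms(4)] powr_mono)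
qed (simp add: vr_abs_def)

lemma vr_abs_add: assumes "x \<in> \<A>" "y \<in> \<A>" shows "vr_abs (x + y) \<le> vr_abs x + vr_abs y"
proof (cases "x = 0 \<or> y = 0")
  case False
  then obtain r s where "vr_val x r" "vr_val y s" using vr_val_exists assms by blast
  then show ?thesis using vr_abs_add_aux[of x y r s] vr_abs_add_aux[of y x s r] assms vr_abs_nonneg[of x] vr_abs_nonneg[of y]
    by (cases "r \<ge> s") (auto simp: add.commute)
qed (auto simp: vr_abs_def)

lemma vr_abs_of_rat: "vr_abs (of_rat q) = padic_abs p q"
proof (cases "q = 0")
  case False
  define k where "k = int (multiplicity (int p) (fst (quotient_of q))) - int (multiplicity (int p) (snd (quotient_of q)))"
  have "vr_val (of_rat q) (real_of_int k)" unfolding vr_val_def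
    using vr_of_rat_decompose[OF False] by (intro exI[of _ 1] exI[of _ k]) (simp add: k_def)
  then have "vr_abs (of_rat q) = real p powr (- real_of_int k)" by (rule vr_abs_eq)
  also have "\<dots> = real p powi (- k)" using real_p by (simp add: powr_real_of_int' flip: of_int_minus)
  finally show ?thesis using False by (simp add: padic_abs_def k_def)
qed (auto simp: vr_abs_def padic_abs_def)

lemma padic_extension_exists_aux:
  "\<exists>w. w \<in> absolute_values \<A> \<and> place_below w = padic_abs p"
proof -
  define w where "w = restrict vr_abs \<A>"
  have "w \<in> absolute_values \<A>"
    using vr_abs_nonneg vr_abs_mult vr_abs_add real_p
    by (auto simp: absolute_values_def w_def alg_closed_under, auto simp: vr_abs_def split: if_splits)
  moreover have "place_below w = padic_abs p"
    by (rule ext) (simp add: place_below_def w_def vr_abs_of_rat alg_Rats)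
  ultimately show ?thesis by blast
qed

end

section \<open>Existence of extensions for all rational places\<close>

lemma inverse_prime_notin_Ints: "prime p \<Longrightarrow> inverse (of_nat p :: complex) \<notin> \<int>"
proof
  assume p: "prime p" and "inverse (of_nat p :: complex) \<in> \<int>"
  then obtain n where "inverse (of_nat p :: complex) = of_int n" by (auto elim: Ints_cases)
  then have "of_int (n * int p) = (1 :: complex)" using p by (simp add: field_simps)
  then have "n * int p = 1" by (simp only: of_int_eq_1_iff)
  then show False using p by (metis dvd_triv_right int_dvd_int_iff not_prime_unit of_nat_1)
qed

text \<open>Zorn's lemma starts from the ring of integers, which does not contain
  \<open>1 / p\<close>.\<close>

lemma padic_extension_exists:
  assumes p: "prime p"
  shows "\<exists>w. w \<in> absolute_values \<A> \<and> place_below w = padic_abs p"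
proof -
  have "\<exists>M\<in>Collect (subring_excluding p). \<forall>X\<in>Collect (subring_excluding p). M \<subseteq> X \<longrightarrow> X = M"
  proof (rule subset_Zorn_nonempty)
    have "subring_excluding p \<int>" using inverse_prime_notin_Ints[OF p] 
      by (auto simp: subring_excluding_def Ints_subset_Rats[THEN subsetD] alg_Rats)
    then show "Collect (subring_excluding p) \<noteq> {}" by auto
    fix C assume C: "C \<noteq> {}" "subset.chain (Collect (subring_excluding p)) C"
    have sr: "subring_excluding p S" if "S \<in> C" for S using C that by (auto simp: subset_chain_def)
    have common: "\<exists>S\<in>C. x \<in> S \<and> y \<in> S" if "x \<in> \<Union>C" "y \<in> \<Union>C" for x y
      using C(2) that unfolding subset_chain_def by blast
    have "subring_excluding p (\<Union>C)" unfolding subring_excluding_def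
    proof (intro conjI ballI)
      show "\<Union>C \<subseteq> \<A>" "inverse (of_nat p) \<notin> \<Union>C" using sr by (auto simp: subring_excluding_def)
      show "1 \<in> \<Union>C" using sr C(1) by (fastforce simp: subring_excluding_def)
      fix x y assume "x \<in> \<Union>C" "y \<in> \<Union>C"
      then obtain S where "S \<in> C" "x \<in> S" "y \<in> S" using common by blast
      then show "x + y \<in> \<Union>C" "x * y \<in> \<Union>C" "- x \<in> \<Union>C" 
        using sr[of S] by (auto simp: subring_excluding_def)
    qed
    then show "\<Union>C \<in> Collect (subring_excluding p)" by simp
  qed
  then obtain M where "subring_excluding p M" "\<And>X. subring_excluding p X \<Longrightarrow> M \<subseteq> X \<Longrightarrow> X = M" by auto
  then show ?thesis using padic_extension_exists_aux[OF p, of M] by blast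
qed

lemma norm_of_rat_complex: "cmod (of_rat q) = \<bar>real_of_rat q\<bar>"
proof -
  have "of_rat q = complex_of_real (of_rat q)" by (cases q) (simp add: of_rat_rat)
  then show ?thesis by (metis norm_of_real)
qed

text \<open>This justifies the choice made in the definition of \<open>extended_place\<close>. At
  the archimedean place the complex modulus is a possible extension.\<close>

lemma extended_place:
  assumes "v \<in> rational_places"
  shows "extended_place v \<in> absolute_values \<A>" "place_below (extended_place v) = v"
proof -
  have "\<exists>w. w \<in> absolute_values \<A> \<and> place_below w = v"
  proof (cases "v = (\<lambda>q. real_of_rat \<bar>q\<bar>)")
    case True
    have "restrict cmod \<A> \<in> absolute_values \<A>"
      by (auto simp: absolute_values_def alg_closed_under norm_mult norm_triangle_ineq)
    moreover have "place_below (restrict cmod \<A>) = v"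
      by (rule ext) (auto simp: place_below_def alg_Rats True norm_of_rat_complex)
    ultimately show ?thesis by blast
  next
    case False
    then show ?thesis using assms padic_extension_exists by (auto simp: rational_places_def)
  qed
  then have "extended_place v \<in> absolute_values \<A> \<and> place_below (extended_place v) = v"
    unfolding extended_place_def by (rule someI_ex)
  then show "extended_place v \<in> absolute_values \<A>" "place_below (extended_place v) = v" by auto
qed

section \<open>Absolute values, averages and heights\<close>

text \<open>Unlike in \<open>absolute_values\<close>, nothing is prescribed outside the algebraic
  numbers, so composition with an automorphism stays in this class. A bound for all such
  \<open>w\<close> is therefore uniform in the automorphism.\<close>

definition extends_place :: "(rat \<Rightarrow> real) \<Rightarrow> (complex \<Rightarrow> real) \<Rightarrow> bool" where
  "extends_place v w \<longleftrightarrow> v \<in> rational_places \<and> (\<forall>x\<in>\<A>. w x \<ge> 0 \<and> (w x = 0 \<longleftrightarrow> x = 0)) \<and>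
     (\<forall>x\<in>\<A>. \<forall>y\<in>\<A>. w (x * y) = w x * w y \<and> w (x + y) \<le> w x + w y) \<and> (\<forall>q. w (of_rat q) = v q)"

lemma extends_place_extended:
  assumes "v \<in> rational_places" "\<sigma> \<in> alg_auts"
  shows "extends_place v (\<lambda>x. extended_place v (\<sigma> x))"
  using extended_place[OF assms(1)] assms 
  by (auto simp: extends_place_def absolute_values_def place_below_def aut_alg aut_add aut_mult 
      aut_eq_0_iff aut_Rats fun_eq_iff)

text \<open>The price of estimating a sum of \<open>N\<close> terms by the largest one. The test
  \<open>w 2 > 1\<close> recognises the archimedean place; elsewhere the price is 1.\<close>

definition arch_const :: "(complex \<Rightarrow> real) \<Rightarrow> real \<Rightarrow> real" where
  "arch_const w N = (if w 2 > 1 then N else 1)"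

context
  fixes v w assumes vw: "extends_place v w"
begin

lemma w_nonneg: "x \<in> \<A> \<Longrightarrow> w x \<ge> 0" and w_0_iff: "x \<in> \<A> \<Longrightarrow> w x = 0 \<longleftrightarrow> x = 0"
  and w_mult: "x \<in> \<A> \<Longrightarrow> y \<in> \<A> \<Longrightarrow> w (x * y) = w x * w y"
  and w_add: "x \<in> \<A> \<Longrightarrow> y \<in> \<A> \<Longrightarrow> w (x + y) \<le> w x + w y"
  and w_rat: "w (of_rat q) = v q" and v_place: "v \<in> rational_places"
  using vw by (auto simp: extends_place_def)

lemma w_0: "w 0 = 0"
  using w_0_iff alg_closed_under(1) by blast

lemma w_1: "w 1 = 1"
  using w_mult[of 1 1] w_0_iff[of 1] alg_closed_under(2) by simp

lemma w_power: "x \<in> \<A> \<Longrightarrow> w (x ^ n) = w x ^ n"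
  by (induction n) (auto simp: w_1 w_mult alg_power)

lemma w_inverse: "x \<in> \<A> \<Longrightarrow> w (inverse x) = inverse (w x)"
  using w_mult[of x "inverse x"] w_0_iff[of x] w_0 w_1 alg_closed_under(6)[of x]
  by (cases "x = 0") (auto simp: inverse_unique)

lemma w_minus: assumes "x \<in> \<A>" shows "w (- x) = w x"
proof -
  have "w (- 1) * w (- 1) = 1" using w_mult[of "-1" "-1"] alg_closed_under(5)[OF alg_closed_under(2)] w_1 by simp
  then have "w (- 1) = 1" using w_nonneg[of "-1"] alg_closed_under(5)[OF alg_closed_under(2)] 
    by (simp add: square_eq_1_iff)
  then show ?thesis using w_mult[of "-1" x] alg_closed_under(5)[OF alg_closed_under(2)] assms by simp
qed

lemma w_sum_le:
  assumes "\<And>i. i \<in> I \<Longrightarrow> f i \<in> \<A>"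
  shows "w (\<Sum>i\<in>I. f i) \<le> (\<Sum>i\<in>I. w (f i))"
  using assms
proof (induction I rule: infinite_finite_induct)
  case (insert i I)
  have "w (f i + (\<Sum>i\<in>I. f i)) \<le> w (f i) + w (\<Sum>i\<in>I. f i)"
    using insert.prems by (intro w_add alg_sum) auto
  then show ?case using insert by auto
qed (auto simp: w_0)

lemma place_cases:
  "v = (\<lambda>q. real_of_rat \<bar>q\<bar>) \<or> (\<exists>p. prime p \<and> v = padic_abs p)"
  using v_place by (auto simp: rational_places_def)

lemma padic_abs_int_le: assumes "prime p" shows "padic_abs p (of_int n) \<le> 1"
proof -
  have "multiplicity (int p) 1 = 0" using assms by (simp add: prime_gt_1_nat)
  then show ?thesis using prime_gt_1_nat[OF assms]
    by (auto simp: padic_abs_def power_int_minus field_simps)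
qed

lemma arch_iff: "w 2 > 1 \<longleftrightarrow> v = (\<lambda>q. real_of_rat \<bar>q\<bar>)"
proof -
  have w2: "w 2 = v 2" using w_rat[of 2] by simp
  show ?thesis using place_cases
  proof
    assume "v = (\<lambda>q. real_of_rat \<bar>q\<bar>)" then show ?thesis using w2 by simp
  next
    assume "\<exists>p. prime p \<and> v = padic_abs p"
    then have "v 2 \<le> 1" using padic_abs_int_le[of _ 2] by auto
    then show ?thesis using w2 by auto
  qed
qed

lemma nonarch_int: assumes "\<not> w 2 > 1" shows "w (of_int n) \<le> 1"
proof -
  obtain p where "prime p" "v = padic_abs p" using assms arch_iff place_cases by blast
  then show ?thesis using w_rat[of "of_int n"] padic_abs_int_le[of p n] by simp
qed

text \<open>Binomial coefficients have absolute value at most 1, so \<open>w (x + y) ^ n\<close> is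
  at most \<open>(n + 1) * B ^ n\<close>. If \<open>w (x + y)\<close> exceeded \<open>B\<close>, the
  powers of the ratio would outgrow \<open>n + 1\<close>.\<close>

lemma nonarch_add:
  assumes na: "\<not> w 2 > 1" and xy: "x \<in> \<A>" "y \<in> \<A>" and B: "w x \<le> B" "w y \<le> B"
  shows "w (x + y) \<le> B"
proof (rule ccontr)
  assume "\<not> w (x + y) \<le> B"
  then have gt: "w (x + y) > B" by simp
  have B0: "B \<ge> 0" using B w_nonneg[OF xy(1)] by simp
  have bound: "w (x + y) ^ n \<le> real (n + 1) * B ^ n" for n
  proof -
    have "w (x + y) ^ n = w (\<Sum>k\<le>n. of_nat (n choose k) * x ^ k * y ^ (n - k))"
      using w_power[OF alg_closed_under(3)[OF xy]] by (simp add: binomial_ring)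
    also have "\<dots> \<le> (\<Sum>k\<le>n. w (of_nat (n choose k) * x ^ k * y ^ (n - k)))"
      using xy by (intro w_sum_le alg_closed_under(4) alg_power alg_Rats[OF Rats_of_nat])
    also have "\<dots> \<le> (\<Sum>k\<le>n. B ^ n)"
    proof (intro sum_mono)
      fix k assume k: "k \<in> {..n}"
      have "w (of_nat (n choose k) * x ^ k * y ^ (n - k)) = w (of_nat (n choose k)) * (w x ^ k * w y ^ (n - k))"
        using xy by (simp add: w_mult w_power alg_closed_under(4) alg_power alg_Rats[OF Rats_of_nat])
      also have "\<dots> \<le> 1 * (B ^ k * B ^ (n - k))"
        using nonarch_int[OF na, of "int (n choose k)"] B B0 w_nonneg[OF xy(1)] w_nonneg[OF xy(2)] w_nonneg[of "of_nat (n choose k)"]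
        by (intro mult_mono power_mono mult_nonneg_nonneg zero_le_power) (auto simp: alg_Rats)
      also have "\<dots> = B ^ n" using k by (simp flip: power_add)
      finally show "w (of_nat (n choose k) * x ^ k * y ^ (n - k)) \<le> B ^ n" .
    qed
    finally show ?thesis by simp
  qed
  show False
  proof (cases "B = 0")
    case True
    then show False using bound[of 1] gt by simp
  next
    case False
    define r where "r = w (x + y) / B"
    have r: "r > 1" using gt False B0 by (simp add: r_def)
    have "r ^ n \<le> real n + 1" for n using bound[of n] False B0 by (simp add: r_def power_divide field_simps)
    moreover have "(\<lambda>n. (real n + 1) / r ^ n) \<longlonglongrightarrow> 0"
    proof -
      have "(\<lambda>n. real n / r ^ n + (1 / r) ^ n) \<longlonglongrightarrow> 0 + 0"
        using r by (intro tendsto_add lim_n_over_pown LIMSEQ_power_zero) auto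
      then show ?thesis by (simp add: add_divide_distrib power_divide)
    qed
    then have "eventually (\<lambda>n. (real n + 1) / r ^ n < 1) sequentially" by (rule order_tendstoD) simp
    then obtain n where "(real n + 1) / r ^ n < 1" using eventually_happens by force
    then have "real n + 1 < r ^ n" using r by (simp add: field_simps)
    ultimately show False by (meson not_le)
  qed
qed

lemma w_sum_bound:
  assumes "\<And>i. i \<in> I \<Longrightarrow> f i \<in> \<A>" "\<And>i. i \<in> I \<Longrightarrow> w (f i) \<le> B" "B \<ge> 0" "real (card I) \<le> N"
  shows "w (\<Sum>i\<in>I. f i) \<le> arch_const w N * B"
proof (cases "w 2 > 1")
  case True
  have "w (\<Sum>i\<in>I. f i) \<le> (\<Sum>i\<in>I. w (f i))" by (intro w_sum_le assms)
  also have "\<dots> \<le> (\<Sum>i\<in>I. B)" by (intro sum_mono assms)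
  also have "\<dots> \<le> N * B" using assms by (auto intro: mult_right_mono)
  finally show ?thesis using True by (simp add: arch_const_def)
next
  case False
  have "w (\<Sum>i\<in>I. f i) \<le> B" using assms(1,2)
    by (induction I rule: infinite_finite_induct) (auto simp: w_0 assms(3) intro!: nonarch_add False alg_sum)
  then show ?thesis using False by (simp add: arch_const_def)
qed

end

section \<open>The places at which an algebraic number has absolute value other than 1\<close>

lemma finite_place_gt_1: "finite {v \<in> rational_places. v q > 1}"
proof -
  define D where "D = {p. p dvd nat (snd (quotient_of q))}"
  have "nat (snd (quotient_of q)) > 0" using quotient_of_denom_pos' by simp
  then have "finite D" by (simp add: D_def)
  have "{v \<in> rational_places. v q > 1} \<subseteq> insert (\<lambda>q. real_of_rat \<bar>q\<bar>) (padic_abs ` D)"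
  proof
    fix v assume v: "v \<in> {v \<in> rational_places. v q > 1}"
    then consider "v = (\<lambda>q. real_of_rat \<bar>q\<bar>)" | p where "prime p" "v = padic_abs p" 
      by (auto simp: rational_places_def)
    then show "v \<in> insert (\<lambda>q. real_of_rat \<bar>q\<bar>) (padic_abs ` D)"
    proof cases
      case 2
      have "int p dvd snd (quotient_of q)"
      proof (rule ccontr)
        assume "\<not> ?thesis"
        then have "multiplicity (int p) (snd (quotient_of q)) = 0" by (simp add: not_dvd_imp_multiplicity_0)
        then have "padic_abs p q \<le> 1" using prime_gt_1_nat[OF 2(1)]
          by (auto simp: padic_abs_def power_int_minus field_simps)
        then show False using v 2 by simp
      qed
      then have "p \<in> D" using quotient_of_denom_pos'[of q] 
        by (metis D_def int_dvd_int_iff int_nat_eq less_imp_le mem_Collect_eq)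
      then show ?thesis using 2 by blast
    qed simp
  qed
  then show ?thesis using \<open>finite D\<close> by (meson finite.insertI finite_imageI finite_subset)
qed

text \<open>Take a monic rational relation for \<open>x\<close>. Away from the archimedean place and
  the finitely many places where a coefficient exceeds 1, \<open>w x > 1\<close> would make
  \<open>x ^ d\<close> larger than the sum of the other terms. This argument covers all extensions
  of a place at once.\<close>

lemma finite_abs_gt_1:
  assumes "x \<in> \<A>"
  shows "finite {v. \<exists>w. extends_place v w \<and> w x > 1}"
proof -
  obtain f where f: "\<And>i. coeff f i \<in> \<rat>" "f \<noteq> 0" "poly f x = 0" using alg_rat_poly[OF assms] by blast
  define c where "c = (\<lambda>i. - (coeff f i / lead_coeff f))"
  define d where "d = degree f"
  have "c i \<in> \<rat>" for i using f(1) by (simp add: c_def)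
  then have "\<forall>i. \<exists>q. c i = of_rat q" by (metis Rats_cases)
  then obtain q where q: "\<And>i. c i = of_rat (q i)" by metis
  have x: "x ^ d = (\<Sum>i<d. c i * x ^ i)" using monic_relation[OF f(3,2)] by (simp add: d_def c_def)
  have "{v. \<exists>w. extends_place v w \<and> w x > 1} \<subseteq> 
     insert (\<lambda>q. real_of_rat \<bar>q\<bar>) (\<Union>i<d. {v \<in> rational_places. v (q i) > 1})"
  proof (rule subsetI, rule ccontr)
    fix v assume v: "v \<in> {v. \<exists>w. extends_place v w \<and> w x > 1}" 
      "v \<notin> insert (\<lambda>q. real_of_rat \<bar>q\<bar>) (\<Union>i<d. {v \<in> rational_places. v (q i) > 1})"
    then obtain w where w: "extends_place v w" "w x > 1" by blast
    have na: "\<not> w 2 > 1" using arch_iff[OF w(1)] v by blast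
    have qi: "w (c i) \<le> 1" if "i < d" for i using v that v_place[OF w(1)] w_rat[OF w(1)] by (force simp: q)
    have cA: "c i \<in> \<A>" for i by (simp add: q alg_Rats)
    have "d > 0" using x by (cases d) auto
    have "w (\<Sum>i<d. c i * x ^ i) \<le> arch_const w d * w x ^ (d - 1)"
    proof (rule w_sum_bound[OF w(1)])
      fix i assume i: "i \<in> {..<d}"
      then show "c i * x ^ i \<in> \<A>" using cA assms by (intro alg_closed_under alg_power)
      have "w (c i * x ^ i) = w (c i) * w x ^ i" using cA assms w(1) by (simp add: w_mult w_power alg_power)
      also have "\<dots> \<le> 1 * w x ^ (d - 1)" using qi[of i] i w \<open>d > 0\<close> 
        by (intro mult_mono power_increasing) auto
      finally show "w (c i * x ^ i) \<le> w x ^ (d - 1)" by simp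
    qed (use w in auto)
    then have "w x ^ d \<le> w x ^ (d - 1)" using na w_power[OF w(1) assms, of d] by (simp add: x arch_const_def)
    moreover have "w x ^ (d - 1) < w x ^ d" using w(2) \<open>d > 0\<close> by (intro power_strict_increasing) auto
    ultimately show False by simp
  qed
  then show ?thesis by (rule finite_subset) (auto intro: finite_place_gt_1)
qed

lemma finite_abs_ne_1:
  assumes "x \<in> \<A>" "x \<noteq> 0"
  shows "finite {v. \<exists>w. extends_place v w \<and> w x \<noteq> 1}"
proof -
  have "{v. \<exists>w. extends_place v w \<and> w x \<noteq> 1} \<subseteq>
    {v. \<exists>w. extends_place v w \<and> w x > 1} \<union> {v. \<exists>w. extends_place v w \<and> w (inverse x) > 1}"
  proof
    fix v assume "v \<in> {v. \<exists>w. extends_place v w \<and> w x \<noteq> 1}"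
    then obtain w where w: "extends_place v w" "w x \<noteq> 1" by blast
    then have "w x > 0" using w_nonneg w_0_iff assms by (metis less_eq_real_def)
    then show "v \<in> {v. \<exists>w. extends_place v w \<and> w x > 1} \<union> {v. \<exists>w. extends_place v w \<and> w (inverse x) > 1}"
    proof (cases "w x > 1")
      case False
      then have "w (inverse x) > 1" using w w_inverse[OF w(1) assms(1)] \<open>w x > 0\<close> by (simp add: one_less_inverse)
      then show ?thesis using w by blast
    qed (use w in auto)
  qed
  then show ?thesis using finite_abs_gt_1 assms alg_closed_under(6) by (meson finite_UnI finite_subset)
qed

text \<open>The mean of a function that depends on the values at a finite set \<open>S\<close> is taken over the restrictions to
  \<open>S\<close>. The maps between these sets of restrictions have fibres of equal size, so \<open>S\<close> does not matter.\<close>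

definition depends_on :: "complex set \<Rightarrow> ((complex \<Rightarrow> complex) \<Rightarrow> real) \<Rightarrow> bool" where
  "depends_on S F \<longleftrightarrow> finite S \<and> S \<subseteq> \<A> \<and>
     (\<forall>\<sigma>\<in>alg_auts. \<forall>\<tau>\<in>alg_auts. (\<forall>x\<in>S. \<sigma> x = \<tau> x) \<longrightarrow> F \<sigma> = F \<tau>)"

definition restrictions :: "complex set \<Rightarrow> (complex \<Rightarrow> complex) set" where
  "restrictions S = (\<lambda>\<sigma>. restrict \<sigma> S) ` alg_auts"

definition aut_rep :: "complex set \<Rightarrow> (complex \<Rightarrow> complex) \<Rightarrow> (complex \<Rightarrow> complex)" where
  "aut_rep S \<tau> = (SOME \<sigma>. \<sigma> \<in> alg_auts \<and> restrict \<sigma> S = \<tau>)"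

definition mean_on :: "complex set \<Rightarrow> ((complex \<Rightarrow> complex) \<Rightarrow> real) \<Rightarrow> real" where
  "mean_on S F = (\<Sum>\<tau>\<in>restrictions S. F (aut_rep S \<tau>)) / card (restrictions S)"

lemma aut_rep:
  assumes "\<tau> \<in> restrictions S"
  shows "aut_rep S \<tau> \<in> alg_auts" "restrict (aut_rep S \<tau>) S = \<tau>"
  using someI_ex[of "\<lambda>\<sigma>. \<sigma> \<in> alg_auts \<and> restrict \<sigma> S = \<tau>"] assms
  by (auto simp: aut_rep_def restrictions_def)

lemma finite_conjugates: assumes "x \<in> \<A>" shows "finite ((\<lambda>\<sigma>. \<sigma> x) ` alg_auts)"
proof -
  obtain f where f: "\<And>i. coeff f i \<in> \<rat>" "f \<noteq> 0" "poly f x = 0" using alg_rat_poly[OF assms] by blast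
  have "(\<lambda>\<sigma>. \<sigma> x) ` alg_auts \<subseteq> {y. poly f y = 0}"
    using aut_rat_poly[OF _ f(1) assms] f(3) aut_0 by auto
  then show ?thesis using poly_roots_finite[OF f(2)] finite_subset by blast
qed

lemma finite_restrictions: assumes "finite S" "S \<subseteq> \<A>" shows "finite (restrictions S)"
proof -
  have "restrictions S \<subseteq> S \<rightarrow>\<^sub>E (\<Union>x\<in>S. (\<lambda>\<sigma>. \<sigma> x) ` alg_auts)" by (auto simp: restrictions_def)
  moreover have "finite (S \<rightarrow>\<^sub>E (\<Union>x\<in>S. (\<lambda>\<sigma>. \<sigma> x) ` alg_auts))"
    using assms finite_conjugates by (intro finite_PiE) auto
  ultimately show ?thesis using finite_subset by blast
qed

lemma card_restrictions: assumes "finite S" "S \<subseteq> \<A>" shows "card (restrictions S) > 0"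
proof -
  have "restrictions S \<noteq> {}" using aut_id by (auto simp: restrictions_def)
  then show ?thesis using finite_restrictions[OF assms] by (simp add: card_gt_0_iff)
qed

text \<open>Composing with the inverse of \<open>\<sigma>\<close> followed by \<open>\<rho>\<close>
  maps one fibre injectively into the other. Used in both directions, this shows that all fibres
  have the same size.\<close>

lemma restriction_fibre_card_le:
  assumes "\<sigma> \<in> alg_auts" "\<rho> \<in> alg_auts" "S \<subseteq> T" "finite T" "T \<subseteq> \<A>"
  shows "card {\<tau> \<in> restrictions T. restrict \<tau> S = restrict \<sigma> S} \<le> 
         card {\<tau> \<in> restrictions T. restrict \<tau> S = restrict \<rho> S}"
proof -
  obtain \<sigma>' where \<sigma>': "\<sigma>' \<in> alg_auts" "\<forall>x\<in>\<A>. \<sigma>' (\<sigma> x) = x"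
    using aut_inv[OF assms(1)] by blast
  define \<kappa> where "\<kappa> = \<rho> \<circ> \<sigma>'"
  have \<kappa>: "\<kappa> \<in> alg_auts" unfolding \<kappa>_def by (intro aut_comp assms \<sigma>')
  let ?f = "\<lambda>\<tau>. restrict (\<kappa> \<circ> \<tau>) T"
  have alg: "\<tau> x \<in> \<A>" if "\<tau> \<in> restrictions T" "x \<in> T" for \<tau> x
    using that assms aut_alg by (auto simp: restrictions_def)
  have inj: "inj_on ?f {\<tau> \<in> restrictions T. restrict \<tau> S = restrict \<sigma> S}"
  proof (rule inj_onI)
    fix \<tau> \<tau>' assume a: "\<tau> \<in> {\<tau> \<in> restrictions T. restrict \<tau> S = restrict \<sigma> S}"
      "\<tau>' \<in> {\<tau> \<in> restrictions T. restrict \<tau> S = restrict \<sigma> S}" "?f \<tau> = ?f \<tau>'"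
    have "\<tau> x = \<tau>' x" if x: "x \<in> T" for x
    proof (rule inj_onD[OF aut_inj[OF \<kappa>]])
      show "\<kappa> (\<tau> x) = \<kappa> (\<tau>' x)" using fun_cong[OF a(3), of x] x by simp
    qed (use alg a x in auto)
    moreover have "\<tau> \<in> extensional T" "\<tau>' \<in> extensional T" using a by (auto simp: restrictions_def)
    ultimately show "\<tau> = \<tau>'" by (auto intro: extensionalityI)
  qed
  have sub: "?f ` {\<tau> \<in> restrictions T. restrict \<tau> S = restrict \<sigma> S} \<subseteq> {\<tau> \<in> restrictions T. restrict \<tau> S = restrict \<rho> S}"
  proof (clarify, intro conjI)
    fix \<tau> assume t: "\<tau> \<in> restrictions T" "restrict \<tau> S = restrict \<sigma> S"
    then obtain \<tau>' where "\<tau>' \<in> alg_auts" "\<tau> = restrict \<tau>' T" by (auto simp: restrictions_def)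
    moreover then have "?f \<tau> = restrict (\<kappa> \<circ> \<tau>') T" by (auto simp: restrict_def)
    ultimately show "?f \<tau> \<in> restrictions T" using aut_comp[OF \<kappa>] by (auto simp: restrictions_def)
    show "restrict (?f \<tau>) S = restrict \<rho> S"
    proof (rule restrict_ext)
      fix x assume x: "x \<in> S"
      then have "\<tau> x = \<sigma> x" using t(2) by (metis restrict_apply')
      then show "?f \<tau> x = \<rho> x" using x assms \<sigma>' by (auto simp: \<kappa>_def)
    qed
  qed
  have "finite {\<tau> \<in> restrictions T. restrict \<tau> S = restrict \<rho> S}"
    using finite_restrictions assms by simp
  then show ?thesis by (rule card_inj_on_le[OF inj sub])
qed

lemma mean_on_superset:
  assumes F: "depends_on S F" and T: "S \<subseteq> T" "finite T" "T \<subseteq> \<A>"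
  shows "mean_on T F = mean_on S F"
proof -
  have S: "finite S" "S \<subseteq> \<A>" using F by (auto simp: depends_on_def)
  \<comment> \<open>The common size of the fibres, read off at the identity.\<close>
  define c where "c = card {\<tau> \<in> restrictions T. restrict \<tau> S = restrict id S}"
  have fib: "card {\<tau> \<in> restrictions T. restrict \<tau> S = \<rho>} = c" if \<rho>: "\<rho> \<in> restrictions S" for \<rho>
  proof -
    obtain \<sigma> where "\<sigma> \<in> alg_auts" "\<rho> = restrict \<sigma> S" using \<rho> by (auto simp: restrictions_def)
    then show ?thesis unfolding c_def by (simp add: antisym restriction_fibre_card_le[OF _ _ T] aut_id)
  qed
  have sub: "(\<lambda>\<tau>. restrict \<tau> S) ` restrictions T \<subseteq> restrictions S"
  proof clarify
    fix \<tau> assume "\<tau> \<in> restrictions T"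
    then obtain \<sigma> where "\<sigma> \<in> alg_auts" "\<tau> = restrict \<sigma> T" by (auto simp: restrictions_def)
    moreover then have "restrict \<tau> S = restrict \<sigma> S" using T(1) by (auto simp: fun_eq_iff)
    ultimately show "restrict \<tau> S \<in> restrictions S" by (auto simp: restrictions_def)
  qed
  have eq: "F (aut_rep T \<tau>) = F (aut_rep S (restrict \<tau> S))" if t: "\<tau> \<in> restrictions T" for \<tau>
  proof -
    have r: "restrict \<tau> S \<in> restrictions S" using sub t by blast
    have "aut_rep T \<tau> x = aut_rep S (restrict \<tau> S) x" if x: "x \<in> S" for x
      using fun_cong[OF aut_rep(2)[OF t], of x] fun_cong[OF aut_rep(2)[OF r], of x] x T(1) by auto
    then show ?thesis using F aut_rep(1)[OF r] aut_rep(1)[OF t] unfolding depends_on_def by blast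
  qed
  have fin: "finite (restrictions T)" "finite (restrictions S)" using finite_restrictions T S by auto
  have "(\<Sum>\<tau>\<in>restrictions T. F (aut_rep T \<tau>)) = 
     (\<Sum>\<rho>\<in>restrictions S. \<Sum>\<tau>\<in>{\<tau> \<in> restrictions T. restrict \<tau> S = \<rho>}. F (aut_rep T \<tau>))"
    by (rule sum.group[OF fin sub, symmetric])
  also have "\<dots> = (\<Sum>\<rho>\<in>restrictions S. c * F (aut_rep S \<rho>))"
    by (intro sum.cong refl) (simp add: eq fib)
  finally have 1: "(\<Sum>\<tau>\<in>restrictions T. F (aut_rep T \<tau>)) = c * (\<Sum>\<rho>\<in>restrictions S. F (aut_rep S \<rho>))"
    by (simp add: sum_distrib_left)
  have "card (restrictions T) = (\<Sum>\<rho>\<in>restrictions S. \<Sum>\<tau>\<in>{\<tau> \<in> restrictions T. restrict \<tau> S = \<rho>}. 1)"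
    using sum.group[OF fin sub, of "\<lambda>_. 1::nat"] by simp
  also have "\<dots> = c * card (restrictions S)" by (simp add: fib)
  finally have 2: "card (restrictions T) = c * card (restrictions S)" .
  have "card (restrictions T) > 0" using card_restrictions T by simp
  then have "c > 0" using 2 by (cases c) auto
  then show ?thesis unfolding mean_on_def 1 2 by simp
qed

definition aut_mean :: "((complex \<Rightarrow> complex) \<Rightarrow> real) \<Rightarrow> real" where
  "aut_mean F = mean_on (SOME S. depends_on S F) F"

text \<open>Two possible sets are compared through their union, so the choice in
  \<open>aut_mean\<close> does not affect the mean.\<close>

lemma aut_mean_eq: assumes "depends_on S F" shows "aut_mean F = mean_on S F"
proof -
  define T where "T = (SOME S. depends_on S F)"
  have T: "depends_on T F" unfolding T_def using someI[of "\<lambda>S. depends_on S F"] assms by blast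
  have fin: "finite (S \<union> T)" "S \<union> T \<subseteq> \<A>" using assms T unfolding depends_on_def by blast+
  have "mean_on (S \<union> T) F = mean_on S F" "mean_on (S \<union> T) F = mean_on T F"
    by (rule mean_on_superset[OF assms _ fin] mean_on_superset[OF T _ fin], blast)+
  then show ?thesis unfolding aut_mean_def T_def[symmetric] by simp
qed

text \<open>Local terms are functions of an absolute value \<open>w\<close>, which \<open>place_sum\<close> evaluates at \<open>w x = |\<sigma> x|\<^sub>v\<close>.\<close>

definition local_term :: "complex set \<Rightarrow> ((complex \<Rightarrow> real) \<Rightarrow> real) \<Rightarrow> bool" where
  "local_term S \<Phi> \<longleftrightarrow> finite S \<and> S \<subseteq> \<A> \<and> (\<forall>w w'. (\<forall>x\<in>S. w x = w' x) \<longrightarrow> \<Phi> w = \<Phi> w') \<and>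
     finite {v. \<exists>w. extends_place v w \<and> \<Phi> w \<noteq> 0}"

definition place_sum :: "((complex \<Rightarrow> real) \<Rightarrow> real) \<Rightarrow> (complex \<Rightarrow> complex) \<Rightarrow> real" where
  "place_sum \<Phi> \<sigma> = (\<Sum>\<^sub>\<infinity>v\<in>rational_places. \<Phi> (\<lambda>x. extended_place v (\<sigma> x)))"

definition global_sum :: "((complex \<Rightarrow> real) \<Rightarrow> real) \<Rightarrow> real" where
  "global_sum \<Phi> = aut_mean (place_sum \<Phi>)"

lemma local_term_superset: "local_term S \<Phi> \<Longrightarrow> S \<subseteq> T \<Longrightarrow> finite T \<Longrightarrow> T \<subseteq> \<A> \<Longrightarrow> local_term T \<Phi>"
  by (auto simp: local_term_def subset_iff)

lemma local_term_depends: "local_term S \<Phi> \<Longrightarrow> depends_on S (place_sum \<Phi>)"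
  unfolding local_term_def depends_on_def place_sum_def
  by (intro conjI ballI impI infsum_cong) auto

lemma local_term_summable:
  assumes "local_term S \<Phi>" "\<sigma> \<in> alg_auts"
  shows "(\<lambda>v. \<Phi> (\<lambda>x. extended_place v (\<sigma> x))) summable_on rational_places"
proof (rule finite_nonzero_values_imp_summable_on)
  have "{v \<in> rational_places. \<Phi> (\<lambda>x. extended_place v (\<sigma> x)) \<noteq> 0} \<subseteq> {v. \<exists>w. extends_place v w \<and> \<Phi> w \<noteq> 0}"
    using extends_place_extended assms by blast
  then show "finite {v \<in> rational_places. \<Phi> (\<lambda>x. extended_place v (\<sigma> x)) \<noteq> 0}"
    using assms finite_subset unfolding local_term_def by blast
qed

lemma local_term_add:
  assumes "local_term S \<Phi>" "local_term T \<Psi>" shows "local_term (S \<union> T) (\<lambda>w. \<Phi> w + \<Psi> w)"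
proof -
  have "finite {v. \<exists>w. extends_place v w \<and> \<Phi> w + \<Psi> w \<noteq> 0}"
    by (rule finite_subset[of _ "{v. \<exists>w. extends_place v w \<and> \<Phi> w \<noteq> 0} \<union> {v. \<exists>w. extends_place v w \<and> \<Psi> w \<noteq> 0}"])
      (use assms in \<open>auto simp: local_term_def\<close>)
  then show ?thesis using assms unfolding local_term_def by (metis Un_iff Un_least finite_UnI)
qed

lemma local_term_cmult:
  assumes "local_term S \<Phi>" shows "local_term S (\<lambda>w. c * \<Phi> w)"
proof -
  have "finite {v. \<exists>w. extends_place v w \<and> c * \<Phi> w \<noteq> 0}"
    by (rule finite_subset[of _ "{v. \<exists>w. extends_place v w \<and> \<Phi> w \<noteq> 0}"])
      (use assms in \<open>auto simp: local_term_def\<close>)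
  then show ?thesis using assms unfolding local_term_def by metis
qed

lemma global_sum_eq: "local_term S \<Phi> \<Longrightarrow> global_sum \<Phi> = mean_on S (place_sum \<Phi>)"
  unfolding global_sum_def by (intro aut_mean_eq local_term_depends)

lemma global_sum_add:
  assumes "local_term S \<Phi>" "local_term T \<Psi>"
  shows "global_sum (\<lambda>w. \<Phi> w + \<Psi> w) = global_sum \<Phi> + global_sum \<Psi>"
proof -
  let ?U = "S \<union> T"
  have lt: "local_term ?U \<Phi>" "local_term ?U \<Psi>" "local_term ?U (\<lambda>w. \<Phi> w + \<Psi> w)"
    using assms local_term_add[OF assms] by (auto intro: local_term_superset simp: local_term_def)
  have "place_sum (\<lambda>w. \<Phi> w + \<Psi> w) \<sigma> = place_sum \<Phi> \<sigma> + place_sum \<Psi> \<sigma>" if "\<sigma> \<in> alg_auts" for \<sigma>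
    unfolding place_sum_def using local_term_summable lt that by (intro infsum_add) blast+
  then show ?thesis unfolding global_sum_eq[OF lt(1)] global_sum_eq[OF lt(2)] global_sum_eq[OF lt(3)]
    by (simp add: mean_on_def aut_rep sum.distrib add_divide_distrib)
qed

lemma global_sum_cmult:
  assumes "local_term S \<Phi>"
  shows "global_sum (\<lambda>w. c * \<Phi> w) = c * global_sum \<Phi>"
  unfolding global_sum_eq[OF assms] global_sum_eq[OF local_term_cmult[OF assms]]
  by (simp add: mean_on_def place_sum_def infsum_cmult_right' sum_distrib_left)

lemma global_sum_mono:
  assumes lt: "local_term S \<Phi>" "local_term T \<Psi>" and le: "\<And>v w. extends_place v w \<Longrightarrow> \<Phi> w \<le> \<Psi> w"
  shows "global_sum \<Phi> \<le> global_sum \<Psi>"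
proof -
  let ?U = "S \<union> T"
  have U: "local_term ?U \<Phi>" "local_term ?U \<Psi>" 
    using lt by (auto intro: local_term_superset simp: local_term_def)
  have "place_sum \<Phi> \<sigma> \<le> place_sum \<Psi> \<sigma>" if "\<sigma> \<in> alg_auts" for \<sigma>
    unfolding place_sum_def using local_term_summable[OF lt(1) that] local_term_summable[OF lt(2) that] 
      le extends_place_extended that by (intro infsum_mono) blast+
  then show ?thesis unfolding global_sum_eq[OF U(1)] global_sum_eq[OF U(2)]
    by (auto simp: mean_on_def aut_rep intro!: divide_right_mono sum_mono)
qed

lemma local_term_arch: "local_term {2} (\<lambda>w. if w 2 > 1 then c else 0)"
proof -
  have "{v. \<exists>w. extends_place v w \<and> (if w 2 > 1 then c else 0) \<noteq> 0} \<subseteq> {\<lambda>q. real_of_rat \<bar>q\<bar>}"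
    using arch_iff by auto
  then have "finite {v. \<exists>w. extends_place v w \<and> (if w 2 > 1 then c else 0) \<noteq> 0}" 
    by (rule finite_subset) simp
  then show ?thesis unfolding local_term_def by (simp add: alg_Rats)
qed

text \<open>The rationals have a single archimedean place, so the constant is counted once for each
  automorphism.\<close>

lemma global_sum_arch: "global_sum (\<lambda>w. if w 2 > 1 then c else 0) = c"
proof -
  have "place_sum (\<lambda>w. if w 2 > 1 then c else 0) \<sigma> = c" if "\<sigma> \<in> alg_auts" for \<sigma>
  proof -
    have "place_sum (\<lambda>w. if w 2 > 1 then c else 0) \<sigma> = 
      (\<Sum>\<^sub>\<infinity>v\<in>{\<lambda>q. real_of_rat \<bar>q\<bar>}. c)" unfolding place_sum_def
      using arch_iff[OF extends_place_extended[OF _ that]]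
      by (intro infsum_cong_neutral) (auto simp: rational_places_def)
    then show ?thesis by simp
  qed
  moreover have "card (restrictions {2}) > 0" by (intro card_restrictions) (auto simp: alg_Rats)
  ultimately show ?thesis unfolding global_sum_eq[OF local_term_arch]
    by (simp add: mean_on_def aut_rep)
qed

section \<open>Heights of finite sets of algebraic numbers\<close>

definition max_abs :: "(complex \<Rightarrow> real) \<Rightarrow> complex set \<Rightarrow> real" where
  "max_abs w S = Max (insert 1 (w ` S))"

text \<open>Since \<open>max_abs\<close> includes the value 1, this is the height of the projective
  point whose coordinates are 1 and the elements of \<open>S\<close>.\<close>

definition height :: "complex set \<Rightarrow> real" where
  "height S = global_sum (\<lambda>w. ln (max_abs w S))"

lemma max_abs_ge: "finite S \<Longrightarrow> max_abs w S \<ge> 1" "finite S \<Longrightarrow> x \<in> S \<Longrightarrow> w x \<le> max_abs w S"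
  by (auto simp: max_abs_def)

lemma max_abs_le: "finite S \<Longrightarrow> 1 \<le> B \<Longrightarrow> (\<And>x. x \<in> S \<Longrightarrow> w x \<le> B) \<Longrightarrow> max_abs w S \<le> B"
  by (auto simp: max_abs_def)

lemma local_term_height:
  assumes "finite S" "S \<subseteq> \<A>" shows "local_term S (\<lambda>w. ln (max_abs w S))"
proof -
  have "{v. \<exists>w. extends_place v w \<and> ln (max_abs w S) \<noteq> 0} \<subseteq> (\<Union>x\<in>S. {v. \<exists>w. extends_place v w \<and> w x > 1})"
  proof clarify
    fix v w assume w: "extends_place v w" "ln (max_abs w S) \<noteq> 0"
    have "max_abs w S \<noteq> 1" using w(2) by auto
    then have "\<not> max_abs w S \<le> 1" using max_abs_ge(1)[OF assms(1), of w] by simp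
    then obtain x where "x \<in> S" "w x > 1" using max_abs_le[OF assms(1), of 1 w] by force
    then show "v \<in> (\<Union>x\<in>S. {v. \<exists>w. extends_place v w \<and> w x > 1})" using w by blast
  qed
  then have "finite {v. \<exists>w. extends_place v w \<and> ln (max_abs w S) \<noteq> 0}"
    using finite_subset assms finite_abs_gt_1 by (metis (no_types, lifting) finite_UN subsetD)
  moreover have "max_abs w S = max_abs w' S" if "\<forall>x\<in>S. w x = w' x" for w w'
    using that by (simp add: max_abs_def cong: image_cong)
  ultimately show ?thesis using assms unfolding local_term_def by metis
qed

lemma height_mono: assumes "S \<subseteq> T" "finite T" "T \<subseteq> \<A>" shows "height S \<le> height T"
  unfolding height_def
proof (rule global_sum_mono[OF local_term_height local_term_height])
  fix v w assume "extends_place v w"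
  have "finite S" using assms finite_subset by blast
  then have "max_abs w S \<le> max_abs w T" "max_abs w S \<ge> 1" 
    using assms by (auto simp: subset_iff intro!: max_abs_le max_abs_ge)
  then show "ln (max_abs w S) \<le> ln (max_abs w T)" by simp
qed (use assms finite_subset in auto)

section \<open>Comparison with the Weil height\<close>

definition conjugates :: "complex \<Rightarrow> complex set" where
  "conjugates x = (\<lambda>\<sigma>. \<sigma> x) ` alg_auts"

definition local_height_sum :: "complex \<Rightarrow> real" where
  "local_height_sum y = (\<Sum>\<^sub>\<infinity>v\<in>rational_places. ln (max 1 (extended_place v y)))"

lemma conjugates_alg: "x \<in> \<A> \<Longrightarrow> y \<in> conjugates x \<Longrightarrow> y \<in> \<A>"
  by (auto simp: conjugates_def aut_alg)

lemma conjugates_eq: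
  assumes "x \<in> \<A>" "y \<in> conjugates x" shows "conjugates y = conjugates x"
proof -
  obtain \<sigma> where \<sigma>: "\<sigma> \<in> alg_auts" "y = \<sigma> x" using assms by (auto simp: conjugates_def)
  obtain \<sigma>' where \<sigma>': "\<sigma>' \<in> alg_auts" "\<forall>x\<in>\<A>. \<sigma>' (\<sigma> x) = x"
    using aut_inv[OF \<sigma>(1)] by blast
  have "\<tau> (\<sigma> x) \<in> conjugates x" if "\<tau> \<in> alg_auts" for \<tau>
    using aut_comp[OF that \<sigma>(1)] unfolding conjugates_def by (metis comp_apply imageI)
  moreover have "\<tau> x \<in> conjugates y" if "\<tau> \<in> alg_auts" for \<tau>
  proof -
    have "\<tau> x = (\<tau> \<circ> \<sigma>') y" using \<sigma> \<sigma>' assms(1) by simp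
    then show ?thesis using aut_comp[OF that \<sigma>'(1)] unfolding conjugates_def by blast
  qed
  ultimately show ?thesis unfolding \<sigma>(2) by (auto simp: conjugates_def)
qed

text \<open>Restricting an automorphism to one point amounts to choosing a conjugate of it.\<close>

lemma mean_on_singleton:
  assumes "x \<in> \<A>"
  shows "mean_on {x} (place_sum (\<lambda>w. l (w x))) = 
    (\<Sum>y\<in>conjugates x. \<Sum>\<^sub>\<infinity>v\<in>rational_places. l (extended_place v y)) / card (conjugates x)"
proof -
  let ?s = "\<lambda>y. \<Sum>\<^sub>\<infinity>v\<in>rational_places. l (extended_place v y)"
  have bij: "bij_betw (\<lambda>\<tau>. \<tau> x) (restrictions {x}) (conjugates x)"
  proof (rule bij_betw_imageI)
    show "inj_on (\<lambda>\<tau>. \<tau> x) (restrictions {x})"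
      by (rule inj_onI) (auto simp: restrictions_def fun_eq_iff)
    show "(\<lambda>\<tau>. \<tau> x) ` restrictions {x} = conjugates x"
      by (force simp: restrictions_def conjugates_def image_iff)
  qed
  have "place_sum (\<lambda>w. l (w x)) (aut_rep {x} \<tau>) = ?s (\<tau> x)" if "\<tau> \<in> restrictions {x}" for \<tau>
  proof -
    have "aut_rep {x} \<tau> x = \<tau> x" using fun_cong[OF aut_rep(2)[OF that], of x] by simp
    then show ?thesis by (simp add: place_sum_def)
  qed
  then have "mean_on {x} (place_sum (\<lambda>w. l (w x))) = (\<Sum>\<tau>\<in>restrictions {x}. ?s (\<tau> x)) / card (restrictions {x})"
    by (simp add: mean_on_def)
  then show ?thesis
    using sum.reindex_bij_betw[OF bij, of ?s] bij_betw_same_card[OF bij] by simp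
qed

lemma height_singleton:
  assumes "x \<in> \<A>"
  shows "height {x} = (\<Sum>y\<in>conjugates x. local_height_sum y) / card (conjugates x)"
proof -
  have "height {x} = mean_on {x} (place_sum (\<lambda>w. ln (max_abs w {x})))"
    unfolding height_def using assms by (intro global_sum_eq local_term_height) auto
  also have "(\<lambda>w. ln (max_abs w {x})) = (\<lambda>w. ln (max 1 (w x)))" by (simp add: max_abs_def)
  finally show ?thesis 
    by (simp only: mean_on_singleton[OF assms, of "\<lambda>t. ln (max 1 t)"] local_height_sum_def)
qed

lemma height_conjugate: "x \<in> \<A> \<Longrightarrow> y \<in> conjugates x \<Longrightarrow> height {y} = height {x}"
  using conjugates_eq[of x y] conjugates_alg[of x y] by (simp add: height_singleton)

lemma card_conjugates_le_degree:
  assumes "x \<in> \<A>"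
  shows "card (conjugates x) \<le> degree_over \<rat> x" "card (conjugates x) > 0" "finite (conjugates x)"
proof -
  show fin: "finite (conjugates x)" using finite_conjugates[OF assms] by (simp add: conjugates_def)
  have "conjugates x \<noteq> {}" using aut_id by (auto simp: conjugates_def)
  then show "card (conjugates x) > 0" using fin by (simp add: card_gt_0_iff)
  have "\<exists>d. \<exists>p\<in>polys_over \<rat>. p \<noteq> 0 \<and> degree p = d \<and> poly p x = 0"
  proof -
    obtain p where "\<And>i. coeff p i \<in> \<rat>" "p \<noteq> 0" "poly p x = 0" using alg_rat_poly[OF assms] by blast
    then show ?thesis unfolding polys_over_def by blast
  qed
  then have "\<exists>p\<in>polys_over \<rat>. p \<noteq> 0 \<and> degree p = degree_over \<rat> x \<and> poly p x = 0"
    unfolding degree_over_def by (rule LeastI_ex)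
  then obtain p where p: "\<And>i. coeff p i \<in> \<rat>" "p \<noteq> 0" "degree p = degree_over \<rat> x" "poly p x = 0"
    by (auto simp: polys_over_def)
  have "conjugates x \<subseteq> {y. poly p y = 0}"
    using aut_rat_poly[OF _ p(1) assms] p(4) aut_0 by (auto simp: conjugates_def)
  then have "card (conjugates x) \<le> card {y. poly p y = 0}"
    using poly_roots_finite[OF p(2)] by (intro card_mono)
  also have "\<dots> \<le> degree p" by (rule card_poly_roots_bound[OF p(2)])
  finally show "card (conjugates x) \<le> degree_over \<rat> x" using p by simp
qed

section \<open>The field generated by one algebraic number, and its embeddings\<close>

lemma rationals_adjoin_eq:
  assumes "x \<in> \<A>"
  shows "rationals_adjoin x = {poly p x |p. \<forall>i. coeff p i \<in> \<rat>}"
proof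
  let ?P = "{poly p x |p. \<forall>i. coeff p i \<in> \<rat>}"
  have PI: "poly p x \<in> ?P" if "\<And>i. coeff p i \<in> \<rat>" for p using that by blast
  have mult: "coeff (p * q) i \<in> \<rat>" if "\<And>i. coeff p i \<in> \<rat>" "\<And>i. coeff q i \<in> \<rat>" for p q :: "complex poly" and i
    unfolding coeff_mult using that by (intro Rats_sum) auto
  have const: "coeff [:c:] i \<in> \<rat>" if "c \<in> \<rat>" for c :: complex and i
    using that by (auto simp: coeff_pCons split: nat.split)
  have comp: "coeff (pcompose p q) i \<in> \<rat>" if "\<And>i. coeff p i \<in> \<rat>" "\<And>i. coeff q i \<in> \<rat>" for p q :: "complex poly" and i
    using that(1)
  proof (induction p arbitrary: i)
    case (pCons a p)
    have "coeff p i \<in> \<rat>" for i using pCons.prems[of "Suc i"] by simp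
    moreover have "a \<in> \<rat>" using pCons.prems[of 0] by simp
    ultimately show ?case using pCons.IH const mult[OF that(2)] by (simp add: pcompose_pCons)
  qed simp
  have "is_subfield ?P" unfolding is_subfield_def
  proof (intro conjI ballI)
    show "0 \<in> ?P" using PI[of 0] by simp
    show "1 \<in> ?P" using PI[of 1] by (simp add: coeff_1)
    fix a assume "a \<in> ?P"
    then obtain p where p: "a = poly p x" "\<And>i. coeff p i \<in> \<rat>" by blast
    show "- a \<in> ?P" using PI[of "- p"] p by simp
    show "inverse a \<in> ?P"
    proof (cases "a = 0")
      case False
      have "a \<in> \<A>" unfolding p using p(2) assms alg_Rats by (intro alg_poly) auto
      \<comment> \<open>The inverse of \<open>a\<close> is a rational polynomial in
        \<open>a\<close>, hence by composition one in \<open>x\<close>.\<close>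
      then obtain q where "\<And>i. coeff q i \<in> \<rat>" "inverse a = poly q a" using alg_inverse_poly False by blast
      then show ?thesis using PI[of "pcompose q p"] comp p by (simp add: poly_pcompose)
    qed (use \<open>0 \<in> ?P\<close> in simp)
    fix b assume "b \<in> ?P"
    then obtain q where q: "b = poly q x" "\<And>i. coeff q i \<in> \<rat>" by blast
    show "a + b \<in> ?P" using PI[of "p + q"] p q by simp
    show "a * b \<in> ?P" using PI[of "p * q"] mult[of p q] p q by simp
  qed
  moreover have "x \<in> ?P" using PI[of "[:0, 1:]"] by (simp add: coeff_pCons split: nat.split)
  ultimately show "rationals_adjoin x \<subseteq> ?P" by (auto simp only: rationals_adjoin_def)
  show "?P \<subseteq> rationals_adjoin x"
  proof (clarsimp simp: rationals_adjoin_def)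
    fix p :: "complex poly" and F assume *: "\<forall>i. coeff p i \<in> \<rat>" "is_subfield F" "x \<in> F"
    have "x ^ i \<in> F" for i using * by (induction i) (auto simp: is_subfield_def)
    then have "coeff p i * x ^ i \<in> F" for i 
      using *(1,2) subsetD[OF Rats_subset_subfield[OF *(2)], of "coeff p i"] by (auto simp: is_subfield_def)
    moreover have sum_in: "(\<Sum>i\<in>I. g i) \<in> F" if "\<And>i. g i \<in> F" for g and I :: "nat set"
      using that *(2) by (induction I rule: infinite_finite_induct) (auto simp: is_subfield_def)
    ultimately show "poly p x \<in> F" unfolding poly_altdef by (intro sum_in)
  qed
qed

context
  fixes x F assumes x: "x \<in> \<A>" and F: "F = rationals_adjoin x"
begin

lemma adjoin_props: "is_subfield F" "x \<in> F"
  unfolding F rationals_adjoin_def is_subfield_def by auto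

lemma adjoin_power: "x ^ n \<in> F"
  using adjoin_props by (induction n) (auto simp: is_subfield_def)

lemma adjoin_Rats: "q \<in> \<rat> \<Longrightarrow> q \<in> F"
  using Rats_subset_subfield[OF adjoin_props(1)] by blast

context
  fixes \<sigma> assumes \<sigma>: "\<sigma> \<in> embeddings F"
begin

lemma embedding_add: "a \<in> F \<Longrightarrow> b \<in> F \<Longrightarrow> \<sigma> (a + b) = \<sigma> a + \<sigma> b"
  and embedding_mult: "a \<in> F \<Longrightarrow> b \<in> F \<Longrightarrow> \<sigma> (a * b) = \<sigma> a * \<sigma> b" and embedding_1: "\<sigma> 1 = 1"
  using \<sigma> by (auto simp: embeddings_def)

lemma embedding_0: "\<sigma> 0 = 0"
  using embedding_add[of 0 0] adjoin_Rats[of 0] by simp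

lemma embedding_minus: "a \<in> F \<Longrightarrow> \<sigma> (- a) = - \<sigma> a"
  using embedding_add[of a "- a"] adjoin_props(1) embedding_0 
  by (simp add: is_subfield_def eq_neg_iff_add_eq_0 add.commute)

lemma embedding_Rats: assumes "q \<in> \<rat>" shows "\<sigma> q = q"
proof -
  have nat: "\<sigma> (of_nat n) = of_nat n" for n
    by (induction n) (auto simp: embedding_0 embedding_1 embedding_add adjoin_Rats)
  have int: "\<sigma> (of_int n) = of_int n" for n
    by (cases n) (simp_all add: nat embedding_minus adjoin_Rats del: of_nat_Suc)
  obtain a b where q: "q = of_int a / of_int b" "b > 0" using assms by (auto elim: Rats_cases')
  have "\<sigma> q * of_int b = \<sigma> (q * of_int b)" 
    using embedding_mult[of q "of_int b"] int adjoin_Rats assms by simp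
  also have "q * of_int b = of_int a" using q by simp
  also have "\<sigma> (of_int a) = q * of_int b" using q int by simp
  finally show ?thesis using q(2) by simp
qed

lemma embedding_poly: assumes "\<And>i. coeff p i \<in> \<rat>" shows "\<sigma> (poly p x) = poly p (\<sigma> x)"
proof -
  have pow: "\<sigma> (x ^ i) = \<sigma> x ^ i" for i
    by (induction i) (auto simp: embedding_1 embedding_mult adjoin_power adjoin_props(2))
  have sm: "\<sigma> (\<Sum>i\<in>I. g i) = (\<Sum>i\<in>I. \<sigma> (g i)) \<and> (\<Sum>i\<in>I. g i) \<in> F" if "\<And>i. g i \<in> F" for g and I :: "nat set"
    using that adjoin_props(1) 
    by (induction I rule: infinite_finite_induct) (auto simp: embedding_0 embedding_add is_subfield_def)
  have mem: "coeff p i * x ^ i \<in> F" for i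
    using adjoin_Rats[OF assms] adjoin_power adjoin_props(1) by (auto simp: is_subfield_def)
  show ?thesis unfolding poly_altdef using sm[OF mem] assms
    by (simp add: embedding_mult adjoin_power adjoin_Rats embedding_Rats pow)
qed

lemma embedding_conjugate: "\<sigma> x \<in> conjugates x"
proof -
  have "poly p (\<sigma> x) = 0" if "\<And>i. coeff p i \<in> \<rat>" "poly p x = 0" for p
    using embedding_poly[of p] embedding_0 that by simp
  then show ?thesis using conjugate_aut[OF x, of "\<sigma> x"] unfolding conjugates_def by (metis imageI)
qed

end

lemma embedding_inj: "inj_on (\<lambda>\<sigma>. \<sigma> x) (embeddings F)"
proof (rule inj_onI)
  fix \<sigma> \<tau> assume a: "\<sigma> \<in> embeddings F" "\<tau> \<in> embeddings F" "\<sigma> x = \<tau> x"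
  have "\<sigma> y = \<tau> y" if "y \<in> F" for y
  proof -
    have "F = {poly p x |p. \<forall>i. coeff p i \<in> \<rat>}" unfolding F by (rule rationals_adjoin_eq[OF x])
    then obtain p where "y = poly p x" "\<And>i. coeff p i \<in> \<rat>" using \<open>y \<in> F\<close> by blast
    then show ?thesis using embedding_poly[OF a(1)] embedding_poly[OF a(2)] a(3) by simp
  qed
  moreover have "\<sigma> \<in> extensional F" "\<tau> \<in> extensional F" using a by (auto simp: embeddings_def PiE_def)
  ultimately show "\<sigma> = \<tau>" by (intro extensionalityI[of _ F]) auto
qed

lemma finite_embeddings: "finite (embeddings F)"
  using embedding_inj embedding_conjugate card_conjugates_le_degree(3)[OF x]
  by (metis (no_types, lifting) finite_imageD finite_subset image_subsetI)

end

lemma local_height_sum_finite: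
  assumes "y \<in> \<A>"
  shows "finite {v \<in> rational_places. extended_place v y > 1}"
    "local_height_sum y = (\<Sum>v\<in>{v \<in> rational_places. extended_place v y > 1}. ln (extended_place v y))"
proof -
  have "{v \<in> rational_places. extended_place v y > 1} \<subseteq> {v. \<exists>w. extends_place v w \<and> w y > 1}"
    using extends_place_extended[OF _ aut_id] by auto
  then show fin: "finite {v \<in> rational_places. extended_place v y > 1}" 
    using finite_abs_gt_1[OF assms] finite_subset by blast
  have "local_height_sum y = (\<Sum>\<^sub>\<infinity>v\<in>{v \<in> rational_places. extended_place v y > 1}. ln (extended_place v y))"
    unfolding local_height_sum_def by (intro infsum_cong_neutral) (auto simp: max_def)
  then show "local_height_sum y = (\<Sum>v\<in>{v \<in> rational_places. extended_place v y > 1}. ln (extended_place v y))"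
    using fin by simp
qed

lemma local_height_sum_nonneg: "y \<in> \<A> \<Longrightarrow> local_height_sum y \<ge> 0"
  by (auto simp: local_height_sum_finite intro!: sum_nonneg)

text \<open>The local degree is the number of embeddings inducing a place, so the Weil sum runs over
  pairs of a place and an embedding. Such a pair is determined by the embedding together with the
  rational place below, and an embedding is determined by the conjugate to which it sends
  \<open>x\<close>.\<close>

lemma weil_height_le:
  assumes x: "x \<in> \<A>"
  shows "weil_height x \<le> height {x}"
proof -
  define F where "F = rationals_adjoin x"
  define d where "d = degree_over \<rat> x"
  define ind where "ind = (\<lambda>w \<sigma>. \<forall>y\<in>F. w y = extended_place (place_below w) (\<sigma> y))"
  define Em where "Em = embeddings F"
  \<comment> \<open>Only pairs with a positive logarithm are kept, which makes the index set
    finite.\<close>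
  define I where "I = {(w, \<sigma>). w \<in> places F \<and> \<sigma> \<in> Em \<and> ind w \<sigma> \<and> w x > 1}"
  define J where "J = (SIGMA \<sigma>:Em. {v \<in> rational_places. extended_place v (\<sigma> x) > 1})"
  define W where "W = fst ` I"
  have finE: "finite Em" unfolding Em_def by (rule finite_embeddings[OF x F_def])
  have xF: "x \<in> F" by (rule adjoin_props(2)[OF x F_def])
  have conj: "\<sigma> x \<in> conjugates x" if "\<sigma> \<in> Em" for \<sigma>
    using embedding_conjugate[OF x F_def] that by (simp add: Em_def)
  have alg: "\<sigma> x \<in> \<A>" if "\<sigma> \<in> Em" for \<sigma> using conj conjugates_alg[OF x] that by blast
  have ld: "local_degree F w = card {\<sigma> \<in> Em. ind w \<sigma>}" for w
    by (simp add: local_degree_def Em_def ind_def)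
  have finJ: "finite J" unfolding J_def using finE local_height_sum_finite(1)[OF alg] by auto
  have inj: "inj_on (\<lambda>(w, \<sigma>). (\<sigma>, place_below w)) I"
  proof (rule inj_onI)
    fix z z' assume z: "z \<in> I" "z' \<in> I" 
      "(case z of (w, \<sigma>) \<Rightarrow> (\<sigma>, place_below w)) = (case z' of (w, \<sigma>) \<Rightarrow> (\<sigma>, place_below w))"
    obtain w \<sigma> w' where zw: "z = (w, \<sigma>)" "z' = (w', \<sigma>)" "place_below w = place_below w'"
      using z(3) by (cases z, cases z') auto
    note a = z(1,2)[unfolded zw(1,2)] zw(3)
    have "w y = w' y" if "y \<in> F" for y using a that by (auto simp: I_def ind_def)
    moreover have "w \<in> extensional F" "w' \<in> extensional F" using a by (auto simp: I_def places_def absolute_values_def)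
    ultimately have "w = w'" by (intro extensionalityI[of _ F]) auto
    then show "z = z'" by (simp add: zw)
  qed
  have im: "(\<lambda>(w, \<sigma>). (\<sigma>, place_below w)) ` I \<subseteq> J"
    using xF by (auto simp: I_def J_def ind_def places_def)
  have finI: "finite I" using inj im finJ by (meson finite_imageD finite_subset)
  then have finW: "finite W" by (simp add: W_def)
  have "weil_height x = (\<Sum>\<^sub>\<infinity>w\<in>places F. real (local_degree F w) / real d * ln (max 1 (w x)))"
    by (simp add: weil_height_def F_def d_def)
  also have "\<dots> = (\<Sum>\<^sub>\<infinity>w\<in>W. real (local_degree F w) / real d * ln (w x))"
  proof -
    \<comment> \<open>A place outside \<open>W\<close> has \<open>w x \<le> 1\<close> or is induced
      by no embedding; in the latter case its local degree is 0.\<close>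
    have "real (local_degree F w) / real d * ln (max 1 (w x)) = 0" if w: "w \<in> places F - W" for w
    proof (cases "w x > 1")
      case True
      then have "{\<sigma> \<in> Em. ind w \<sigma>} = {}" using w by (force simp: W_def I_def)
      then show ?thesis unfolding ld by (metis card.empty mult_zero_left of_nat_0 div_0)
    qed (simp add: max_def)
    then show ?thesis by (intro infsum_cong_neutral) (auto simp: W_def I_def)
  qed
  also have "\<dots> = (\<Sum>w\<in>W. real (local_degree F w) * ln (w x)) / d"
    using finW by (simp add: sum_divide_distrib)
  also have "(\<Sum>w\<in>W. real (local_degree F w) * ln (w x)) = (\<Sum>w\<in>W. \<Sum>\<sigma>\<in>{\<sigma> \<in> Em. ind w \<sigma>}. ln (w x))"
    by (simp add: ld)
  also have "\<dots> = (\<Sum>(w, \<sigma>)\<in>(SIGMA w:W. {\<sigma> \<in> Em. ind w \<sigma>}). ln (w x))"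
    using finW finE by (intro sum.Sigma) auto
  also have "(SIGMA w:W. {\<sigma> \<in> Em. ind w \<sigma>}) = I" by (force simp: W_def I_def)
  also have "(\<Sum>(w, \<sigma>)\<in>I. ln (w x)) = (\<Sum>z\<in>I. case (case z of (w, \<sigma>) \<Rightarrow> (\<sigma>, place_below w)) of (\<sigma>, v) \<Rightarrow> ln (extended_place v (\<sigma> x)))"
    using xF by (intro sum.cong) (auto simp: I_def ind_def)
  also have "\<dots> = (\<Sum>(\<sigma>, v)\<in>(\<lambda>(w, \<sigma>). (\<sigma>, place_below w)) ` I. ln (extended_place v (\<sigma> x)))"
    by (subst sum.reindex[OF inj]) simp
  also have "\<dots> \<le> (\<Sum>(\<sigma>, v)\<in>J. ln (extended_place v (\<sigma> x)))"
    using finJ im by (intro sum_mono2) (auto simp: J_def)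
  also have "\<dots> = (\<Sum>\<sigma>\<in>Em. \<Sum>v\<in>{v \<in> rational_places. extended_place v (\<sigma> x) > 1}. ln (extended_place v (\<sigma> x)))"
    unfolding J_def using finE local_height_sum_finite(1)[OF alg] by (intro sum.Sigma[symmetric]) auto
  also have "\<dots> = (\<Sum>\<sigma>\<in>Em. local_height_sum (\<sigma> x))"
    by (intro sum.cong refl local_height_sum_finite(2)[symmetric] alg)
  also have "\<dots> = (\<Sum>y\<in>(\<lambda>\<sigma>. \<sigma> x) ` Em. local_height_sum y)"
    using embedding_inj[OF x F_def] by (subst sum.reindex) (auto simp: Em_def)
  also have "\<dots> \<le> (\<Sum>y\<in>conjugates x. local_height_sum y)"
    using card_conjugates_le_degree(3)[OF x] conj conjugates_alg[OF x]
    by (intro sum_mono2) (auto intro: local_height_sum_nonneg)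
  finally have "weil_height x \<le> (\<Sum>y\<in>conjugates x. local_height_sum y) / d"
    by (simp add: divide_right_mono)
  \<comment> \<open>There are at most \<open>d\<close> conjugates, so dividing by their number can
    only enlarge the nonnegative quotient.\<close>
  also have "\<dots> \<le> (\<Sum>y\<in>conjugates x. local_height_sum y) / card (conjugates x)"
    using card_conjugates_le_degree[OF x] conjugates_alg[OF x]
    by (intro divide_left_mono sum_nonneg local_height_sum_nonneg) (auto simp: d_def)
  finally show ?thesis by (simp add: height_singleton[OF x])
qed

lemma northcott_height:
  assumes "northcott L"
  shows "finite {x \<in> L. height {x} \<le> T}"
proof (rule finite_subset)
  \<comment> \<open>\<open>northcott\<close> speaks of strict inequalities with a positive bound,
    hence \<open>T + 1\<close> and the maximum with 1.\<close>
  show "{x \<in> L. height {x} \<le> T} \<subseteq> {x \<in> L. weil_height x < max 1 (T + 1)}"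
  proof clarify
    fix x assume x: "x \<in> L" "height {x} \<le> T"
    then have "x \<in> \<A>" using assms unfolding northcott_def by blast
    then show "weil_height x < max 1 (T + 1)" using weil_height_le[of x] x(2) by simp
  qed
  show "finite {x \<in> L. weil_height x < max 1 (T + 1)}"
    using assms unfolding northcott_def by simp
qed

section \<open>The homogeneous Nullstellensatz\<close>

text \<open>Polynomials are treated as functions with the pointwise ring structure, so identities
  between forms can be checked by evaluation.\<close>

type_synonym polyfun = "(nat \<Rightarrow> complex) \<Rightarrow> complex"

lemma sum_fun_apply: "(\<Sum>i\<in>I. f i) x = (\<Sum>i\<in>I. f i x)"
  by (induction I rule: infinite_finite_induct) auto

lemma power_fun_apply: "(f ^ n) x = f x ^ n"
  by (induction n) auto

definition constfun :: "complex \<Rightarrow> polyfun" where "constfun c = (\<lambda>_. c)"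
definition coordfun :: "nat \<Rightarrow> polyfun" where "coordfun i = (\<lambda>x. x i)"
definition monfun :: "nat list \<Rightarrow> polyfun" where "monfun u = prod_list (map coordfun u)"
definition words :: "nat \<Rightarrow> nat \<Rightarrow> nat list set" where "words n e = {u. set u \<subseteq> {..<n} \<and> length u = e}"

text \<open>Monomials are words in the variables, so the coefficients \<open>a\<close> are not unique.\<close>
definition homfun :: "nat \<Rightarrow> nat \<Rightarrow> polyfun set" where
  "homfun n e = {\<Sum>u\<in>words n e. constfun (a u) * monfun u |a. \<forall>u. a u \<in> \<A>}"

lemma finite_words: "finite (words n e)"
  by (simp add: words_def finite_lists_length_eq)

lemma constfun_simps: "constfun 0 = 0" "constfun 1 = 1" "constfun (a + b) = constfun a + constfun b"
  "constfun (a * b) = constfun a * constfun b" "constfun (- a) = - constfun a" "constfun a x = a"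
  by (auto simp: constfun_def fun_eq_iff)

lemma coordfun_apply: "coordfun i x = x i"
  by (simp add: coordfun_def)

lemma monfun_simps: "monfun [] = 1" "monfun (i # u) = coordfun i * monfun u" "monfun (u @ v) = monfun u * monfun v"
  by (auto simp: monfun_def)

lemma monfun_apply: "monfun u x = (\<Prod>i\<leftarrow>u. x i)"
  by (induction u) (auto simp: monfun_simps coordfun_def)

lemma homfunI: "(\<And>u. a u \<in> \<A>) \<Longrightarrow> (\<Sum>u\<in>words n e. constfun (a u) * monfun u) \<in> homfun n e"
  by (auto simp: homfun_def)

lemma homfunE:
  assumes "p \<in> homfun n e"
  obtains a where "\<And>u. a u \<in> \<A>" "p = (\<Sum>u\<in>words n e. constfun (a u) * monfun u)"
  using assms by (auto simp: homfun_def)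

lemma homfun_0: "0 \<in> homfun n e"
  using homfunI[of "\<lambda>_. 0" n e] by (simp add: alg_closed_under constfun_simps)

lemma homfun_add: assumes "p \<in> homfun n e" "q \<in> homfun n e" shows "p + q \<in> homfun n e"
proof -
  obtain a where a: "\<And>u. a u \<in> \<A>" "p = (\<Sum>u\<in>words n e. constfun (a u) * monfun u)" using homfunE[OF assms(1)] by blast
  obtain b where b: "\<And>u. b u \<in> \<A>" "q = (\<Sum>u\<in>words n e. constfun (b u) * monfun u)" using homfunE[OF assms(2)] by blast
  have "p + q = (\<Sum>u\<in>words n e. constfun (a u + b u) * monfun u)"
    by (simp add: a b constfun_simps ring_distribs sum.distrib)
  then show ?thesis using homfunI[of "\<lambda>u. a u + b u"] a(1) b(1) alg_closed_under(3) by simp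
qed

lemma homfun_sum: "(\<And>i. i \<in> I \<Longrightarrow> f i \<in> homfun n e) \<Longrightarrow> (\<Sum>i\<in>I. f i) \<in> homfun n e"
  by (induction I rule: infinite_finite_induct) (auto intro: homfun_0 homfun_add)

lemma homfun_monfun: assumes "u \<in> words n e" "c \<in> \<A>" shows "constfun c * monfun u \<in> homfun n e"
proof -
  have "(\<Sum>u'\<in>words n e. constfun (if u' = u then c else 0) * monfun u') = (\<Sum>u'\<in>words n e. if u' = u then constfun c * monfun u else 0)"
    by (intro sum.cong) (auto simp: constfun_simps)
  also have "\<dots> = constfun c * monfun u" using assms(1) finite_words by simp
  finally show ?thesis using homfunI[of "\<lambda>u'. if u' = u then c else 0" n e] assms(2) alg_closed_under(1) by auto
qed

lemma words_append: "u \<in> words n d \<Longrightarrow> v \<in> words n e \<Longrightarrow> u @ v \<in> words n (d + e)"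
  by (auto simp: words_def)

lemma homfun_mult: assumes "p \<in> homfun n d" "q \<in> homfun n e" shows "p * q \<in> homfun n (d + e)"
proof -
  obtain a where a: "\<And>u. a u \<in> \<A>" "p = (\<Sum>u\<in>words n d. constfun (a u) * monfun u)" using homfunE[OF assms(1)] by blast
  obtain b where b: "\<And>u. b u \<in> \<A>" "q = (\<Sum>u\<in>words n e. constfun (b u) * monfun u)" using homfunE[OF assms(2)] by blast
  have "p * q = (\<Sum>u\<in>words n d. \<Sum>v\<in>words n e. constfun (a u * b v) * monfun (u @ v))"
    by (simp add: a b sum_product constfun_simps monfun_simps mult_ac)
  also have "\<dots> \<in> homfun n (d + e)"
    by (intro homfun_sum homfun_monfun words_append a b alg_closed_under(4))
  finally show ?thesis .
qed

lemma homfun_const: "c \<in> \<A> \<Longrightarrow> constfun c \<in> homfun n 0"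
  using homfun_monfun[of "[]" n 0 c] by (simp add: words_def monfun_simps)

lemma homfun_cmult: "c \<in> \<A> \<Longrightarrow> p \<in> homfun n e \<Longrightarrow> constfun c * p \<in> homfun n e"
  using homfun_mult[OF homfun_const, of c p n e] by simp

lemma homfun_minus: "p \<in> homfun n e \<Longrightarrow> - p \<in> homfun n e"
  using homfun_cmult[of "-1" p n e] alg_closed_under(5)[OF alg_closed_under(2)] by (simp add: constfun_simps)

lemma homfun_diff: "p \<in> homfun n e \<Longrightarrow> q \<in> homfun n e \<Longrightarrow> p - q \<in> homfun n e"
  using homfun_add[of p n e "- q"] homfun_minus by simp

lemma homfun_mon: "u \<in> words n e \<Longrightarrow> monfun u \<in> homfun n e"
  using homfun_monfun[of u n e 1] by (simp add: alg_closed_under constfun_simps)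

lemma homfun_coord: "i < n \<Longrightarrow> coordfun i \<in> homfun n 1"
  using homfun_mon[of "[i]" n 1] by (simp add: words_def monfun_simps)

lemma homfun_power: "p \<in> homfun n 1 \<Longrightarrow> p ^ e \<in> homfun n e"
proof (induction e)
  case 0 then show ?case using homfun_const[OF alg_closed_under(2)] by (simp add: constfun_simps flip: one_fun_def)
next
  case (Suc e) then show ?case using homfun_mult[of p n 1 "p ^ e" e] by (simp only: power_Suc plus_1_eq_Suc)
qed

section \<open>Graded ideals maximal among those with no power of the irrelevant ideal\<close>

definition graded_ideal :: "nat \<Rightarrow> (nat \<times> polyfun) set \<Rightarrow> bool" where
  "graded_ideal n P \<longleftrightarrow> (\<forall>(e, p)\<in>P. p \<in> homfun n e) \<and> (\<forall>e. (e, 0) \<in> P) \<and>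
     (\<forall>e p q. (e, p) \<in> P \<longrightarrow> (e, q) \<in> P \<longrightarrow> (e, p + q) \<in> P) \<and>
     (\<forall>d e p q. (e, p) \<in> P \<longrightarrow> q \<in> homfun n d \<longrightarrow> (d + e, q * p) \<in> P)"

text \<open>Containing all monomials of some degree means containing a power of the ideal generated
  by the variables. The relevant ideals are those for which a projective zero can be
  expected.\<close>

definition relevant :: "nat \<Rightarrow> (nat \<times> polyfun) set \<Rightarrow> bool" where
  "relevant n P \<longleftrightarrow> (\<forall>N. \<exists>u\<in>words n N. (N, monfun u) \<notin> P)"

text \<open>The ideal generated by \<open>P\<close> and a form \<open>l\<close> of degree
  \<open>d\<close>. The clause for \<open>e < d\<close> guards against truncated subtraction in
  \<open>e - d\<close>.\<close>

definition ideal_add :: "nat \<Rightarrow> (nat \<times> polyfun) set \<Rightarrow> nat \<Rightarrow> polyfun \<Rightarrow> (nat \<times> polyfun) set" where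
  "ideal_add n P d l = {(e, p + q * l) |e p q. (e, p) \<in> P \<and> q \<in> homfun n (e - d) \<and> (e < d \<longrightarrow> q = 0)}"

lemma graded_idealD:
  assumes "graded_ideal n P"
  shows "(e, p) \<in> P \<Longrightarrow> p \<in> homfun n e" "(e, 0) \<in> P" "(e, p) \<in> P \<Longrightarrow> (e, q) \<in> P \<Longrightarrow> (e, p + q) \<in> P"
    "(e, p) \<in> P \<Longrightarrow> q \<in> homfun n d \<Longrightarrow> (d + e, q * p) \<in> P"
  using assms by (auto simp: graded_ideal_def)

lemma graded_ideal_ideal_add:
  assumes P: "graded_ideal n P" and l: "l \<in> homfun n d"
  shows "graded_ideal n (ideal_add n P d l)" "P \<subseteq> ideal_add n P d l" "(d, l) \<in> ideal_add n P d l"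
proof -
  note D = graded_idealD[OF P]
  show sub: "P \<subseteq> ideal_add n P d l"
  proof clarify
    fix e p assume "(e, p) \<in> P"
    then show "(e, p) \<in> ideal_add n P d l" unfolding ideal_add_def
      by (intro CollectI exI[of _ e] exI[of _ p] exI[of _ 0]) (auto simp: homfun_0)
  qed
  show "(d, l) \<in> ideal_add n P d l" unfolding ideal_add_def using D(2) homfun_const[OF alg_closed_under(2)]
    by (intro CollectI exI[of _ d] exI[of _ 0] exI[of _ 1]) (auto simp: constfun_simps)
  show "graded_ideal n (ideal_add n P d l)" unfolding graded_ideal_def
  proof (intro conjI allI impI ballI)
    show "(e, 0) \<in> ideal_add n P d l" for e using sub D(2) by blast
    show "case z of (e, p) \<Rightarrow> p \<in> homfun n e" if zI: "z \<in> ideal_add n P d l" for z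
    proof -
      obtain e p q where z: "z = (e, p + q * l)" "(e, p) \<in> P" "q \<in> homfun n (e - d)" "e < d \<longrightarrow> q = 0"
        using zI by (auto simp: ideal_add_def)
      have "q * l \<in> homfun n e" using homfun_mult[OF z(3) l] z(4) homfun_0 by (cases "e < d") auto
      then show ?thesis using z D(1) homfun_add by auto
    qed
    fix e p q assume "(e, p) \<in> ideal_add n P d l" "(e, q) \<in> ideal_add n P d l"
    then obtain p' p'' q' q'' where "p = p' + p'' * l" "q = q' + q'' * l" "(e, p') \<in> P" "(e, q') \<in> P"
      "p'' \<in> homfun n (e - d)" "q'' \<in> homfun n (e - d)" "e < d \<longrightarrow> p'' = 0" "e < d \<longrightarrow> q'' = 0"
      by (auto simp: ideal_add_def)
    then show "(e, p + q) \<in> ideal_add n P d l" unfolding ideal_add_def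
      by (intro CollectI exI[of _ e] exI[of _ "p' + q'"] exI[of _ "p'' + q''"]) 
        (auto simp: algebra_simps intro: D homfun_add)
  next
    fix c e p q assume "(e, p) \<in> ideal_add n P d l" and q: "q \<in> homfun n c"
    then obtain p' p'' where p: "p = p' + p'' * l" "(e, p') \<in> P" "p'' \<in> homfun n (e - d)" "e < d \<longrightarrow> p'' = 0"
      by (auto simp: ideal_add_def)
    show "(c + e, q * p) \<in> ideal_add n P d l"
    proof (cases "e < d")
      case True
      then show ?thesis using p D(4)[OF p(2) q] sub by auto
    next
      case False
      then have "q * p'' \<in> homfun n (c + e - d)" using homfun_mult[OF q p(3)] by simp
      then show ?thesis unfolding ideal_add_def using p D(4)[OF p(2) q] False
        by (intro CollectI exI[of _ "c + e"] exI[of _ "q * p'"] exI[of _ "q * p''"]) (auto simp: algebra_simps)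
    qed
  qed
qed

lemma maximal_relevant_ideal:
  assumes "graded_ideal n I" "relevant n I"
  obtains P where "graded_ideal n P" "relevant n P" "I \<subseteq> P"
    "\<And>Q. graded_ideal n Q \<Longrightarrow> relevant n Q \<Longrightarrow> P \<subseteq> Q \<Longrightarrow> Q = P"
proof -
  let ?S = "{P. graded_ideal n P \<and> relevant n P \<and> I \<subseteq> P}"
  have "\<exists>M\<in>?S. \<forall>X\<in>?S. M \<subseteq> X \<longrightarrow> X = M"
  proof (rule subset_Zorn_nonempty)
    show "?S \<noteq> {}" using assms by auto
    fix C assume C: "C \<noteq> {}" "subset.chain ?S C"
    have CS: "graded_ideal n P" "relevant n P" "I \<subseteq> P" if "P \<in> C" for P
      using C(2) that by (auto simp: subset_chain_def)
    have "graded_ideal n (\<Union>C)" unfolding graded_ideal_def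
    proof (intro conjI allI impI ballI)
      show "case z of (e, p) \<Rightarrow> p \<in> homfun n e" if "z \<in> \<Union>C" for z 
        using that graded_idealD(1)[OF CS(1)] by auto
      show "(e, 0) \<in> \<Union>C" for e using C(1) graded_idealD(2)[OF CS(1)] by auto
      fix e p q assume pq: "(e, p) \<in> \<Union>C" "(e, q) \<in> \<Union>C"
      obtain Q where "Q \<in> C" "{(e, p), (e, q)} \<subseteq> Q"
        by (rule finite_subset_Union_chain[OF _ _ C(1,2), of "{(e, p), (e, q)}"]) (use pq in auto)
      then show "(e, p + q) \<in> \<Union>C" using graded_idealD(3)[OF CS(1)[of Q]] by auto
    next
      fix d e p q assume "(e, p) \<in> \<Union>C" "q \<in> homfun n d"
      then show "(d + e, q * p) \<in> \<Union>C" using graded_idealD(4)[OF CS(1)] by blast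
    qed
    moreover have "relevant n (\<Union>C)"
    proof (rule ccontr)
      assume "\<not> relevant n (\<Union>C)"
      then obtain N where N: "\<And>u. u \<in> words n N \<Longrightarrow> (N, monfun u) \<in> \<Union>C" by (auto simp: relevant_def)
      \<comment> \<open>There are finitely many monomials of degree \<open>N\<close>, so a single
        member of the chain contains them all.\<close>
      obtain Q where "Q \<in> C" "(\<lambda>u. (N, monfun u)) ` words n N \<subseteq> Q"
        by (rule finite_subset_Union_chain[OF _ _ C(1,2), of "(\<lambda>u. (N, monfun u)) ` words n N"])
          (use N finite_words in auto)
      moreover then obtain u where "u \<in> words n N" "(N, monfun u) \<notin> Q" using CS(2)[of Q] unfolding relevant_def by blast
      ultimately show False by blast
    qed
    ultimately show "\<Union>C \<in> ?S" using CS(3) C(1) by blast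
  qed
  then obtain M where "M \<in> ?S" "\<forall>X\<in>?S. M \<subseteq> X \<longrightarrow> X = M" by blast
  then show ?thesis by (intro that[of M]) auto
qed

section \<open>Binary forms and their factorization\<close>

lemma coeff_synthetic:
  fixes B :: "complex poly"
  assumes A: "\<And>i. coeff ([:- r, 1:] * B) i \<in> \<A>" and r: "r \<in> \<A>"
  shows "coeff B i \<in> \<A>"
proof (induction "Suc (degree B) - i" arbitrary: i)
  case 0
  then have "coeff B i = 0" by (intro coeff_eq_0) auto
  then show ?case by (simp add: alg_closed_under)
next
  case (Suc k)
  then have "coeff B (Suc i) \<in> \<A>" by (intro Suc.hyps(1)) auto
  \<comment> \<open>Synthetic division, run from the top coefficient downwards.\<close>
  moreover have "coeff B i = coeff ([:- r, 1:] * B) (Suc i) + r * coeff B (Suc i)" by simp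
  ultimately show ?case using A r by (metis alg_closed_under(3,4))
qed

text \<open>The binary form \<open>y ^ D * A (z / y)\<close>, cleared of denominators.
  \<open>D\<close> may exceed the degree of \<open>A\<close>, and then powers of \<open>y\<close>
  split off.\<close>

definition homogenize :: "nat \<Rightarrow> complex poly \<Rightarrow> polyfun \<Rightarrow> polyfun \<Rightarrow> polyfun" where
  "homogenize D A y z = (\<Sum>t\<le>D. constfun (coeff A t) * y ^ (D - t) * z ^ t)"

lemma homogenize_apply:
  assumes "degree A \<le> D"
  shows "homogenize D A y z x = (if y x = 0 then coeff A D * z x ^ D else y x ^ D * poly A (z x / y x))"
proof (cases "y x = 0")
  case True
  have "homogenize D A y z x = (\<Sum>t\<le>D. if t = D then coeff A D * z x ^ D else 0)"
    unfolding homogenize_def sum_fun_apply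
    by (intro sum.cong) (auto simp: power_fun_apply constfun_simps True)
  then show ?thesis using True by simp
next
  case False
  have "poly A (z x / y x) = (\<Sum>t\<le>D. coeff A t * (z x / y x) ^ t)"
    unfolding poly_altdef using assms by (intro sum.mono_neutral_left) (auto simp: coeff_eq_0)
  then have "y x ^ D * poly A (z x / y x) = (\<Sum>t\<le>D. coeff A t * (y x ^ D / y x ^ t) * z x ^ t)"
    by (simp add: sum_distrib_left power_divide mult_ac)
  also have "\<dots> = homogenize D A y z x"
    unfolding homogenize_def sum_fun_apply
    by (intro sum.cong) (auto simp: power_fun_apply constfun_simps power_diff False)
  finally show ?thesis using False by simp
qed

lemma homfun_homogenize:
  assumes "\<And>i. coeff A i \<in> \<A>" "y \<in> homfun n 1" "z \<in> homfun n 1"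
  shows "homogenize D A y z \<in> homfun n D"
  unfolding homogenize_def
proof (intro homfun_sum)
  fix t assume "t \<in> {..D}"
  then show "constfun (coeff A t) * y ^ (D - t) * z ^ t \<in> homfun n D"
    using homfun_mult[OF homfun_cmult[OF assms(1) homfun_power[OF assms(2)]] homfun_power[OF assms(3)], of t "D - t" t] by simp
qed

context
  fixes n P
  assumes P: "graded_ideal n P" and rel: "relevant n P"
    and max: "\<And>Q. graded_ideal n Q \<Longrightarrow> relevant n Q \<Longrightarrow> P \<subseteq> Q \<Longrightarrow> Q = P"
begin

lemmas P_hom = graded_idealD(1)[OF P] and P_0 = graded_idealD(2)[OF P] 
  and P_add = graded_idealD(3)[OF P] and P_mult = graded_idealD(4)[OF P]

lemma P_sum: "(\<And>i. i \<in> I \<Longrightarrow> (e, f i) \<in> P) \<Longrightarrow> (e, \<Sum>i\<in>I. f i) \<in> P"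
  by (induction I rule: infinite_finite_induct) (auto intro: P_0 P_add)

lemma P_cmult: "c \<in> \<A> \<Longrightarrow> (e, p) \<in> P \<Longrightarrow> (e, constfun c * p) \<in> P"
  using P_mult[OF _ homfun_const, of e p c] by simp

lemma P_diff: "(e, p) \<in> P \<Longrightarrow> (e, q) \<in> P \<Longrightarrow> (e, p - q) \<in> P"
  using P_add[of e p "- q"] P_cmult[of "-1" e q] alg_closed_under(5)[OF alg_closed_under(2)] by (simp add: constfun_simps)

text \<open>By maximality \<open>P\<close> and \<open>l\<close> together generate an ideal that is
  no longer relevant.\<close>

lemma outside:
  assumes "l \<in> homfun n d" "(d, l) \<notin> P"
  obtains N where "\<And>u. u \<in> words n N \<Longrightarrow> 
    \<exists>p q. monfun u = p + q * l \<and> (N, p) \<in> P \<and> q \<in> homfun n (N - d) \<and> (N < d \<longrightarrow> q = 0)"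
proof -
  note ia = graded_ideal_ideal_add[OF P assms(1)]
  have "\<not> relevant n (ideal_add n P d l)" using max[OF ia(1)] ia(2,3) assms(2) by blast
  then obtain N where N: "\<And>u. u \<in> words n N \<Longrightarrow> (N, monfun u) \<in> ideal_add n P d l" 
    unfolding relevant_def by blast
  show ?thesis
  proof (rule that[of N])
    fix u assume "u \<in> words n N"
    then show "\<exists>p q. monfun u = p + q * l \<and> (N, p) \<in> P \<and> q \<in> homfun n (N - d) \<and> (N < d \<longrightarrow> q = 0)"
      using N unfolding ideal_add_def by blast
  qed
qed

text \<open>For \<open>a\<close> and \<open>b\<close> outside \<open>P\<close>, all monomials of
  some degree \<open>N\<close> are multiples of \<open>a\<close> modulo \<open>P\<close>, and all
  those of some degree \<open>M\<close> are multiples of \<open>b\<close>. Cutting a word of length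
  \<open>N + M\<close> in two shows that \<open>a * b\<close> in \<open>P\<close> would make
  \<open>P\<close> irrelevant.\<close>

lemma P_prime:
  assumes a: "a \<in> homfun n d" "(d, a) \<notin> P" and b: "b \<in> homfun n e" "(e, b) \<notin> P"
  shows "(d + e, a * b) \<notin> P"
proof
  assume ab: "(d + e, a * b) \<in> P"
  obtain N where N: "\<And>u. u \<in> words n N \<Longrightarrow> 
    \<exists>p q. monfun u = p + q * a \<and> (N, p) \<in> P \<and> q \<in> homfun n (N - d) \<and> (N < d \<longrightarrow> q = 0)" using outside[OF a] by blast
  obtain M where M: "\<And>u. u \<in> words n M \<Longrightarrow> 
    \<exists>p q. monfun u = p + q * b \<and> (M, p) \<in> P \<and> q \<in> homfun n (M - e) \<and> (M < e \<longrightarrow> q = 0)" using outside[OF b] by blast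
  have "(N + M, monfun u) \<in> P" if "u \<in> words n (N + M)" for u
  proof -
    define v w where "v = take N u" and "w = drop N u"
    have vw: "v \<in> words n N" "w \<in> words n M" "u = v @ w"
      using that by (auto simp: words_def v_def w_def dest: in_set_takeD in_set_dropD)
    obtain p q where p: "monfun v = p + q * a" "(N, p) \<in> P" "q \<in> homfun n (N - d)" "N < d \<longrightarrow> q = 0" using N[OF vw(1)] by blast
    obtain p' q' where p': "monfun w = p' + q' * b" "(M, p') \<in> P" "q' \<in> homfun n (M - e)" "M < e \<longrightarrow> q' = 0" using M[OF vw(2)] by blast
    have qa: "q * a \<in> homfun n N" using homfun_mult[OF p(3) a(1)] p(4) homfun_0 by (cases "N < d") auto
    have 1: "(N + M, monfun w * p) \<in> P" using P_mult[OF p(2) homfun_mon[OF vw(2)]] by (simp add: add.commute)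
    have 2: "(N + M, (q * a) * p') \<in> P" using P_mult[OF p'(2) qa] .
    have 3: "(N + M, (q * q') * (a * b)) \<in> P"
    proof (cases "N < d \<or> M < e")
      case True then show ?thesis using p(4) p'(4) P_0 by auto
    next
      case False
      then have "N - d + (M - e) + (d + e) = N + M" by simp
      then show ?thesis using P_mult[OF ab homfun_mult[OF p(3) p'(3)]] by metis
    qed
    have "monfun u = monfun w * p + ((q * a) * p' + (q * q') * (a * b))"
      by (simp add: vw(3) monfun_simps p(1) p'(1) algebra_simps)
    then show ?thesis using P_add[OF 1 P_add[OF 2 3]] by simp
  qed
  then show False using rel unfolding relevant_def by blast
qed

lemma P_const: assumes "c \<in> \<A>" "c \<noteq> 0" shows "(0, constfun c) \<notin> P"
proof
  assume *: "(0, constfun c) \<in> P"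
  obtain u where u: "u \<in> words n 0" "(0, monfun u) \<notin> P" using rel unfolding relevant_def by blast
  have "(0, constfun (inverse c) * constfun c) \<in> P" using * assms by (intro P_cmult alg_closed_under(6))
  moreover have "constfun (inverse c) * constfun c = 1" using assms(2) by (simp flip: constfun_simps)
  ultimately show False using u by (simp add: words_def monfun_simps)
qed

lemma P_power: assumes "y \<in> homfun n 1" "(1, y) \<notin> P" shows "(d, y ^ d) \<notin> P"
proof (induction d)
  case 0 then show ?case using P_const[of 1] by (simp add: constfun_simps alg_closed_under flip: one_fun_def)
next
  case (Suc d) then show ?case using P_prime[OF assms homfun_power[OF assms(1)] Suc] unfolding power_Suc plus_1_eq_Suc by blast
qed

text \<open>Over an algebraically closed field the form splits into linear factors, and the prime
  ideal \<open>P\<close> contains one of them. Constants and \<open>y\<close> are excluded, so it is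
  a factor belonging to a root of \<open>A\<close>.\<close>

lemma binary_form_factor:
  assumes y: "y \<in> homfun n 1" "(1, y) \<notin> P" and z: "z \<in> homfun n 1"
    and A: "\<And>i. coeff A i \<in> \<A>" "A \<noteq> 0" "degree A \<le> D" and "(D, homogenize D A y z) \<in> P"
  shows "\<exists>r\<in>\<A>. (1, z - constfun r * y) \<in> P"
  using A assms(7)
proof (induction D arbitrary: A)
  case 0
  then obtain c where c: "A = [:c:]" by (metis degree_eq_zeroE le_zero_eq)
  have "homogenize 0 A y z = constfun c" by (simp add: homogenize_def c fun_eq_iff constfun_simps power_fun_apply)
  moreover have "c \<in> \<A>" "c \<noteq> 0" using 0(1)[of 0] 0(2) by (auto simp: c)
  ultimately show ?case using 0(4) P_const[of c] by simp
next
  case (Suc D)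
  note hom = homfun_homogenize[OF _ y(1) z]
  show ?case
  proof (cases "degree A = 0")
    case True
    \<comment> \<open>For constant \<open>A\<close> the form is divisible by \<open>y\<close>, which
      lies outside \<open>P\<close> and can be cancelled.\<close>
    then have "homogenize (Suc D) A y z = y * homogenize D A y z"
      by (auto simp: fun_eq_iff homogenize_apply coeff_eq_0)
    then have "(1 + D, y * homogenize D A y z) \<in> P" using Suc.prems(4) by (simp only: plus_1_eq_Suc)
    then have "(D, homogenize D A y z) \<in> P" using P_prime[OF y hom[OF Suc.prems(1)]] by blast
    then show ?thesis using Suc.IH[OF Suc.prems(1,2)] True by simp
  next
    case False
    then obtain r where r: "poly A r = 0" using alg_closed_imp_poly_has_root[of A] by auto
    then obtain B where B: "A = [:- r, 1:] * B" using poly_eq_0_iff_dvd by blast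
    have rA: "r \<in> \<A>" using alg_poly_root[OF Suc.prems(1,2) r] .
    have BA: "coeff B i \<in> \<A>" for i using coeff_synthetic[OF _ rA, of B] Suc.prems(1) unfolding B by blast
    have B0: "B \<noteq> 0" using Suc.prems(2) B by auto
    have dB: "degree B \<le> D" using Suc.prems(3) B0 unfolding B by (subst (asm) degree_mult_eq) auto
    have zl: "z - constfun r * y \<in> homfun n 1" using z y rA by (intro homfun_diff homfun_cmult)
    have "homogenize (Suc D) A y z = (z - constfun r * y) * homogenize D B y z"
    proof
      fix x
      have cA: "coeff A (Suc D) = coeff B D" unfolding B using dB by (simp add: coeff_eq_0)
      have pA: "poly A t = (t - r) * poly B t" for t unfolding B by (simp add: algebra_simps)
      have "y x ^ Suc D * ((z x / y x - r) * poly B (z x / y x)) = (z x - r * y x) * (y x ^ D * poly B (z x / y x))"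
        if "y x \<noteq> 0" using that by (simp add: field_simps)
      then show "homogenize (Suc D) A y z x = ((z - constfun r * y) * homogenize D B y z) x"
        by (simp add: homogenize_apply[OF dB] homogenize_apply[OF Suc.prems(3)] constfun_simps cA pA)
    qed
    then have "(1 + D, (z - constfun r * y) * homogenize D B y z) \<in> P" using Suc.prems(4) by (simp only: plus_1_eq_Suc)
    then have "(1, z - constfun r * y) \<in> P \<or> (D, homogenize D B y z) \<in> P" 
      using P_prime[OF zl _ hom[OF BA]] by blast
    then show ?thesis using Suc.IH[OF BA B0 dB] rA by blast
  qed
qed

text \<open>Modulo \<open>P\<close>, multiplication by a linear form outside \<open>P\<close> is surjective in large degrees, so the
  graded pieces have bounded dimension. Hence two linear forms satisfy a binary form modulo \<open>P\<close>, which
  splits into linear factors.\<close>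
lemma proportional:
  assumes y: "y \<in> homfun n 1" "(1, y) \<notin> P" and z: "z \<in> homfun n 1"
  shows "\<exists>r\<in>\<A>. (1, z - constfun r * y) \<in> P"
proof -
  obtain N where N: "\<And>u. u \<in> words n N \<Longrightarrow> 
    \<exists>p q. monfun u = p + q * y \<and> (N, p) \<in> P \<and> q \<in> homfun n (N - 1) \<and> (N < 1 \<longrightarrow> q = 0)" using outside[OF y] by blast
  \<comment> \<open>The first \<open>N\<close> letters of a word are congruent to a multiple of
    \<open>y\<close>; extracting one factor \<open>y\<close> at a time leaves a form of degree
    \<open>N\<close>.\<close>
  have reduce: "\<exists>g\<in>homfun n N. (N + j, f - y ^ j * g) \<in> P" if "f \<in> homfun n (N + j)" for f j
    using that
  proof (induction j arbitrary: f)
    case 0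
    have eq: "f - y ^ 0 * f = 0" by (simp add: fun_eq_iff)
    have "(N + 0, f - y ^ 0 * f) \<in> P" unfolding eq by (rule P_0)
    then show ?case by (rule bexI[of "\<lambda>g. (N + 0, f - y ^ 0 * g) \<in> P" f]) (use 0 in simp)
  next
    case (Suc j)
    have mon: "\<exists>h\<in>homfun n (N + j). (N + Suc j, monfun u - y * h) \<in> P" if u: "u \<in> words n (N + Suc j)" for u
    proof -
      define v w where "v = take N u" and "w = drop N u"
      have vw: "v \<in> words n N" "w \<in> words n (Suc j)" "u = v @ w"
        using u by (auto simp: words_def v_def w_def dest: in_set_takeD in_set_dropD)
      obtain p q where p: "monfun v = p + q * y" "(N, p) \<in> P" "q \<in> homfun n (N - 1)" "N < 1 \<longrightarrow> q = 0" using N[OF vw(1)] by blast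
      have h: "q * monfun w \<in> homfun n (N + j)"
      proof (cases "N < 1")
        case False
        then show ?thesis using homfun_mult[OF p(3) homfun_mon[OF vw(2)]] by simp
      qed (use p(4) homfun_0 in simp)
      have "monfun u - y * (q * monfun w) = monfun w * p" by (simp add: vw(3) monfun_simps p(1) algebra_simps)
      then show ?thesis using h P_mult[OF p(2) homfun_mon[OF vw(2)]] 
        by (intro bexI[of _ "q * monfun w"]) (auto simp: add.commute)
    qed
    then obtain h where h: "\<And>u. u \<in> words n (N + Suc j) \<Longrightarrow> h u \<in> homfun n (N + j)"
      "\<And>u. u \<in> words n (N + Suc j) \<Longrightarrow> (N + Suc j, monfun u - y * h u) \<in> P" by metis
    obtain a where a: "\<And>u. a u \<in> \<A>" "f = (\<Sum>u\<in>words n (N + Suc j). constfun (a u) * monfun u)" 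
      using homfunE[OF Suc.prems] by blast
    define f' where "f' = (\<Sum>u\<in>words n (N + Suc j). constfun (a u) * h u)"
    have "f' \<in> homfun n (N + j)" unfolding f'_def by (intro homfun_sum homfun_cmult a h)
    then obtain g where g: "g \<in> homfun n N" "(N + j, f' - y ^ j * g) \<in> P" using Suc.IH by blast
    have "f - y * f' = (\<Sum>u\<in>words n (N + Suc j). constfun (a u) * (monfun u - y * h u))"
      unfolding a(2) f'_def by (simp add: sum_distrib_left algebra_simps flip: sum_subtractf)
    then have 1: "(N + Suc j, f - y * f') \<in> P" by (simp only:) (intro P_sum P_cmult a h)
    have 2: "(N + Suc j, y * (f' - y ^ j * g)) \<in> P" using P_mult[OF g(2) y(1)] by simp
    have "f - y ^ Suc j * g = (f - y * f') + y * (f' - y ^ j * g)" by (simp add: algebra_simps)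
    then show ?case using g(1) P_add[OF 1 2] by metis
  qed
  \<comment> \<open>The \<open>h + 1\<close> forms \<open>y ^ (D - t) * z ^ t\<close> with
    \<open>t \<le> h\<close> reduce to \<open>y ^ h\<close> times forms of degree \<open>N\<close>.
    The latter are combinations of only \<open>h\<close> words, so they are linearly
    dependent.\<close>
  define h where "h = card (words n N)"
  define D where "D = N + h"
  have "\<exists>g\<in>homfun n N. (D, y ^ (D - t) * z ^ t - y ^ h * g) \<in> P" if "t \<le> h" for t
  proof -
    have "y ^ (D - t) * z ^ t \<in> homfun n (D - t + t)" by (intro homfun_mult homfun_power y z)
    then show ?thesis using reduce[of _ h] that by (simp add: D_def)
  qed
  then obtain g where g: "\<And>t. t \<le> h \<Longrightarrow> g t \<in> homfun n N" "\<And>t. t \<le> h \<Longrightarrow> (D, y ^ (D - t) * z ^ t - y ^ h * g t) \<in> P"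
    by metis
  have "\<exists>c. (\<forall>u. c u \<in> \<A>) \<and> g t = (\<Sum>u\<in>words n N. constfun (c u) * monfun u)" if "t \<le> h" for t
    using g(1)[OF that] by (auto simp: homfun_def)
  then obtain c where c: "\<And>t u. t \<le> h \<Longrightarrow> c t u \<in> \<A>" 
    "\<And>t. t \<le> h \<Longrightarrow> g t = (\<Sum>u\<in>words n N. constfun (c t u) * monfun u)" by metis
  obtain a where a: "\<forall>t\<in>{..h}. a t \<in> \<A>" "\<exists>t\<in>{..h}. a t \<noteq> 0" "\<forall>u\<in>words n N. (\<Sum>t\<in>{..h}. a t * c t u) = 0"
    using linear_dependence[OF is_subfield_algebraic_numbers finite_words, of "{..h}" n N c] c(1)
    by (auto simp: h_def)
  have constsum: "constfun (\<Sum>t\<in>I. f t) = (\<Sum>t\<in>I. constfun (f t))" for f and I :: "nat set"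
    by (simp add: fun_eq_iff constfun_simps sum_fun_apply)
  have "(\<Sum>t\<le>h. constfun (a t) * g t) = (\<Sum>t\<le>h. \<Sum>u\<in>words n N. constfun (a t * c t u) * monfun u)"
    by (intro sum.cong refl) (simp add: c(2) sum_distrib_left constfun_simps mult_ac)
  also have "\<dots> = (\<Sum>u\<in>words n N. \<Sum>t\<le>h. constfun (a t * c t u) * monfun u)" by (rule sum.swap)
  also have "\<dots> = (\<Sum>u\<in>words n N. constfun (\<Sum>t\<le>h. a t * c t u) * monfun u)"
    by (simp only: constsum sum_distrib_right)
  also have "\<dots> = 0" using a(3) by (simp add: constfun_simps)
  finally have ag: "(\<Sum>t\<le>h. constfun (a t) * g t) = 0" .
  define A where "A = (\<Sum>t\<le>h. monom (a t) t)"
  have cA: "coeff A t = (if t \<le> h then a t else 0)" for t by (simp add: A_def coeff_sum)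
  have "homogenize D A y z = (\<Sum>t\<le>h. constfun (a t) * y ^ (D - t) * z ^ t)"
    unfolding homogenize_def cA by (intro sum.mono_neutral_cong_right) (auto simp: D_def constfun_simps)
  also have "\<dots> = (\<Sum>t\<le>h. constfun (a t) * (y ^ (D - t) * z ^ t - y ^ h * g t)) + y ^ h * (\<Sum>t\<le>h. constfun (a t) * g t)"
    by (simp add: sum_distrib_left algebra_simps flip: sum.distrib)
  also have "\<dots> = (\<Sum>t\<le>h. constfun (a t) * (y ^ (D - t) * z ^ t - y ^ h * g t))" by (simp add: ag)
  finally have "(D, homogenize D A y z) \<in> P" by (simp only:) (intro P_sum P_cmult; use a(1) g(2) in simp)
  moreover have "A \<noteq> 0" using a(2) cA by (metis atMost_iff coeff_0)
  moreover have "degree A \<le> D" by (intro degree_le) (auto simp: cA D_def)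
  moreover have "coeff A i \<in> \<A>" for i using a(1) by (simp add: cA alg_closed_under)
  ultimately show ?thesis using binary_form_factor[OF y z] by blast
qed

text \<open>Some variable \<open>m\<close> lies outside \<open>P\<close>, and modulo
  \<open>P\<close> every variable is a constant multiple of it. These constants form the point
  \<open>z\<close>. A form \<open>p\<close> of degree \<open>e\<close> is congruent to
  \<open>p z\<close> times the \<open>e\<close>-th power of that variable, so \<open>p\<close> in
  \<open>P\<close> forces \<open>p z = 0\<close>.\<close>

lemma projective_zero:
  "\<exists>z m. (\<forall>i. z i \<in> \<A>) \<and> m < n \<and> z m = 1 \<and> (\<forall>(e, p)\<in>P. p z = 0)"
proof -
  obtain u where u: "u \<in> words n 1" "(1, monfun u) \<notin> P" using rel unfolding relevant_def by blast
  then obtain m where m: "u = [m]" "m < n" by (auto simp: words_def length_Suc_conv)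
  define y where "y = coordfun m"
  have y: "y \<in> homfun n 1" "(1, y) \<notin> P" using u m homfun_coord[of m n] by (auto simp: y_def monfun_simps)
  have "\<exists>r\<in>\<A>. (1, coordfun i - constfun r * y) \<in> P" if "i < n" for i
    by (rule proportional[OF y homfun_coord[OF that]])
  then obtain r where r: "\<And>i. i < n \<Longrightarrow> r i \<in> \<A>" "\<And>i. i < n \<Longrightarrow> (1, coordfun i - constfun (r i) * y) \<in> P" by metis
  \<comment> \<open>The value 1 at \<open>m\<close> normalises the point; at the indices from
    \<open>n\<close> on it is an arbitrary algebraic value.\<close>
  define z where "z = (\<lambda>i. if i < n \<and> i \<noteq> m then r i else 1)"
  have zA: "z i \<in> \<A>" for i using r(1) by (auto simp: z_def alg_closed_under)
  have zP: "(1, coordfun i - constfun (z i) * y) \<in> P" if "i < n" for i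
    using r(2)[OF that] that P_0 by (auto simp: z_def y_def constfun_simps)
  have monA: "monfun u z \<in> \<A>" for u
    by (induction u) (auto simp: monfun_simps coordfun_apply zA alg_closed_under)
  have mon: "(e, monfun u - constfun (monfun u z) * y ^ e) \<in> P" if "u \<in> words n e" for u e
    using that
  proof (induction u arbitrary: e)
    case Nil
    then have "e = 0" by (simp add: words_def)
    moreover have "monfun [] - constfun (monfun [] z) * y ^ 0 = 0" by (simp add: fun_eq_iff monfun_simps constfun_simps)
    ultimately show ?case using P_0 by metis
  next
    case (Cons i u)
    then obtain d where d: "e = Suc d" "u \<in> words n d" "i < n" by (auto simp: words_def)
    have 1: "(d + 1, monfun u * (coordfun i - constfun (z i) * y)) \<in> P" 
      by (rule P_mult[OF zP[OF d(3)] homfun_mon[OF d(2)]])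
    have 2: "(1 + d, (constfun (z i) * y) * (monfun u - constfun (monfun u z) * y ^ d)) \<in> P"
      by (rule P_mult[OF Cons.IH[OF d(2)] homfun_cmult[OF zA y(1)]])
    have "monfun (i # u) - constfun (monfun (i # u) z) * y ^ e = monfun u * (coordfun i - constfun (z i) * y) + 
        (constfun (z i) * y) * (monfun u - constfun (monfun u z) * y ^ d)"
      by (simp add: d monfun_simps constfun_simps coordfun_apply algebra_simps)
    moreover have "(d + 1, monfun u * (coordfun i - constfun (z i) * y) + 
        (constfun (z i) * y) * (monfun u - constfun (monfun u z) * y ^ d)) \<in> P"
      by (rule P_add[OF 1 2[unfolded add.commute[of 1 d]]])
    ultimately show ?case using d(1) by (metis Suc_eq_plus1)
  qed
  have "p z = 0" if p: "(e, p) \<in> P" for e p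
  proof (rule ccontr)
    assume nz: "p z \<noteq> 0"
    obtain a where a: "\<And>u. a u \<in> \<A>" "p = (\<Sum>u\<in>words n e. constfun (a u) * monfun u)" 
      using homfunE[OF P_hom[OF p]] by blast
    have pz: "p z = (\<Sum>u\<in>words n e. a u * monfun u z)" by (simp add: a(2) sum_fun_apply constfun_simps)
    have "p - constfun (p z) * y ^ e = (\<Sum>u\<in>words n e. constfun (a u) * (monfun u - constfun (monfun u z) * y ^ e))"
    proof
      fix x
      have "(p - constfun (p z) * y ^ e) x = (\<Sum>u\<in>words n e. a u * monfun u x) - p z * (y ^ e) x"
        by (simp add: a(2) sum_fun_apply constfun_simps)
      also have "\<dots> = (\<Sum>u\<in>words n e. a u * (monfun u x - monfun u z * (y ^ e) x))"
        unfolding pz by (simp add: right_diff_distrib sum_subtractf sum_distrib_right mult.assoc)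
      finally show "(p - constfun (p z) * y ^ e) x = (\<Sum>u\<in>words n e. constfun (a u) * (monfun u - constfun (monfun u z) * y ^ e)) x"
        by (simp add: sum_fun_apply constfun_simps)
    qed
    then have "(e, p - constfun (p z) * y ^ e) \<in> P" by (simp only:) (intro P_sum P_cmult a mon)
    then have "(e, p - (p - constfun (p z) * y ^ e)) \<in> P" by (rule P_diff[OF p])
    moreover have "p - (p - constfun (p z) * y ^ e) = constfun (p z) * y ^ e" by (simp add: fun_eq_iff)
    ultimately have *: "(e, constfun (p z) * y ^ e) \<in> P" by (simp only:)
    have pzA: "p z \<in> \<A>" unfolding pz by (intro alg_sum alg_closed_under(4) a monA)
    have "(e, constfun (inverse (p z)) * (constfun (p z) * y ^ e)) \<in> P"
      by (rule P_cmult[OF alg_closed_under(6)[OF pzA] *])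
    moreover have "constfun (inverse (p z)) * (constfun (p z) * y ^ e) = y ^ e"
      using nz by (auto simp: fun_eq_iff constfun_simps)
    ultimately show False using P_power[OF y] by simp
  qed
  then show ?thesis using zA m(2) by (intro exI[of _ z] exI[of _ m]) (auto simp: z_def)
qed

end

text \<open>If the ideal generated by the \<open>g j\<close> were relevant, a maximal relevant ideal
  above it would supply a common zero with a coordinate 1. So it contains all monomials of some
  degree \<open>N\<close>. Because the ideal is graded, the cofactors are forms of the complementary
  degrees, which the height estimates rely on.\<close>

theorem homogeneous_nullstellensatz:
  fixes k :: nat and g :: "nat \<Rightarrow> polyfun"
  assumes g: "\<And>j. j < k \<Longrightarrow> g j \<in> homfun n (d j)"
    and nz: "\<And>z. (\<And>i. z i \<in> \<A>) \<Longrightarrow> (\<And>j. j < k \<Longrightarrow> g j z = 0) \<Longrightarrow> \<forall>i<n. z i = 0"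
  shows "\<exists>N A. (\<forall>i<n. \<forall>j<k. A i j \<in> homfun n (N - d j) \<and> (N < d j \<longrightarrow> A i j = 0)) \<and>
    (\<forall>i<n. \<forall>x. x i ^ N = (\<Sum>j<k. A i j x * g j x))"
proof -
  define I where "I = {(e, \<Sum>j<k. A j * g j) |e A. \<forall>j<k. A j \<in> homfun n (e - d j) \<and> (e < d j \<longrightarrow> A j = 0)}"
  have gI: "graded_ideal n I" unfolding graded_ideal_def
  proof (intro conjI allI impI ballI)
    show "case z of (e, p) \<Rightarrow> p \<in> homfun n e" if z: "z \<in> I" for z
    proof -
      obtain e A where A: "z = (e, \<Sum>j<k. A j * g j)" "\<And>j. j < k \<Longrightarrow> A j \<in> homfun n (e - d j) \<and> (e < d j \<longrightarrow> A j = 0)"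
        using z by (auto simp: I_def)
      have "A j * g j \<in> homfun n e" if "j < k" for j
        using A(2)[OF that] homfun_mult[OF _ g[OF that], of "A j" "e - d j"] homfun_0 by (cases "e < d j") auto
      then show ?thesis unfolding A(1) prod.case by (intro homfun_sum) auto
    qed
    show "(e, 0) \<in> I" for e unfolding I_def
      by (intro CollectI exI[of _ e] exI[of _ "\<lambda>_. 0"]) (auto simp: homfun_0)
    fix e p q assume "(e, p) \<in> I" "(e, q) \<in> I"
    then obtain A B where AB: "p = (\<Sum>j<k. A j * g j)" "\<forall>j<k. A j \<in> homfun n (e - d j) \<and> (e < d j \<longrightarrow> A j = 0)"
      "q = (\<Sum>j<k. B j * g j)" "\<forall>j<k. B j \<in> homfun n (e - d j) \<and> (e < d j \<longrightarrow> B j = 0)" by (auto simp: I_def)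
    then show "(e, p + q) \<in> I" unfolding I_def
      by (intro CollectI exI[of _ e] exI[of _ "\<lambda>j. A j + B j"]) (auto simp: ring_distribs sum.distrib homfun_add)
  next
    fix c e p q assume "(e, p) \<in> I" and q: "q \<in> homfun n c"
    then obtain A where A: "p = (\<Sum>j<k. A j * g j)" "\<forall>j<k. A j \<in> homfun n (e - d j) \<and> (e < d j \<longrightarrow> A j = 0)"
      by (auto simp: I_def)
    have "q * A j \<in> homfun n (c + e - d j) \<and> (c + e < d j \<longrightarrow> q * A j = 0)" if "j < k" for j
    proof (cases "e < d j")
      case True
      then have "A j = 0" using A(2) that by blast
      then show ?thesis by (simp add: homfun_0)
    next
      case False
      then show ?thesis using homfun_mult[OF q, of "A j" "e - d j"] A(2) that by simp
    qed
    then show "(c + e, q * p) \<in> I" unfolding I_def A(1)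
      by (intro CollectI exI[of _ "c + e"] exI[of _ "\<lambda>j. q * A j"]) (auto simp: sum_distrib_left mult_ac)
  qed
  have gin: "(d j, g j) \<in> I" if j: "j < k" for j
  proof -
    have "(\<Sum>i<k. (if i = j then 1 else 0) * g i) = (\<Sum>i<k. if i = j then g j else 0)" by (intro sum.cong) auto
    also have "\<dots> = g j" using j by (subst sum.delta) auto
    finally show ?thesis unfolding I_def using homfun_const[OF alg_closed_under(2)] homfun_0
      by (intro CollectI exI[of _ "d j"] exI[of _ "\<lambda>i. if i = j then 1 else 0"]) (auto simp: constfun_simps)
  qed
  have "\<not> relevant n I"
  proof
    assume "relevant n I"
    then obtain P where P: "graded_ideal n P" "relevant n P" "I \<subseteq> P"
      "\<And>Q. graded_ideal n Q \<Longrightarrow> relevant n Q \<Longrightarrow> P \<subseteq> Q \<Longrightarrow> Q = P"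
      using maximal_relevant_ideal[OF gI] by metis
    obtain z m where z: "\<forall>i. z i \<in> \<A>" "m < n" "z m = 1" "\<forall>(e, p)\<in>P. p z = 0"
      using projective_zero[OF P(1,2,4)] by blast
    have "g j z = 0" if "j < k" for j using z(4) P(3) gin[OF that] by blast
    then show False using nz[of z] z by auto
  qed
  then obtain N where N: "\<And>u. u \<in> words n N \<Longrightarrow> (N, monfun u) \<in> I" unfolding relevant_def by blast
  have "\<exists>A. (\<forall>j<k. A j \<in> homfun n (N - d j) \<and> (N < d j \<longrightarrow> A j = 0)) \<and> monfun (replicate N i) = (\<Sum>j<k. A j * g j)"
    if "i < n" for i
  proof -
    have "replicate N i \<in> words n N" using that by (auto simp: words_def)
    then show ?thesis using N unfolding I_def by blast
  qed
  then obtain A where A: "\<And>i j. i < n \<Longrightarrow> j < k \<Longrightarrow> A i j \<in> homfun n (N - d j) \<and> (N < d j \<longrightarrow> A i j = 0)"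
    "\<And>i. i < n \<Longrightarrow> monfun (replicate N i) = (\<Sum>j<k. A i j * g j)" by metis
  have "x i ^ N = (\<Sum>j<k. A i j x * g j x)" if "i < n" for i x
    using fun_cong[OF A(2)[OF that], of x] by (simp add: monfun_apply sum_fun_apply)
  then show ?thesis using A(1) by blast
qed

section \<open>Height bounds for polynomial mappings\<close>

lemma arch_const_ge_1: "1 \<le> N \<Longrightarrow> 1 \<le> arch_const w N"
  and arch_const_mono: "N \<le> N' \<Longrightarrow> arch_const w N \<le> arch_const w N'"
  and arch_const_mult: "arch_const w (N * N') = arch_const w N * arch_const w N'"
  and ln_arch_const: "ln (arch_const w N) = (if w 2 > 1 then ln N else 0)"
  by (auto simp: arch_const_def)

lemma max_abs_mono: "S \<subseteq> T \<Longrightarrow> finite T \<Longrightarrow> max_abs w S \<le> max_abs w T"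
  by (intro max_abs_le max_abs_ge) (auto intro: finite_subset max_abs_ge)

text \<open>Logarithms turn the exponents of the local inequality into coefficients of heights. Each
  of the \<open>k\<close> constants adds \<open>ln N\<close>, counted at the archimedean place only,
  and the height of the coefficient set.\<close>

lemma height_bound:
  assumes X: "finite X" "X \<subseteq> \<A>" and Y: "finite Y" "Y \<subseteq> \<A>" and S: "finite S" "S \<subseteq> \<A>" and N: "1 \<le> N"
    and le: "\<And>v w. extends_place v w \<Longrightarrow> 
      max_abs w Y ^ a \<le> (arch_const w N * max_abs w S) ^ k * max_abs w X ^ b"
  shows "a * height Y \<le> b * height X + k * (ln N + height S)"
proof -
  note lX = local_term_height[OF X] and lY = local_term_height[OF Y] and lS = local_term_height[OF S]
    and lN = local_term_arch[of "ln N"]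
  have 1: "a * height Y = global_sum (\<lambda>w. a * ln (max_abs w Y))"
    unfolding height_def by (rule global_sum_cmult[OF lY, symmetric])
  have 2: "b * height X + k * (ln N + height S) = 
    global_sum (\<lambda>w. b * ln (max_abs w X) + k * ((if w 2 > 1 then ln N else 0) + ln (max_abs w S)))"
    unfolding height_def
    by (simp only: global_sum_add[OF local_term_cmult[OF lX] local_term_cmult[OF local_term_add[OF lN lS]]]
      global_sum_cmult[OF lX] global_sum_cmult[OF local_term_add[OF lN lS]] global_sum_add[OF lN lS] global_sum_arch)
  show ?thesis unfolding 1 2
  proof (rule global_sum_mono[OF local_term_cmult[OF lY] local_term_add[OF local_term_cmult[OF lX] local_term_cmult[OF local_term_add[OF lN lS]]]])
    fix v w assume vw: "extends_place v w"
    have pos: "max_abs w X \<ge> 1" "max_abs w Y \<ge> 1" "max_abs w S \<ge> 1" "arch_const w N \<ge> 1"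
      using max_abs_ge(1) X(1) Y(1) S(1) arch_const_ge_1 N by auto
    have "a * ln (max_abs w Y) = ln (max_abs w Y ^ a)" using pos by (simp add: ln_realpow)
    also have "\<dots> \<le> ln ((arch_const w N * max_abs w S) ^ k * max_abs w X ^ b)"
      using le[OF vw] pos by (subst ln_le_cancel_iff) auto
    also have "\<dots> = b * ln (max_abs w X) + k * ((if w 2 > 1 then ln N else 0) + ln (max_abs w S))"
      unfolding ln_arch_const[symmetric] using pos by (simp add: ln_mult ln_realpow)
    finally show "a * ln (max_abs w Y) \<le> b * ln (max_abs w X) + k * ((if w 2 > 1 then ln N else 0) + ln (max_abs w S))" .
  qed
qed

text \<open>A growth bound of degree \<open>D\<close>, uniform in places and points. As
  \<open>S\<close> is a fixed finite set, the constant is 1 at all but finitely many places.\<close>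

definition polybound :: "nat \<Rightarrow> nat \<Rightarrow> polyfun \<Rightarrow> real \<Rightarrow> complex set \<Rightarrow> bool" where
  "polybound n D F N S \<longleftrightarrow> finite S \<and> S \<subseteq> \<A> \<and> 1 \<le> N \<and>
     (\<forall>v w x. extends_place v w \<longrightarrow> (\<forall>i<n. x i \<in> \<A>) \<longrightarrow>
        F x \<in> \<A> \<and> w (F x) \<le> arch_const w N * max_abs w S * max_abs w (x ` {..<n}) ^ D)"

lemma polybound_mono:
  assumes "polybound n D F N S" "D \<le> D'" "N \<le> N'" "S \<subseteq> S'" "finite S'" "S' \<subseteq> \<A>"
  shows "polybound n D' F N' S'"
  unfolding polybound_def
proof (intro conjI allI impI)
  fix v w x assume vw: "extends_place v w" and x: "\<forall>i<n. x i \<in> \<A>"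
  show "F x \<in> \<A>" using assms(1) vw x by (auto simp: polybound_def)
  have "w (F x) \<le> arch_const w N * max_abs w S * max_abs w (x ` {..<n}) ^ D"
    using assms(1) vw x by (auto simp: polybound_def)
  also have "\<dots> \<le> arch_const w N' * max_abs w S' * max_abs w (x ` {..<n}) ^ D'"
  proof -
    have "1 \<le> N" "finite S" using assms(1) by (auto simp: polybound_def)
    then show ?thesis using assms arch_const_ge_1[of N w] max_abs_ge(1)[of S w] max_abs_ge(1)[of S' w]
        arch_const_mono[of N N' w] max_abs_mono[of S S' w] max_abs_ge(1)[of "x ` {..<n}" w]
      by (intro mult_mono power_increasing) auto
  qed
  finally show "w (F x) \<le> arch_const w N' * max_abs w S' * max_abs w (x ` {..<n}) ^ D'" .
qed (use assms in \<open>auto simp: polybound_def\<close>)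

lemma polybound_uniform:
  assumes "finite J" "\<And>j. j \<in> J \<Longrightarrow> \<exists>N S. polybound n (e j) (F j) N S"
  shows "\<exists>N S. finite S \<and> S \<subseteq> \<A> \<and> 1 \<le> N \<and> (\<forall>j\<in>J. polybound n (e j) (F j) N S)"
  using assms
proof (induction J rule: finite_induct)
  case empty
  then show ?case by (intro exI[of _ 1] exI[of _ "{}"]) auto
next
  case (insert j J)
  then obtain N S where NS: "finite S" "S \<subseteq> \<A>" "1 \<le> N" "\<forall>j\<in>J. polybound n (e j) (F j) N S" by auto
  obtain N' S' where NS': "polybound n (e j) (F j) N' S'" using insert.prems[of j] by blast
  have S': "finite S'" "S' \<subseteq> \<A>" using NS' by (auto simp: polybound_def)
  have "polybound n (e j) (F j) (max N N') (S \<union> S')"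
    using NS S' by (intro polybound_mono[OF NS']) auto
  moreover have "polybound n (e i) (F i) (max N N') (S \<union> S')" if "i \<in> J" for i
    by (rule polybound_mono[OF bspec[OF NS(4) that]]) (use NS S' in auto)
  ultimately show ?case using NS S' 
    by (intro exI[of _ "max N N'"] exI[of _ "S \<union> S'"]) auto
qed

lemma polybound_add:
  assumes "polybound n D F N S" "polybound n D G M T"
  shows "polybound n D (F + G) (2 * max N M) (S \<union> T)"
proof -
  have ST: "finite S" "S \<subseteq> \<A>" "finite T" "T \<subseteq> \<A>" using assms by (auto simp: polybound_def)
  define U K where "U = S \<union> T" and "K = max N M"
  have FG: "polybound n D F K U" "polybound n D G K U" 
    using ST by (auto simp: K_def U_def intro!: polybound_mono[OF assms(1)] polybound_mono[OF assms(2)])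
  have "polybound n D (F + G) (2 * K) U" unfolding polybound_def
  proof (intro conjI allI impI)
    fix v w x assume vw: "extends_place v w" and x: "\<forall>i<n. x i \<in> \<A>"
    let ?B = "arch_const w K * max_abs w U * max_abs w (x ` {..<n}) ^ D"
    have F: "F x \<in> \<A>" "w (F x) \<le> ?B" and G: "G x \<in> \<A>" "w (G x) \<le> ?B" using FG vw x by (auto simp: polybound_def)
    show "(F + G) x \<in> \<A>" using F G alg_closed_under(3) by simp
    have B: "?B \<ge> 0" using w_nonneg[OF vw F(1)] F(2) by simp
    \<comment> \<open>The two terms are summed over a two-element index set so that
      \<open>w_sum_bound\<close> supplies the factor \<open>arch_const w 2\<close>.\<close>
    have "w (\<Sum>i\<in>{0, 1::nat}. if i = 0 then F x else G x) \<le> arch_const w 2 * ?B"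
      using F G B by (intro w_sum_bound[OF vw]) auto
    then show "w ((F + G) x) \<le> arch_const w (2 * K) * max_abs w U * max_abs w (x ` {..<n}) ^ D"
      by (simp add: arch_const_mult)
  qed (use FG in \<open>auto simp: polybound_def\<close>)
  then show ?thesis by (simp add: U_def K_def)
qed

lemma polybound_0: "polybound n D 0 1 {}"
  unfolding polybound_def
proof (intro conjI allI impI)
  fix v w and x :: "nat \<Rightarrow> complex" assume vw: "extends_place v w"
  have "0 \<le> arch_const w 1" "0 \<le> max_abs w {}" "0 \<le> max_abs w (x ` {..<n})"
    using arch_const_ge_1[of 1 w] max_abs_ge(1)[of "{}" w] max_abs_ge(1)[of "x ` {..<n}" w] by simp_all
  then show "w (0 x) \<le> arch_const w 1 * max_abs w {} * max_abs w (x ` {..<n}) ^ D"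
    by (simp add: w_0[OF vw])
qed (auto simp: alg_closed_under(1))

lemma polybound_sum:
  assumes "\<And>i. i \<in> I \<Longrightarrow> \<exists>N S. polybound n D (F i) N S"
  shows "\<exists>N S. polybound n D (\<Sum>i\<in>I. F i) N S"
  using assms
proof (induction I rule: infinite_finite_induct)
  case (insert i I)
  obtain N S where 1: "polybound n D (F i) N S" using insert.prems[of i] by blast
  obtain M T where 2: "polybound n D (\<Sum>i\<in>I. F i) M T" using insert.IH insert.prems by blast
  show ?case using polybound_add[OF 1 2] unfolding sum.insert[OF insert.hyps] by blast
qed (use polybound_0 in \<open>(simp, blast)+\<close>)

lemma monfun_alg: "set u \<subseteq> {..<n} \<Longrightarrow> (\<And>i. i < n \<Longrightarrow> x i \<in> \<A>) \<Longrightarrow> monfun u x \<in> \<A>"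
  by (induction u) (auto simp: monfun_simps coordfun_apply alg_closed_under)

lemma monfun_bound:
  assumes "extends_place v w" "\<forall>i<n. x i \<in> \<A>" "set u \<subseteq> {..<n}"
  shows "w (monfun u x) \<le> max_abs w (x ` {..<n}) ^ length u"
  using assms(3)
proof (induction u)
  case (Cons i u)
  have "w (monfun (i # u) x) = w (x i) * w (monfun u x)" using Cons.prems assms(2) monfun_alg[of u n x]
    by (simp add: monfun_simps coordfun_apply w_mult[OF assms(1)])
  also have "\<dots> \<le> max_abs w (x ` {..<n}) * max_abs w (x ` {..<n}) ^ length u"
  proof (rule mult_mono)
    show "w (x i) \<le> max_abs w (x ` {..<n})" using Cons.prems by (intro max_abs_ge) auto
    then show "0 \<le> max_abs w (x ` {..<n})" using max_abs_ge(1)[of "x ` {..<n}" w] by simp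
    show "0 \<le> w (monfun u x)" using Cons.prems assms(2) monfun_alg[of u n x] by (simp add: w_nonneg[OF assms(1)])
  qed (use Cons in auto)
  finally show ?case by simp
qed (simp add: monfun_simps w_1[OF assms(1)])

lemma homfun_polybound:
  assumes "p \<in> homfun n e"
  shows "\<exists>N S. polybound n e p N S"
proof -
  obtain a where a: "\<And>u. a u \<in> \<A>" "p = (\<Sum>u\<in>words n e. constfun (a u) * monfun u)" using homfunE[OF assms] by blast
  have "\<exists>N S. polybound n e (constfun (a u) * monfun u) N S" if u: "u \<in> words n e" for u
  proof -
    have "polybound n e (constfun (a u) * monfun u) 1 {a u}" unfolding polybound_def
    proof (intro conjI allI impI)
      fix v w x assume vw: "extends_place v w" and x: "\<forall>i<n. x i \<in> \<A>"
      have m: "monfun u x \<in> \<A>" using u x by (intro monfun_alg[of u n]) (auto simp: words_def)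
      then show "(constfun (a u) * monfun u) x \<in> \<A>" using a(1) by (simp add: constfun_simps alg_closed_under(4))
      have "w ((constfun (a u) * monfun u) x) = w (a u) * w (monfun u x)" using a(1) m by (simp add: constfun_simps w_mult[OF vw])
      also have "\<dots> \<le> max_abs w {a u} * max_abs w (x ` {..<n}) ^ e"
        using monfun_bound[OF vw x, of u] u max_abs_ge(2)[of "{a u}" "a u" w] max_abs_ge(1)[of "{a u}" w] w_nonneg[OF vw m]
        by (intro mult_mono) (auto simp: words_def)
      finally show "w ((constfun (a u) * monfun u) x) \<le> arch_const w 1 * max_abs w {a u} * max_abs w (x ` {..<n}) ^ e"
        by (simp add: arch_const_def)
    qed (use a in auto)
    then show ?thesis by blast
  qed
  then show ?thesis unfolding a(2) by (rule polybound_sum)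
qed

lemma height_upper_bound:
  fixes k :: nat
  assumes "\<And>j. j < k \<Longrightarrow> \<exists>N S. polybound n D (F j) N S"
  shows "\<exists>c. \<forall>x. (\<forall>i<n. x i \<in> \<A>) \<longrightarrow>
    height ((\<lambda>j. F j x) ` {..<k}) \<le> D * height (x ` {..<n}) + c"
proof -
  obtain N S where NS: "finite S" "S \<subseteq> \<A>" "1 \<le> N" "\<forall>j\<in>{..<k}. polybound n D (F j) N S"
    using polybound_uniform[of "{..<k}" n "\<lambda>_. D" F] assms by auto
  show ?thesis
  proof (intro exI allI impI)
    fix x :: "nat \<Rightarrow> complex" assume x: "\<forall>i<n. x i \<in> \<A>"
    have "real 1 * height ((\<lambda>j. F j x) ` {..<k}) \<le> D * height (x ` {..<n}) + real 1 * (ln N + height S)"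
    proof (rule height_bound)
      show "x ` {..<n} \<subseteq> \<A>" using x by auto
      have FA: "F j x \<in> \<A> \<and> w (F j x) \<le> arch_const w N * max_abs w S * max_abs w (x ` {..<n}) ^ D" 
        if "j < k" "extends_place v w" for j v w using NS(4) x that by (auto simp: polybound_def)
      have "\<exists>v w. extends_place v w" using extends_place_extended[OF _ aut_id] by (auto simp: rational_places_def)
      then show "(\<lambda>j. F j x) ` {..<k} \<subseteq> \<A>" using FA by auto
      fix v w assume vw: "extends_place v w"
      have "1 \<le> arch_const w N * max_abs w S * max_abs w (x ` {..<n}) ^ D"
      proof -
        have "1 * 1 * 1 \<le> arch_const w N * max_abs w S * max_abs w (x ` {..<n}) ^ D"
          using arch_const_ge_1[OF NS(3), of w] max_abs_ge(1)[OF NS(1), of w] max_abs_ge(1)[of "x ` {..<n}" w]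
          by (intro mult_mono one_le_power) auto
        then show ?thesis by simp
      qed
      then have "max_abs w ((\<lambda>j. F j x) ` {..<k}) \<le> arch_const w N * max_abs w S * max_abs w (x ` {..<n}) ^ D"
        using FA[OF _ vw] by (intro max_abs_le) auto
      then show "max_abs w ((\<lambda>j. F j x) ` {..<k}) ^ 1 \<le> (arch_const w N * max_abs w S) ^ 1 * max_abs w (x ` {..<n}) ^ D"
        by simp
    qed (use NS in auto)
    then show "height ((\<lambda>j. F j x) ` {..<k}) \<le> D * height (x ` {..<n}) + (ln N + height S)" by simp
  qed
qed

text \<open>The bound is obtained by evaluating the identities \<open>x\<^sub>i\<^sup>e = \<Sum>\<^sub>j A\<^sub>i\<^sub>j g\<^sub>j\<close> at a point.\<close>
lemma nullstellensatz_bound: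
  fixes k :: nat and g :: "nat \<Rightarrow> polyfun"
  assumes g: "\<And>j. j < k \<Longrightarrow> g j \<in> homfun n (d j)"
    and nz: "\<And>z. (\<And>i. z i \<in> \<A>) \<Longrightarrow> (\<And>j. j < k \<Longrightarrow> g j z = 0) \<Longrightarrow> \<forall>i<n. z i = 0"
  shows "\<exists>e N S. 1 \<le> N \<and> finite S \<and> S \<subseteq> \<A> \<and>
    (\<forall>v w x i B. extends_place v w \<longrightarrow> (\<forall>i<n. x i \<in> \<A>) \<longrightarrow> i < n \<longrightarrow> 0 \<le> B \<longrightarrow>
       (\<forall>j<k. d j \<le> e \<longrightarrow> max_abs w (x ` {..<n}) ^ (e - d j) * w (g j x) \<le> B) \<longrightarrow>
       w (x i) ^ e \<le> arch_const w N * max_abs w S * B)"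
proof -
  have "\<exists>N A. (\<forall>i<n. \<forall>j<k. A i j \<in> homfun n (N - d j) \<and> (N < d j \<longrightarrow> A i j = 0)) \<and>
    (\<forall>i<n. \<forall>x. x i ^ N = (\<Sum>j<k. A i j x * g j x))"
    by (rule homogeneous_nullstellensatz[OF g nz])
  then obtain e A where A': "\<forall>i<n. \<forall>j<k. A i j \<in> homfun n (e - d j) \<and> (e < d j \<longrightarrow> A i j = 0)"
    and eq': "\<forall>i<n. \<forall>x. x i ^ e = (\<Sum>j<k. A i j x * g j x)" by blast
  note A = A'[rule_format] and eq = eq'[rule_format]
  obtain N S where NS: "finite S" "S \<subseteq> \<A>" "1 \<le> N" 
    "\<forall>(i, j)\<in>{..<n} \<times> {..<k}. polybound n (e - d j) (A i j) N S"
  proof -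
    have "\<exists>N S. polybound n (e - d (snd z)) (A (fst z) (snd z)) N S" if "z \<in> {..<n} \<times> {..<k}" for z
      using homfun_polybound A that by auto
    then show ?thesis using that polybound_uniform[of "{..<n} \<times> {..<k}" n "\<lambda>z. e - d (snd z)" "\<lambda>z. A (fst z) (snd z)"]
      by (auto simp: case_prod_unfold)
  qed
  show ?thesis
  proof (intro exI conjI allI impI)
    \<comment> \<open>\<open>k + 1\<close> bounds the number of summands and stays positive for
      \<open>k = 0\<close>.\<close>
    have "1 * 1 \<le> real (k + 1) * N" using NS(3) by (intro mult_mono) auto
    then show "1 \<le> real (k + 1) * N" by simp
    show "finite S" "S \<subseteq> \<A>" by fact+
    fix v w x i B assume vw: "extends_place v w" and x: "\<forall>i<n. x i \<in> \<A>" and i: "i < n" and B: "0 \<le> B"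
      and le: "\<forall>j<k. d j \<le> e \<longrightarrow> max_abs w (x ` {..<n}) ^ (e - d j) * w (g j x) \<le> B"
    have Aij: "A i j x \<in> \<A>" "w (A i j x) \<le> arch_const w N * max_abs w S * max_abs w (x ` {..<n}) ^ (e - d j)" if "j < k" for j
      using NS(4) i that vw x by (auto simp: polybound_def)
    have gA: "g j x \<in> \<A>" if "j < k" for j
      using homfun_polybound[OF g[OF that]] vw x by (auto simp: polybound_def)
    have K: "arch_const w N * max_abs w S \<ge> 0" 
      using arch_const_ge_1[OF NS(3), of w] max_abs_ge(1)[OF NS(1), of w] by simp
    have "w (x i) ^ e = w (\<Sum>j<k. A i j x * g j x)" using eq[OF i] w_power[OF vw] x i by metis
    also have "\<dots> \<le> arch_const w (k + 1) * (arch_const w N * max_abs w S * B)"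
    proof (rule w_sum_bound[OF vw])
      fix j assume "j \<in> {..<k}"
      then have j: "j < k" by simp
      show "A i j x * g j x \<in> \<A>" using Aij(1) gA j alg_closed_under(4) by blast
      show "w (A i j x * g j x) \<le> arch_const w N * max_abs w S * B"
      proof (cases "e < d j")
        case True
        then have "A i j x = 0" using A[OF i j] by simp
        then show ?thesis using K B by (simp add: w_0[OF vw])
      next
        case False
        have "w (A i j x * g j x) = w (A i j x) * w (g j x)" using Aij(1) gA j by (simp add: w_mult[OF vw])
        also have "\<dots> \<le> (arch_const w N * max_abs w S * max_abs w (x ` {..<n}) ^ (e - d j)) * w (g j x)"
          using Aij(2) gA j w_nonneg[OF vw] by (intro mult_right_mono) auto
        also have "\<dots> = (arch_const w N * max_abs w S) * (max_abs w (x ` {..<n}) ^ (e - d j) * w (g j x))" by simp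
        also have "\<dots> \<le> arch_const w N * max_abs w S * B" using le j False K by (intro mult_left_mono) auto
        finally show ?thesis .
      qed
    qed (use K B in auto)
    finally show "w (x i) ^ e \<le> arch_const w (real (k + 1) * N) * max_abs w S * B" 
      by (simp add: arch_const_mult mult.assoc)
  qed
qed

text \<open>The forms \<open>g\<^sub>j\<close> are the leading forms of the \<open>F\<^sub>j\<close>.\<close>
lemma height_lower_bound:
  fixes k d0 :: nat and g F :: "nat \<Rightarrow> polyfun"
  assumes g: "\<And>j. j < k \<Longrightarrow> g j \<in> homfun n (d j)"
    and nz: "\<And>z. (\<And>i. z i \<in> \<A>) \<Longrightarrow> (\<And>j. j < k \<Longrightarrow> g j z = 0) \<Longrightarrow> \<forall>i<n. z i = 0"
    and F: "\<And>j. j < k \<Longrightarrow> \<exists>N S. polybound n (d j - 1) (g j - F j) N S"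
    and d: "\<And>j. j < k \<Longrightarrow> d0 \<le> d j" "1 \<le> d0"
  shows "\<exists>c. \<forall>x. (\<forall>i<n. x i \<in> \<A>) \<longrightarrow>
    d0 * height (x ` {..<n}) \<le> height ((\<lambda>j. F j x) ` {..<k}) + c"
proof -
  have "\<exists>e N S. 1 \<le> N \<and> finite S \<and> S \<subseteq> \<A> \<and>
    (\<forall>v w x i B. extends_place v w \<longrightarrow> (\<forall>i<n. x i \<in> \<A>) \<longrightarrow> i < n \<longrightarrow> 0 \<le> B \<longrightarrow>
       (\<forall>j<k. d j \<le> e \<longrightarrow> max_abs w (x ` {..<n}) ^ (e - d j) * w (g j x) \<le> B) \<longrightarrow>
       w (x i) ^ e \<le> arch_const w N * max_abs w S * B)"
    by (rule nullstellensatz_bound[OF g nz])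
  then obtain e N1 S1 where N1: "1 \<le> N1" "finite S1" "S1 \<subseteq> \<A>" and
    null': "\<forall>v w x i B. extends_place v w \<longrightarrow> (\<forall>i<n. x i \<in> \<A>) \<longrightarrow> i < n \<longrightarrow> 0 \<le> B \<longrightarrow>
       (\<forall>j<k. d j \<le> e \<longrightarrow> max_abs w (x ` {..<n}) ^ (e - d j) * w (g j x) \<le> B) \<longrightarrow>
       w (x i) ^ e \<le> arch_const w N1 * max_abs w S1 * B" by blast
  have null: "w (x i) ^ e \<le> arch_const w N1 * max_abs w S1 * B" 
    if "extends_place v w" "\<forall>i<n. x i \<in> \<A>" "i < n" "0 \<le> B"
       "\<And>j. j < k \<Longrightarrow> d j \<le> e \<Longrightarrow> max_abs w (x ` {..<n}) ^ (e - d j) * w (g j x) \<le> B" for v w x i B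
    using null' that by blast
  obtain N2 S2 where N2: "finite S2" "S2 \<subseteq> \<A>" "1 \<le> N2" "\<forall>j\<in>{..<k}. polybound n (d j - 1) (g j - F j) N2 S2"
    using polybound_uniform[of "{..<k}" n "\<lambda>j. d j - 1" "\<lambda>j. g j - F j"] F by auto
  \<comment> \<open>\<open>N1\<close> comes from the Nullstellensatz identities,
    \<open>2 * N2\<close> from writing \<open>g j\<close> as \<open>F j\<close> plus lower
    terms.\<close>
  define N where "N = N1 * (2 * N2)"
  define S where "S = S1 \<union> S2"
  have N: "1 \<le> N" using mult_mono[of 1 N1 1 "2 * N2"] N1 N2 by (simp add: N_def)
  have S: "finite S" "S \<subseteq> \<A>" using N1 N2 by (auto simp: S_def)
  have FA: "F j x \<in> \<A>" if "j < k" "\<forall>i<n. x i \<in> \<A>" for j x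
  proof -
    obtain v w where vw: "extends_place v w" using extends_place_extended[OF _ aut_id] by (auto simp: rational_places_def)
    have "g j x \<in> \<A>" using homfun_polybound[OF g[OF that(1)]] vw that(2) by (auto simp: polybound_def)
    moreover have "g j x - F j x \<in> \<A>" using N2(4) vw that by (auto simp: polybound_def)
    ultimately show ?thesis using alg_diff[of "g j x" "g j x - F j x"] by simp
  qed
  show ?thesis
  proof (intro exI allI impI)
    fix x :: "nat \<Rightarrow> complex" assume x: "\<forall>i<n. x i \<in> \<A>"
    define Y where "Y = (\<lambda>j. F j x) ` {..<k}"
    have Y: "finite Y" "Y \<subseteq> \<A>" using FA x by (auto simp: Y_def)
    have "d0 * height (x ` {..<n}) \<le> real 1 * height Y + real (2 * d0) * (ln N + height S)"
    proof (rule height_bound[OF Y])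
      show "x ` {..<n} \<subseteq> \<A>" using x by auto
      fix v w assume vw: "extends_place v w"
      define M where "M = max_abs w (x ` {..<n})"
      define B where "B = max_abs w Y"
      define K1 where "K1 = arch_const w N1 * max_abs w S1"
      define K2 where "K2 = arch_const w (2 * N2) * max_abs w S2"
      define K where "K = arch_const w N * max_abs w S"
      have M: "M \<ge> 1" unfolding M_def by (rule max_abs_ge) auto
      have B: "B \<ge> 1" unfolding B_def by (rule max_abs_ge) (rule Y)
      have mul1: "1 \<le> a * b" if "1 \<le> a" "1 \<le> b" for a b :: real using mult_mono[of 1 a 1 b] that by simp
      have K12: "K1 \<ge> 1" "K2 \<ge> 1" "K \<ge> 1" unfolding K1_def K2_def K_def
        using N N1 N2 S by (auto intro!: mul1 arch_const_ge_1 max_abs_ge)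
      have "K1 * K2 \<le> K ^ 2"
      proof -
        have "K1 * K2 = arch_const w N * (max_abs w S1 * max_abs w S2)"
          by (simp add: K1_def K2_def N_def arch_const_mult)
        also have "\<dots> \<le> (arch_const w N * arch_const w N) * (max_abs w S * max_abs w S)"
        proof (intro mult_mono)
          show "arch_const w N \<le> arch_const w N * arch_const w N" using arch_const_ge_1[OF N, of w] by simp
          show "max_abs w S1 \<le> max_abs w S" "max_abs w S2 \<le> max_abs w S" using S by (auto simp: S_def intro!: max_abs_mono)
        qed (use arch_const_ge_1[OF N, of w] max_abs_ge(1)[OF N1(2), of w] max_abs_ge(1)[OF N2(1), of w] max_abs_ge(1)[OF S(1), of w] in auto)
        finally show ?thesis by (simp add: K_def power2_eq_square mult_ac)
      qed
      \<comment> \<open>\<open>g j\<close> is \<open>F j\<close>, bounded by \<open>B\<close>, plus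
        a remainder of degree at most \<open>d j - 1\<close>.\<close>
      have gb: "w (g j x) \<le> K2 * max B (M ^ (d j - 1))" if j: "j < k" for j
      proof -
        have r: "(g j - F j) x \<in> \<A>" "w ((g j - F j) x) \<le> arch_const w N2 * max_abs w S2 * M ^ (d j - 1)"
          using N2(4) j vw x by (auto simp: polybound_def M_def)
        have Fj: "F j x \<in> \<A>" "w (F j x) \<le> B" using FA[OF j x] Y j by (auto simp: B_def Y_def intro!: max_abs_ge)
        define C where "C = arch_const w N2 * max_abs w S2 * max B (M ^ (d j - 1))"
        have one: "1 \<le> arch_const w N2 * max_abs w S2" using N2 by (auto intro!: mul1 arch_const_ge_1 max_abs_ge)
        have "w (F j x) \<le> C" "w ((g j - F j) x) \<le> C"
        proof -
          have "1 * B \<le> C" unfolding C_def using one B by (intro mult_mono) auto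
          then show "w (F j x) \<le> C" using Fj by simp
          have "arch_const w N2 * max_abs w S2 * M ^ (d j - 1) \<le> C" unfolding C_def using one by (intro mult_left_mono) auto
          then show "w ((g j - F j) x) \<le> C" using r by simp
        qed
        moreover have "0 \<le> C" using calculation w_nonneg[OF vw Fj(1)] by simp
        ultimately have "w (\<Sum>i\<in>{0, 1::nat}. if i = 0 then F j x else (g j - F j) x) \<le> arch_const w 2 * C"
          using r Fj by (intro w_sum_bound[OF vw]) auto
        then show ?thesis by (simp add: C_def K2_def arch_const_mult mult_ac)
      qed
      have main: "M ^ e \<le> K1 * (K2 * max (M ^ (e - d0) * B) (M ^ (e - 1))) \<and> d0 \<le> e" if M1: "M > 1"
      proof -
        have "M \<in> insert 1 (w ` x ` {..<n})" unfolding M_def max_abs_def by (rule Max_in) auto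
        then obtain i where i: "i < n" "w (x i) = M" using M1 by auto
        \<comment> \<open>For \<open>e < d0\<close> the conditions on the \<open>g j\<close> are
          void, and the bound 0 would give \<open>M ^ e \<le> 0\<close>.\<close>
        have ed: "d0 \<le> e"
        proof (rule ccontr)
          assume "\<not> d0 \<le> e"
          then have "w (x i) ^ e \<le> arch_const w N1 * max_abs w S1 * 0" using d by (intro null[OF vw x i(1)]) fastforce+
          moreover have "0 < M ^ e" using M1 by (intro zero_less_power) simp
          ultimately show False using i by simp
        qed
        have "w (x i) ^ e \<le> arch_const w N1 * max_abs w S1 * (K2 * max (M ^ (e - d0) * B) (M ^ (e - 1)))"
        proof (rule null[OF vw x i(1)])
          show "0 \<le> K2 * max (M ^ (e - d0) * B) (M ^ (e - 1))" using K12 M by (auto simp: le_max_iff_disj)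
          fix j assume j: "j < k" "d j \<le> e"
          have "M ^ (e - d j) * w (g j x) \<le> M ^ (e - d j) * (K2 * max B (M ^ (d j - 1)))"
            using gb[OF j(1)] M by (intro mult_left_mono) auto
          also have "\<dots> = K2 * max (M ^ (e - d j) * B) (M ^ (e - d j) * M ^ (d j - 1))"
          proof -
            have "M ^ (e - d j) * max B (M ^ (d j - 1)) = max (M ^ (e - d j) * B) (M ^ (e - d j) * M ^ (d j - 1))"
              using M by (simp only: max_mult_distrib_left) simp
            then show ?thesis by (metis mult.left_commute)
          qed
          also have "M ^ (e - d j) * M ^ (d j - 1) = M ^ (e - 1)"
            using j d(1)[OF j(1)] d(2) by (simp flip: power_add)
          also have "K2 * max (M ^ (e - d j) * B) (M ^ (e - 1)) \<le> K2 * max (M ^ (e - d0) * B) (M ^ (e - 1))"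
            using K12 M B d(1)[OF j(1)] by (intro mult_left_mono max.mono mult_right_mono power_increasing) auto
          finally show "max_abs w (x ` {..<n}) ^ (e - d j) * w (g j x) \<le> K2 * max (M ^ (e - d0) * B) (M ^ (e - 1))"
            by (simp add: M_def)
        qed
        then show ?thesis using i ed by (simp add: K1_def)
      qed
      \<comment> \<open>Either the values \<open>F j x\<close> dominate and
        \<open>M ^ d0 \<le> K ^ 2 * B\<close>, or the lower terms do and
        \<open>M \<le> K ^ 2\<close>. Raising the second bound to the power \<open>d0\<close> is the
        origin of the factor \<open>2 * d0\<close>.\<close>
      have "M ^ d0 \<le> (K ^ 2) ^ d0 * B"
      proof (cases "M > 1")
        case False
        then have "M = 1" using M by simp
        then show ?thesis using mul1[of "(K ^ 2) ^ d0" B] K12 B by simp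
      next
        case True
        note ed = main[OF True, THEN conjunct2]
        have pos: "M ^ (e - d0) > 0" "M ^ (e - 1) > 0" using M by auto
        have "M ^ e \<le> (K1 * K2) * max (M ^ (e - d0) * B) (M ^ (e - 1))" using main[OF True] by simp
        also have "\<dots> \<le> K ^ 2 * max (M ^ (e - d0) * B) (M ^ (e - 1))" 
          using \<open>K1 * K2 \<le> K ^ 2\<close> pos by (intro mult_right_mono) (auto simp: le_max_iff_disj)
        finally have le: "M ^ e \<le> max (K ^ 2 * (M ^ (e - d0) * B)) (K ^ 2 * M ^ (e - 1))" 
          by (simp add: max_mult_distrib_left)
        have K2: "K ^ 2 \<ge> 1" using K12 by simp
        have KK: "K ^ 2 \<le> (K ^ 2) ^ d0" using power_increasing[OF d(2) K2] by simp
        consider "M ^ e \<le> K ^ 2 * (M ^ (e - d0) * B)" | "M ^ e \<le> K ^ 2 * M ^ (e - 1)" using le by linarith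
        then show ?thesis
        proof cases
          case 1
          have "M ^ (e - d0) * M ^ d0 = M ^ e" using ed by (simp flip: power_add)
          then have "M ^ (e - d0) * M ^ d0 \<le> M ^ (e - d0) * (K ^ 2 * B)" using 1 by (simp add: mult_ac)
          then have "M ^ d0 \<le> K ^ 2 * B" using pos by (simp only: mult_le_cancel_left_pos)
          also have "\<dots> \<le> (K ^ 2) ^ d0 * B" using KK B by (intro mult_right_mono) auto
          finally show ?thesis .
        next
          case 2
          have "M ^ (e - 1) * M = M ^ e" using ed d(2) by (cases e) auto
          then have "M ^ (e - 1) * M \<le> M ^ (e - 1) * K ^ 2" using 2 by (simp add: mult_ac)
          then have "M \<le> K ^ 2" using pos by (simp only: mult_le_cancel_left_pos)
          then have "M ^ d0 \<le> (K ^ 2) ^ d0" using M by (intro power_mono) auto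
          also have "\<dots> = (K ^ 2) ^ d0 * 1" by simp
          also have "\<dots> \<le> (K ^ 2) ^ d0 * B" using K2 B by (intro mult_left_mono) auto
          finally show ?thesis .
        qed
      qed
      then show "max_abs w (x ` {..<n}) ^ d0 \<le> (arch_const w N * max_abs w S) ^ (2 * d0) * max_abs w Y ^ 1"
        by (simp add: M_def K_def B_def power_mult)
    qed (use S N in auto)
    then show "d0 * height (x ` {..<n}) \<le> height ((\<lambda>j. F j x) ` {..<k}) + real (2 * d0) * (ln N + height S)"
      by (simp add: Y_def)
  qed
qed

section \<open>Property (K)\<close>

lemma injective_contraction_finite:
  fixes h :: "'a \<Rightarrow> real" and a b c :: real
  assumes fin: "\<And>t. finite {x \<in> X. h x \<le> t}" and T: "T ` X \<subseteq> X" "inj_on T X"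
    and le: "\<And>x. x \<in> X \<Longrightarrow> a * h (T x) \<le> b * h x + c" and ab: "0 \<le> b" "b < a"
  shows "finite X"
proof -
  \<comment> \<open>The fixed point of the map sending \<open>t\<close> to
    \<open>(b * t + c) / a\<close>: points of height at most \<open>C\<close> stay there under
    \<open>T\<close>, and points above \<open>C\<close> lose height.\<close>
  define C where "C = c / (a - b)"
  define S where "S = {x \<in> X. h x \<le> C}"
  have c: "c = (a - b) * C" using ab by (simp add: C_def)
  have TS: "T x \<in> S" if "x \<in> S" for x
  proof -
    have "a * h (T x) \<le> b * C + c" using le[of x] that ab mult_left_mono[of "h x" C b] by (auto simp: S_def)
    also have "\<dots> = a * C" by (simp add: c algebra_simps)
    finally show ?thesis using that T ab by (auto simp: S_def)
  qed
  have down: "h (T x) < h x" if "x \<in> X - S" for x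
  proof -
    have "C < h x" using that by (auto simp: S_def)
    then have "(a - b) * C < (a - b) * h x" using ab by simp
    then have "a * h (T x) < b * h x + (a - b) * h x" using le[of x] that c by auto
    then show ?thesis using ab by (simp add: algebra_simps)
  qed
  have "finite S" unfolding S_def by (rule fin)
  then have surj: "T ` S = S" using TS inj_on_subset[OF T(2), of S] by (intro endo_inj_surj) (auto simp: S_def)
  have "X - S = {}"
  proof (rule ccontr)
    assume "X - S \<noteq> {}"
    then obtain x0 where x0: "x0 \<in> X - S" by blast
    define Y where "Y = {x \<in> X - S. h x \<le> h x0}"
    have Y: "finite Y" "Y \<noteq> {}" using x0 finite_subset[OF _ fin[of "h x0"], of Y] by (auto simp: Y_def)
    define x where "x = arg_min_on h Y"
    have x: "x \<in> Y" "\<And>y. y \<in> Y \<Longrightarrow> h x \<le> h y"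
      unfolding x_def using arg_min_if_finite(1)[OF Y] arg_min_least[OF Y] by auto
    have xX: "x \<in> X - S" using x(1) by (simp add: Y_def)
    \<comment> \<open>\<open>T\<close> already permutes \<open>S\<close>, so by injectivity no point
      outside \<open>S\<close> is sent into it. Thus \<open>T x\<close> would be a point of
      \<open>Y\<close> below the minimum.\<close>
    have "T x \<notin> S"
    proof
      assume "T x \<in> S"
      then obtain s where "s \<in> S" "T x = T s" using surj by (metis imageE)
      then show False using inj_onD[OF T(2), of x s] xX by (auto simp: S_def)
    qed
    then have "T x \<in> Y" using down[OF xX] x(1) T(1) xX by (auto simp: Y_def)
    then show False using x(2) down[OF xX] by fastforce
  qed
  then have "X \<subseteq> S" by auto
  then show ?thesis using \<open>finite S\<close> by (rule finite_subset)
qed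

section \<open>Polynomials given by coefficients as sums of forms\<close>

definition mono_fun :: "(nat \<Rightarrow>\<^sub>0 nat) \<Rightarrow> polyfun" where
  "mono_fun m = (\<Prod>i\<in>Poly_Mapping.keys m. coordfun i ^ Poly_Mapping.lookup m i)"

lemma prod_fun_apply: "(\<Prod>i\<in>I. f i) x = (\<Prod>i\<in>I. f i x)"
  by (induction I rule: infinite_finite_induct) auto

lemma homfun_mono_fun:
  assumes "Poly_Mapping.keys m \<subseteq> {..<n}"
  shows "mono_fun m \<in> homfun n (monom_degree m)"
proof -
  have "(\<Prod>i\<in>I. coordfun i ^ f i) \<in> homfun n (\<Sum>i\<in>I. f i)" if "finite I" "I \<subseteq> {..<n}" for I f
    using that
  proof (induction I rule: finite_induct)
    case empty
    then show ?case using homfun_const[OF alg_closed_under(2), of n] by (simp add: constfun_simps flip: one_fun_def)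
  next
    case (insert i I)
    have "coordfun i ^ f i * (\<Prod>i\<in>I. coordfun i ^ f i) \<in> homfun n (f i + (\<Sum>i\<in>I. f i))"
      using insert by (intro homfun_mult homfun_power homfun_coord) auto
    then show ?case unfolding prod.insert[OF insert.hyps] sum.insert[OF insert.hyps] .
  qed
  then show ?thesis unfolding mono_fun_def monom_degree_def using assms by simp
qed

lemma eval_mpoly_fun:
  "eval_mpoly p = (\<Sum>m\<in>Poly_Mapping.keys p. constfun (Poly_Mapping.lookup p m) * mono_fun m)"
  by (simp add: fun_eq_iff eval_mpoly_def sum_fun_apply constfun_simps mono_fun_def prod_fun_apply power_fun_apply coordfun_apply)

definition top_monoms :: "'a::zero mpoly \<Rightarrow> (nat \<Rightarrow>\<^sub>0 nat) set" where
  "top_monoms p = {m \<in> Poly_Mapping.keys p. monom_degree m = total_degree p}"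

lemma lookup_leading_form:
  "Poly_Mapping.lookup (leading_form p) m = (if m \<in> top_monoms p then Poly_Mapping.lookup p m else 0)"
proof -
  have fin: "finite (top_monoms p)" by (simp add: top_monoms_def)
  have "Poly_Mapping.lookup (leading_form p) m = 
    (\<Sum>m'\<in>top_monoms p. Poly_Mapping.lookup (Poly_Mapping.single m' (Poly_Mapping.lookup p m')) m)"
    by (simp add: leading_form_def top_monoms_def lookup_sum)
  also have "\<dots> = (\<Sum>m'\<in>top_monoms p. if m' = m then Poly_Mapping.lookup p m else 0)"
    by (intro sum.cong) (auto simp: lookup_single when_def)
  finally show ?thesis using fin by (simp add: sum.delta)
qed

lemma keys_leading_form: "Poly_Mapping.keys (leading_form p) = top_monoms p"
  by (auto simp: in_keys_iff lookup_leading_form top_monoms_def split: if_splits)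

lemma eval_leading_form:
  "eval_mpoly (leading_form p) = (\<Sum>m\<in>top_monoms p. constfun (Poly_Mapping.lookup p m) * mono_fun m)"
  unfolding eval_mpoly_fun keys_leading_form by (intro sum.cong) (auto simp: lookup_leading_form)

lemma monom_degree_le: "m \<in> Poly_Mapping.keys p \<Longrightarrow> monom_degree m \<le> total_degree p"
  by (auto simp: total_degree_def)

lemma mpolys_term:
  assumes "p \<in> mpolys_over L n" "L \<subseteq> \<A>" "m \<in> Poly_Mapping.keys p"
  shows "constfun (Poly_Mapping.lookup p m) * mono_fun m \<in> homfun n (monom_degree m)"
  using assms by (intro homfun_cmult homfun_mono_fun) (auto simp: mpolys_over_def)

lemma polybound_degree_le: "polybound n d F N S \<Longrightarrow> d \<le> D \<Longrightarrow> polybound n D F N S"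
  using polybound_mono[of n d F N S D N S] by (simp add: polybound_def)

lemma homfun_polybound_le: "p \<in> homfun n e \<Longrightarrow> e \<le> D \<Longrightarrow> \<exists>N S. polybound n D p N S"
  using homfun_polybound polybound_degree_le by metis

lemma leading_form_homfun:
  assumes "p \<in> mpolys_over L n" "L \<subseteq> \<A>"
  shows "eval_mpoly (leading_form p) \<in> homfun n (total_degree p)"
  unfolding eval_leading_form
proof (intro homfun_sum)
  fix m assume "m \<in> top_monoms p"
  then show "constfun (Poly_Mapping.lookup p m) * mono_fun m \<in> homfun n (total_degree p)"
    using mpolys_term[OF assms, of m] by (simp add: top_monoms_def)
qed

lemma eval_mpoly_polybound:
  assumes "p \<in> mpolys_over L n" "L \<subseteq> \<A>" "total_degree p \<le> D"
  shows "\<exists>N S. polybound n D (eval_mpoly p) N S"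
  unfolding eval_mpoly_fun
proof (intro polybound_sum)
  fix m assume m: "m \<in> Poly_Mapping.keys p"
  show "\<exists>N S. polybound n D (constfun (Poly_Mapping.lookup p m) * mono_fun m) N S"
    using homfun_polybound_le[OF mpolys_term[OF assms(1,2) m]] monom_degree_le[OF m] assms(3) by simp
qed

lemma lower_terms_polybound:
  assumes "p \<in> mpolys_over L n" "L \<subseteq> \<A>"
  shows "\<exists>N S. polybound n (total_degree p - 1) (eval_mpoly (leading_form p) - eval_mpoly p) N S"
proof -
  have sub: "top_monoms p \<subseteq> Poly_Mapping.keys p" by (auto simp: top_monoms_def)
  have "eval_mpoly p = (\<Sum>m\<in>Poly_Mapping.keys p - top_monoms p. constfun (Poly_Mapping.lookup p m) * mono_fun m)
      + (\<Sum>m\<in>top_monoms p. constfun (Poly_Mapping.lookup p m) * mono_fun m)"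
    unfolding eval_mpoly_fun by (rule sum.subset_diff[OF sub]) simp
  then have eq: "eval_mpoly (leading_form p) - eval_mpoly p = 
    (\<Sum>m\<in>Poly_Mapping.keys p - top_monoms p. - (constfun (Poly_Mapping.lookup p m) * mono_fun m))"
    by (simp only: eval_leading_form sum_negf) (simp add: fun_eq_iff)
  have "\<exists>N S. polybound n (total_degree p - 1) (- (constfun (Poly_Mapping.lookup p m) * mono_fun m)) N S"
    if "m \<in> Poly_Mapping.keys p - top_monoms p" for m
  proof (rule homfun_polybound_le)
    show "- (constfun (Poly_Mapping.lookup p m) * mono_fun m) \<in> homfun n (monom_degree m)"
      using that by (intro homfun_minus mpolys_term[OF assms]) auto
    have "monom_degree m \<noteq> total_degree p" using that by (auto simp: top_monoms_def)
    then show "monom_degree m \<le> total_degree p - 1" using monom_degree_le[of m p] that by auto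
  qed
  then show ?thesis unfolding eq by (rule polybound_sum)
qed

text \<open>Connects zeros with algebraic coordinates to the zero condition in
  \<open>admissible\<close>, which is posed over the closure of \<open>L\<close>.\<close>

lemma alg_subset_closure: assumes "is_subfield L" shows "\<A> \<subseteq> alg_closure_of L"
proof
  fix x assume "x \<in> \<A>"
  then obtain p where "\<And>i. coeff p i \<in> \<rat>" "p \<noteq> 0" "poly p x = 0" using alg_rat_poly by blast
  then show "x \<in> alg_closure_of L" using Rats_subset_subfield[OF assms]
    by (auto simp: alg_closure_of_def polys_over_def)
qed

lemma eval_mpoly_cong:
  assumes "p \<in> mpolys_over L n" "\<And>i. i < n \<Longrightarrow> x i = y i"
  shows "eval_mpoly p x = eval_mpoly p y"
  unfolding eval_mpoly_def
proof (intro sum.cong refl arg_cong2[of _ _ _ _ "(*)"] prod.cong)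
  fix m i assume "m \<in> Poly_Mapping.keys p" "i \<in> Poly_Mapping.keys m"
  then have "i < n" using assms(1) by (auto simp: mpolys_over_def)
  then show "x i ^ Poly_Mapping.lookup m i = y i ^ Poly_Mapping.lookup m i" using assms(2) by simp
qed

lemma leading_form_mpolys: "p \<in> mpolys_over L n \<Longrightarrow> 0 \<in> L \<Longrightarrow> leading_form p \<in> mpolys_over L n"
  by (auto simp: mpolys_over_def keys_leading_form lookup_leading_form top_monoms_def)

text \<open>Each coordinate has at most the height of the set of all coordinates, so only finitely
  many values are available for it.\<close>

lemma finite_bounded_height_points:
  assumes L: "L \<subseteq> \<A>" and fin: "\<And>t. finite {y \<in> L. height {y} \<le> t}"
  shows "finite {x \<in> affine_space L n. height (x ` {..<n}) \<le> t}"
proof (rule finite_subset)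
  show "{x \<in> affine_space L n. height (x ` {..<n}) \<le> t} \<subseteq> {..<n} \<rightarrow>\<^sub>E {y \<in> L. height {y} \<le> t}"
  proof
    fix x assume "x \<in> {x \<in> affine_space L n. height (x ` {..<n}) \<le> t}"
    then have x: "x \<in> {..<n} \<rightarrow>\<^sub>E L" "height (x ` {..<n}) \<le> t" by (auto simp: affine_space_def)
    have "height {x i} \<le> t" if "i < n" for i
      using height_mono[of "{x i}" "x ` {..<n}"] x L that by fastforce
    then show "x \<in> {..<n} \<rightarrow>\<^sub>E {y \<in> L. height {y} \<le> t}" using x(1) by (auto simp: PiE_iff)
  qed
  show "finite ({..<n} \<rightarrow>\<^sub>E {y \<in> L. height {y} \<le> t})" using fin by (intro finite_PiE) auto
qed

lemma northcott_property_K: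
  assumes L: "is_subfield L" "L \<subseteq> \<A>" and N: "northcott L"
  shows "property_K L"
  unfolding property_K_def
proof (intro allI impI)
  fix n \<Phi> \<Psi> X
  assume n: "1 \<le> n" and adm: "admissible L n \<Phi>" and tup: "polynomial_tuple L n \<Psi>"
    and deg: "Max ((\<lambda>i. total_degree (\<Psi> i)) ` {..<n}) < Min ((\<lambda>i. total_degree (\<Phi> i)) ` {..<n})"
    and X: "X \<subseteq> affine_space L n" and sub: "polynomial_map n \<Psi> ` X \<subseteq> polynomial_map n \<Phi> ` X"
    and inj: "inj_on (polynomial_map n \<Psi>) X"
  define D where "D = Max ((\<lambda>i. total_degree (\<Psi> i)) ` {..<n})"
  define d where "d = Min ((\<lambda>i. total_degree (\<Phi> i)) ` {..<n})"
  have D: "total_degree (\<Psi> i) \<le> D" and d: "d \<le> total_degree (\<Phi> i)" if "i < n" for i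
    using that by (auto simp: D_def d_def)
  have Dd: "D < d" using deg by (simp add: D_def d_def)
  have \<Phi>: "\<Phi> i \<in> mpolys_over L n" and \<Psi>: "\<Psi> i \<in> mpolys_over L n" if "i < n" for i
    using adm tup that by (auto simp: admissible_def polynomial_tuple_def)
  have 0: "0 \<in> L" using L(1) by (simp add: is_subfield_def)
  have XA: "x i \<in> \<A>" if "x \<in> X" "i < n" for x i using that X L by (auto simp: affine_space_def)
  have "\<exists>c. \<forall>x. (\<forall>i<n. x i \<in> \<A>) \<longrightarrow> 
    d * height (x ` {..<n}) \<le> height ((\<lambda>j. eval_mpoly (\<Phi> j) x) ` {..<n}) + c"
  proof (rule height_lower_bound[of n "\<lambda>j. eval_mpoly (leading_form (\<Phi> j))" n "\<lambda>j. total_degree (\<Phi> j)"])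
    fix z :: "nat \<Rightarrow> complex" assume z: "\<And>i. z i \<in> \<A>" "\<And>j. j < n \<Longrightarrow> eval_mpoly (leading_form (\<Phi> j)) z = 0"
    \<comment> \<open>Points of \<open>affine_space\<close> are undefined from \<open>n\<close> on,
      so the zero is restricted first; the forms do not see the other indices.\<close>
    define z' where "z' = restrict z {..<n}"
    have "eval_mpoly (leading_form (\<Phi> j)) z' = 0" if "j < n" for j
      using eval_mpoly_cong[OF leading_form_mpolys[OF \<Phi>[OF that] 0], of z' z] z(2)[OF that] by (simp add: z'_def)
    moreover have "z' \<in> affine_space (alg_closure_of L) n"
      using z(1) alg_subset_closure[OF L(1)] by (auto simp: z'_def affine_space_def)
    ultimately have "\<forall>i<n. z' i = 0" using adm unfolding admissible_def by blast
    then show "\<forall>i<n. z i = 0" by (simp add: z'_def)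
  qed (use leading_form_homfun[OF \<Phi> L(2)] lower_terms_polybound[OF \<Phi> L(2)] d Dd in auto)
  then obtain c1 where c1: "\<forall>x. (\<forall>i<n. x i \<in> \<A>) \<longrightarrow> 
    d * height (x ` {..<n}) \<le> height ((\<lambda>j. eval_mpoly (\<Phi> j) x) ` {..<n}) + c1" by blast
  have "\<exists>c. \<forall>x. (\<forall>i<n. x i \<in> \<A>) \<longrightarrow> 
    height ((\<lambda>j. eval_mpoly (\<Psi> j) x) ` {..<n}) \<le> D * height (x ` {..<n}) + c"
    by (rule height_upper_bound) (rule eval_mpoly_polybound[OF \<Psi> L(2) D])
  then obtain c2 where c2: "\<forall>x. (\<forall>i<n. x i \<in> \<A>) \<longrightarrow> 
    height ((\<lambda>j. eval_mpoly (\<Psi> j) x) ` {..<n}) \<le> D * height (x ` {..<n}) + c2" by blast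
  have "\<forall>x\<in>X. \<exists>y\<in>X. polynomial_map n \<Psi> x = polynomial_map n \<Phi> y" using sub by blast
  then obtain T where T: "\<And>x. x \<in> X \<Longrightarrow> T x \<in> X" "\<And>x. x \<in> X \<Longrightarrow> polynomial_map n \<Psi> x = polynomial_map n \<Phi> (T x)"
    by metis
  show "finite X"
  proof (rule injective_contraction_finite[where h = "\<lambda>x. height (x ` {..<n})" and a = d and b = D and c = "c1 + c2"])
    show "finite {x \<in> X. height (x ` {..<n}) \<le> t}" for t
      by (rule finite_subset[OF _ finite_bounded_height_points[OF L(2) northcott_height[OF N], of n t]]) (use X in auto)
    show "T ` X \<subseteq> X" using T(1) by auto
    \<comment> \<open>\<open>T x\<close> determines \<open>\<Psi> x\<close>, and
      \<open>\<Psi>\<close> is injective on \<open>X\<close>.\<close>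
    show "inj_on T X" using T(2) inj by (metis (no_types, lifting) inj_onD inj_onI)
    fix x assume x: "x \<in> X"
    have "(\<lambda>j. eval_mpoly (\<Psi> j) x) ` {..<n} = polynomial_map n \<Psi> x ` {..<n}" by (simp add: polynomial_map_def)
    also have "\<dots> = (\<lambda>j. eval_mpoly (\<Phi> j) (T x)) ` {..<n}" unfolding T(2)[OF x] by (simp add: polynomial_map_def)
    finally show "d * height (T x ` {..<n}) \<le> D * height (x ` {..<n}) + (c1 + c2)"
      using c1[rule_format, of "T x"] c2[rule_format, of x] XA x T(1)[OF x] by simp
  qed (use Dd in auto)
qed

text \<open>(SP) is the case of (K) in which \<open>\<Psi>\<close> is the identity: its coordinate
  polynomials have degree 1, while those of an admissible mapping have degree at least 2.\<close>

lemma property_K_imp_SP: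
  fixes K :: "'a::alg_closed_field set"
  assumes K: "is_subfield K" and "property_K K"
  shows "property_SP K"
  unfolding property_SP_def property_SP_dim_def
proof (intro allI impI)
  fix n f X
  assume n: "1 \<le> n" and adm: "admissible K n f" and X: "X \<subseteq> affine_space K n" and fX: "polynomial_map n f ` X = X"
  define \<Psi> :: "nat \<Rightarrow> 'a mpoly" where "\<Psi> = (\<lambda>i. Poly_Mapping.single (Poly_Mapping.single i 1) 1)"
  have keys: "Poly_Mapping.keys (\<Psi> i) = {Poly_Mapping.single i 1}" for i by (simp add: \<Psi>_def)
  have "monom_degree (Poly_Mapping.single i 1) = 1" for i by (simp add: monom_degree_def)
  then have deg: "total_degree (\<Psi> i) = 1" for i by (simp add: total_degree_def keys)
  have eval: "eval_mpoly (\<Psi> i) x = x i" for i x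
    by (simp add: eval_mpoly_def keys) (simp add: \<Psi>_def)
  have id: "polynomial_map n \<Psi> x = x" if "x \<in> X" for x
    using X that by (auto simp: polynomial_map_def eval affine_space_def fun_eq_iff restrict_def PiE_def extensional_def)
  have "polynomial_tuple K n \<Psi>" using K
    by (auto simp: polynomial_tuple_def mpolys_over_def keys) (auto simp: \<Psi>_def lookup_single when_def is_subfield_def)
  moreover have "Max ((\<lambda>i. total_degree (\<Psi> i)) ` {..<n}) < Min ((\<lambda>i. total_degree (f i)) ` {..<n})"
  proof -
    have "(\<lambda>i. total_degree (\<Psi> i)) ` {..<n} = {1}" using n by (simp add: deg image_constant_conv lessThan_empty_iff)
    moreover have "1 < Min ((\<lambda>i. total_degree (f i)) ` {..<n})"
    proof -
      have "{..<n} \<noteq> {}" using n by (auto simp only: lessThan_empty_iff)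
      moreover have "1 < total_degree (f i)" if "i < n" for i using adm that by (force simp: admissible_def)
      ultimately show ?thesis by (subst Min_gr_iff) auto
    qed
    ultimately show ?thesis by simp
  qed
  moreover have "polynomial_map n \<Psi> ` X \<subseteq> polynomial_map n f ` X" using id fX by auto
  moreover have "inj_on (polynomial_map n \<Psi>) X" using id by (metis inj_onI)
  ultimately show "finite X" using assms(2) n adm X unfolding property_K_def by blast
qed

lemma property_SP_imp_P: "property_SP K \<Longrightarrow> property_P K"
  by (simp add: property_SP_def property_P_def)

section \<open>The product formula and properties (R) and (P bar)\<close>

text \<open>Only one extension of each rational place enters, so for irrational \<open>y\<close>
  this need not vanish; the sum over all conjugates of a nonzero number does.\<close>

definition log_sum :: "complex \<Rightarrow> real" where
  "log_sum y = (\<Sum>\<^sub>\<infinity>v\<in>rational_places. ln (extended_place v y))"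

lemma extends_place_id: "v \<in> rational_places \<Longrightarrow> extends_place v (extended_place v)"
  using extends_place_extended[OF _ aut_id] by simp

lemma log_sum_summable:
  assumes "y \<in> \<A>" "y \<noteq> 0"
  shows "(\<lambda>v. ln (extended_place v y)) summable_on rational_places"
proof (rule finite_nonzero_values_imp_summable_on)
  have "{v \<in> rational_places. ln (extended_place v y) \<noteq> 0} \<subseteq> {v. \<exists>w. extends_place v w \<and> w y \<noteq> 1}"
  proof clarify
    fix v assume "v \<in> rational_places" "ln (extended_place v y) \<noteq> 0"
    then show "\<exists>w. extends_place v w \<and> w y \<noteq> 1"
      by (intro exI[of _ "extended_place v"]) (auto simp: extends_place_id)
  qed
  then show "finite {v \<in> rational_places. ln (extended_place v y) \<noteq> 0}"
    using finite_abs_ne_1[OF assms] by (rule finite_subset)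
qed

lemma log_sum_mult:
  assumes "x \<in> \<A>" "x \<noteq> 0" "y \<in> \<A>" "y \<noteq> 0"
  shows "log_sum (x * y) = log_sum x + log_sum y"
proof -
  have "ln (extended_place v (x * y)) = ln (extended_place v x) + ln (extended_place v y)"
    if "v \<in> rational_places" for v
  proof -
    note vw = extends_place_id[OF that]
    have "extended_place v x > 0" "extended_place v y > 0"
      using w_nonneg[OF vw] w_0_iff[OF vw] assms by (simp_all add: less_le)
    then show ?thesis using assms by (simp add: w_mult[OF vw] ln_mult)
  qed
  then have "log_sum (x * y) = (\<Sum>\<^sub>\<infinity>v\<in>rational_places. ln (extended_place v x) + ln (extended_place v y))"
    unfolding log_sum_def by (intro infsum_cong)
  then show ?thesis unfolding log_sum_def
    using infsum_add[OF log_sum_summable[OF assms(1,2)] log_sum_summable[OF assms(3,4)]] by simp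
qed

lemma log_sum_1: "log_sum 1 = 0"
  using log_sum_mult[of 1 1] by (simp add: alg_closed_under)

lemma log_sum_prod:
  assumes "\<And>i. i \<in> I \<Longrightarrow> f i \<in> \<A> \<and> f i \<noteq> 0"
  shows "log_sum (\<Prod>i\<in>I. f i) = (\<Sum>i\<in>I. log_sum (f i))"
  using assms
proof (induction I rule: infinite_finite_induct)
  case (insert i I)
  then have "log_sum (f i * (\<Prod>i\<in>I. f i)) = log_sum (f i) + log_sum (\<Prod>i\<in>I. f i)"
    by (intro log_sum_mult alg_prod) auto
  then show ?case using insert by simp
qed (auto simp: log_sum_1)

lemma padic_abs_of_prime:
  assumes "prime p" "prime q"
  shows "padic_abs p (of_nat q) = (if p = q then 1 / real p else 1)"
proof -
  have qo: "quotient_of (of_nat q) = (int q, 1)" using quotient_of_int[of "int q"] by simp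
  have "multiplicity (int p) (int q) = (if p = q then 1 else 0)"
    using assms prime_multiplicity_other[of "int p" "int q"] by (auto simp: prime_gt_1_nat multiplicity_self)
  then show ?thesis using assms
    by (auto simp: padic_abs_def qo prime_gt_0_nat power_int_minus field_simps)
qed

text \<open>Only the archimedean and the \<open>p\<close>-adic place contribute, with opposite
  logarithms.\<close>

lemma log_sum_prime:
  assumes p: "prime p"
  shows "log_sum (of_nat p) = 0"
proof -
  let ?a = "\<lambda>q. real_of_rat \<bar>q\<bar>"
  have p1: "real p > 1" using prime_gt_1_nat[OF p] by simp
  \<comment> \<open>The two places have to be distinct for their contributions to be added
    separately.\<close>
  have ne: "?a \<noteq> padic_abs p"
  proof
    assume "?a = padic_abs p"
    then have "real p = 1 / real p" using fun_cong[of ?a "padic_abs p" "of_nat p"] padic_abs_of_prime[OF p p] by simp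
    moreover have "1 / real p < 1" using p1 by simp
    ultimately show False using p1 by linarith
  qed
  have val: "extended_place v (of_nat p) = v (of_nat p)" if "v \<in> rational_places" for v
    using w_rat[OF extends_place_id[OF that], of "of_nat p"] by simp
  have "log_sum (of_nat p) = (\<Sum>\<^sub>\<infinity>v\<in>{?a, padic_abs p}. ln (v (of_nat p)))"
    unfolding log_sum_def
  proof (intro infsum_cong_neutral)
    fix v assume "v \<in> rational_places - {?a, padic_abs p}"
    then obtain q where q: "v \<in> rational_places" "prime q" "v = padic_abs q" "q \<noteq> p" by (auto simp: rational_places_def)
    then show "ln (extended_place v (of_nat p)) = 0" using val padic_abs_of_prime[OF q(2) p] by simp
  qed (use val p in \<open>auto simp: rational_places_def\<close>)
  also have "\<dots> = ln (real p) + ln (1 / real p)"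
    using ne padic_abs_of_prime[OF p p] by simp
  finally show ?thesis using p1 by (simp add: ln_div)
qed

lemma log_sum_of_nat: "n > 0 \<Longrightarrow> log_sum (of_nat n) = 0"
proof (induction n rule: prime_divisors_induct)
  case (factor p n)
  then have "n > 0" "p > 0" by auto
  then have "log_sum (of_nat p * of_nat n) = log_sum (of_nat p) + log_sum (of_nat n)"
    by (intro log_sum_mult alg_Rats) auto
  then show ?case using factor log_sum_prime \<open>n > 0\<close> by simp
qed (auto simp: log_sum_1)

lemma log_sum_Rats:
  assumes "q \<in> \<rat>" "q \<noteq> 0"
  shows "log_sum q = 0"
proof -
  have "log_sum (- 1) + log_sum (- 1) = 0"
    using log_sum_mult[of "-1" "-1"] log_sum_1 by (simp add: alg_Rats)
  then have m1: "log_sum (- 1) = 0" by simp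
  have int: "log_sum (of_int a) = 0" if "a \<noteq> 0" for a
  proof (cases "a > 0")
    case True
    then show ?thesis using log_sum_of_nat[of "nat a"] by simp
  next
    case False
    then have "log_sum (- 1 * of_nat (nat (- a))) = log_sum (- 1) + log_sum (of_nat (nat (- a)))"
      using that by (intro log_sum_mult alg_Rats) auto
    then show ?thesis using m1 log_sum_of_nat[of "nat (- a)"] False that by simp
  qed
  obtain a b where ab: "q = of_int a / of_int b" "b > 0" using assms(1) by (auto elim: Rats_cases')
  have "log_sum (q * of_int b) = log_sum q + log_sum (of_int b)"
    using assms ab by (intro log_sum_mult alg_Rats) auto
  moreover have "q * of_int b = of_int a" using ab by simp
  moreover have "a \<noteq> 0" using assms(2) ab by auto
  ultimately show ?thesis using int[of a] int[of b] ab(2) by simp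
qed

text \<open>The identity of \<open>L\<close> is a partial isomorphism, and \<open>m\<close> is its
  own image under it. Hence \<open>poly_rel_root\<close> carries every rational relation for
  \<open>x\<close> over to \<open>b\<close>.\<close>

lemma minimal_poly_root_conjugate:
  assumes L: "is_subfield L" "L \<subseteq> \<A>" and x: "x \<in> \<A>"
    and m: "\<And>i. coeff m i \<in> L" "m \<noteq> 0" "poly m x = 0"
    and min: "\<And>p. (\<And>i. coeff p i \<in> L) \<Longrightarrow> p \<noteq> 0 \<Longrightarrow> poly p x = 0 \<Longrightarrow> degree m \<le> degree p"
    and b: "poly m b = 0"
  shows "b \<in> conjugates x"
proof -
  have iso: "partial_iso (Id_on L)" using L Rats_subset_subfield[OF L(1)]
    by (auto simp: partial_iso_def is_subfield_def)
  have rel: "poly_rel (Id_on L) p q \<longleftrightarrow> p = q \<and> (\<forall>i. coeff p i \<in> L)" for p q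
    by (auto simp: poly_rel_def Id_on_iff poly_eq_iff)
  have "poly p b = 0" if "\<And>i. coeff p i \<in> \<rat>" "poly p x = 0" for p
  proof (rule poly_rel_root[OF iso, of m m x b p])
    show "poly_rel (Id_on L) m m" using m(1) by (simp add: rel)
    show "poly_rel (Id_on L) p p" using that(1) Rats_subset_subfield[OF L(1)] by (auto simp: rel)
    show "degree m \<le> degree p" if "poly_rel (Id_on L) p q" "p \<noteq> 0" "poly p x = 0" for p q
      using that min by (auto simp: rel)
  qed (use m b that in auto)
  then show ?thesis using conjugate_aut[OF x, of b] unfolding conjugates_def by (metis imageI)
qed

text \<open>The roots of the minimal polynomial are conjugates, so \<open>x\<close> is its only
  root. If \<open>x\<close> were a multiple root, the derivative would be a relation of smaller
  degree; so the polynomial is linear.\<close>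

lemma fixed_Rats:
  assumes x: "x \<in> \<A>" and fixed: "conjugates x = {x}"
  shows "x \<in> \<rat>"
proof -
  define Q where "Q = (\<lambda>p. (\<forall>i. coeff p i \<in> \<rat>) \<and> p \<noteq> 0 \<and> poly p x = 0)"
  have ex: "\<exists>p. Q p" using alg_rat_poly[OF x] unfolding Q_def by metis
  define m where "m = arg_min degree Q"
  have Qm: "Q m" and min: "Q q \<Longrightarrow> degree m \<le> degree q" for q
    unfolding m_def using ex arg_min_natI arg_min_nat_le by metis+
  have m: "\<And>i. coeff m i \<in> \<rat>" "m \<noteq> 0" "poly m x = 0" using Qm by (auto simp: Q_def)
  have root: "b = x" if b: "poly m b = 0" for b
  proof -
    have "b \<in> conjugates x"
    proof (rule minimal_poly_root_conjugate[OF is_subfield_Rats _ x m _ b])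
      show "\<rat> \<subseteq> \<A>" using alg_Rats by blast
      show "degree m \<le> degree p" if "\<And>i. coeff p i \<in> \<rat>" "p \<noteq> 0" "poly p x = 0" for p
        using that by (intro min) (simp add: Q_def)
    qed
    then show ?thesis using fixed by simp
  qed
  have "degree m \<noteq> 0"
  proof
    assume "degree m = 0"
    then obtain c where "m = [:c:]" by (metis degree_eq_zeroE)
    then show False using m(2,3) by simp
  qed
  obtain q where q: "m = [:- x, 1:] * q" using m(3) poly_eq_0_iff_dvd by blast
  have "degree q = 0"
  proof (rule ccontr)
    assume "degree q \<noteq> 0"
    then obtain b where b: "poly q b = 0" using alg_closed_imp_poly_has_root[of q] by auto
    then have "b = x" using root q by simp
    then have qx: "poly q x = 0" using b by simp
    have "poly (pderiv m) x = 0" unfolding q pderiv_mult using qx by (simp add: pderiv_pCons)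
    moreover have "coeff (pderiv m) i \<in> \<rat>" for i using m(1)[of "Suc i"] by (simp add: coeff_pderiv)
    moreover have "pderiv m \<noteq> 0" using \<open>degree m \<noteq> 0\<close> by (simp add: pderiv_eq_0_iff)
    ultimately have "degree m \<le> degree (pderiv m)" using min by (simp add: Q_def)
    then show False using \<open>degree m \<noteq> 0\<close> by (simp add: degree_pderiv)
  qed
  then obtain c where c: "q = [:c:]" by (metis degree_eq_zeroE)
  have "c \<noteq> 0" using m(2) q c by auto
  have "x = - coeff m 0 / coeff m 1" using \<open>c \<noteq> 0\<close> by (simp add: q c)
  then show ?thesis using m(1) by (metis Rats_divide Rats_minus_iff)
qed

text \<open>The product of the conjugates is fixed by all automorphisms, hence rational, and has
  logarithmic sum 0. By multiplicativity the sum of \<open>log_sum\<close> over the conjugates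
  vanishes, and with it the mean.\<close>

lemma product_formula:
  assumes x: "x \<in> \<A>" "x \<noteq> 0"
  shows "local_term {x} (\<lambda>w. ln (w x))" "global_sum (\<lambda>w. ln (w x)) = 0"
proof -
  have "{v. \<exists>w. extends_place v w \<and> ln (w x) \<noteq> 0} \<subseteq> {v. \<exists>w. extends_place v w \<and> w x \<noteq> 1}" by auto
  then have "finite {v. \<exists>w. extends_place v w \<and> ln (w x) \<noteq> 0}" using finite_abs_ne_1[OF x] by (rule finite_subset)
  then show lt: "local_term {x} (\<lambda>w. ln (w x))" using x by (auto simp: local_term_def)
  define N where "N = (\<Prod>y\<in>conjugates x. y)"
  have fin: "finite (conjugates x)" by (rule card_conjugates_le_degree(3)[OF x(1)])
  have cA: "y \<in> \<A> \<and> y \<noteq> 0" if "y \<in> conjugates x" for y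
    using that x aut_eq_0_iff aut_alg by (auto simp: conjugates_def)
  have NA: "N \<in> \<A>" "N \<noteq> 0" unfolding N_def using cA fin by (auto intro!: alg_prod)
  have "\<sigma> N = N" if \<sigma>: "\<sigma> \<in> alg_auts" for \<sigma>
  proof -
    have prod: "\<sigma> (\<Prod>y\<in>I. y) = (\<Prod>y\<in>I. \<sigma> y)" if "finite I" "I \<subseteq> \<A>" for I
      using that by (induction I rule: finite_induct) (auto simp: aut_1[OF \<sigma>] aut_mult[OF \<sigma>] alg_prod subset_iff)
    have "\<sigma> ` conjugates x \<subseteq> conjugates x"
    proof clarify
      fix y assume "y \<in> conjugates x"
      then obtain \<tau> where "\<tau> \<in> alg_auts" "y = \<tau> x" by (auto simp: conjugates_def)
      then show "\<sigma> y \<in> conjugates x" using aut_comp[OF \<sigma>, of \<tau>] unfolding conjugates_def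
        by (intro image_eqI[of _ _ "\<sigma> \<circ> \<tau>"]) auto
    qed
    moreover have inj: "inj_on \<sigma> (conjugates x)" using aut_inj[OF \<sigma>] cA by (meson inj_on_subset subsetI)
    ultimately have "\<sigma> ` conjugates x = conjugates x" using fin by (intro endo_inj_surj)
    then have "(\<Prod>y\<in>conjugates x. \<sigma> y) = N" unfolding N_def using prod.reindex[OF inj, of "\<lambda>y. y"] by simp
    then show ?thesis using prod[OF fin] cA unfolding N_def by auto
  qed
  moreover have "N \<in> conjugates N" unfolding conjugates_def by (rule image_eqI[OF _ aut_id]) simp
  ultimately have "conjugates N = {N}" by (auto simp: conjugates_def)
  then have "log_sum N = 0" using fixed_Rats log_sum_Rats NA by blast
  then have "(\<Sum>y\<in>conjugates x. log_sum y) = 0" unfolding N_def using log_sum_prod[of "conjugates x" "\<lambda>y. y"] cA by simp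
  then show "global_sum (\<lambda>w. ln (w x)) = 0"
    unfolding global_sum_eq[OF lt] using mean_on_singleton[OF x(1), of ln] by (simp add: log_sum_def)
qed

lemma coprime_no_common_root:
  fixes a b :: "'a::field poly"
  assumes "coprime a b" "poly a x = 0" "poly b x = 0"
  shows False
proof -
  have "[:- x, 1:] dvd a" "[:- x, 1:] dvd b" using assms by (auto simp: poly_eq_0_iff_dvd)
  then have "is_unit [:- x, 1:]" using assms(1) by (meson coprime_common_divisor)
  then show False by (simp add: is_unit_pCons_iff)
qed

text \<open>The numerator and denominator are homogenized to two binary forms without common zero; the
  denominator disappears from the global bound by the product formula.\<close>
lemma rational_function_height:
  assumes a: "\<And>i. coeff a i \<in> \<A>" and b: "\<And>i. coeff b i \<in> \<A>" and cop: "coprime a b"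
    and d: "d = max (degree a) (degree b)"
  shows "\<exists>c. \<forall>x\<in>\<A>. poly b x \<noteq> 0 \<longrightarrow> d * height {x} \<le> height {poly a x / poly b x} + c"
proof -
  \<comment> \<open>Variable 1 homogenizes variable 0, so the point of interest is
    \<open>(x, 1)\<close>.\<close>
  define y z where "y = coordfun 1" and "z = coordfun 0"
  define g where "g = (\<lambda>j::nat. homogenize d (if j = 0 then a else b) y z)"
  have yz: "y \<in> homfun 2 1" "z \<in> homfun 2 1" by (simp_all add: y_def z_def homfun_coord del: One_nat_def)
  have g: "g j \<in> homfun 2 d" for j unfolding g_def using a b by (intro homfun_homogenize yz) auto
  have ga: "g 0 u = (if u 1 = 0 then coeff a d * u 0 ^ d else u 1 ^ d * poly a (u 0 / u 1))" for u
    unfolding g_def using d by (simp add: homogenize_apply y_def z_def coordfun_apply)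
  have gb: "g (Suc 0) u = (if u 1 = 0 then coeff b d * u 0 ^ d else u 1 ^ d * poly b (u 0 / u 1))" for u
    unfolding g_def using d by (simp add: homogenize_apply y_def z_def coordfun_apply)
  have "\<exists>e N S. 1 \<le> N \<and> finite S \<and> S \<subseteq> \<A> \<and>
    (\<forall>v w x i B. extends_place v w \<longrightarrow> (\<forall>i<2. x i \<in> \<A>) \<longrightarrow> i < 2 \<longrightarrow> 0 \<le> B \<longrightarrow>
       (\<forall>j<2. d \<le> e \<longrightarrow> max_abs w (x ` {..<2}) ^ (e - d) * w (g j x) \<le> B) \<longrightarrow>
       w (x i) ^ e \<le> arch_const w N * max_abs w S * B)"
  proof (rule nullstellensatz_bound)
    show "g j \<in> homfun 2 d" for j by (rule g)
    fix u :: "nat \<Rightarrow> complex" assume "\<And>j. j < 2 \<Longrightarrow> g j u = 0"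
    then have g0: "g 0 u = 0" "g (Suc 0) u = 0" by auto
    have "u 1 = 0"
    proof (rule ccontr)
      assume "u 1 \<noteq> 0"
      then show False using g0 coprime_no_common_root[OF cop, of "u 0 / u 1"] by (simp add: ga gb)
    qed
    moreover have "u 0 = 0"
    proof (rule ccontr)
      assume "u 0 \<noteq> 0"
      \<comment> \<open>At infinity the forms reduce to their coefficients in degree
        \<open>d\<close>, at least one of which is a leading coefficient.\<close>
      then have "coeff a d = 0" "coeff b d = 0" using g0 \<open>u 1 = 0\<close> by (simp_all add: ga gb)
      then have "lead_coeff a = 0 \<or> lead_coeff b = 0" using d by (auto simp: max_def split: if_splits)
      then have "a = 0 \<and> b = 0" 
      proof
        assume "lead_coeff a = 0"
        then show ?thesis using d \<open>coeff b d = 0\<close> by simp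
      next
        assume "lead_coeff b = 0"
        then show ?thesis using d \<open>coeff a d = 0\<close> by simp
      qed
      then show False using cop by simp
    qed
    ultimately show "\<forall>i<2. u i = 0" by (auto simp: less_2_cases_iff)
  qed
  then obtain e N S where N: "1 \<le> N" and S: "finite S" "S \<subseteq> \<A>" and
    null: "\<forall>v w x i B. extends_place v w \<longrightarrow> (\<forall>i<2. x i \<in> \<A>) \<longrightarrow> i < 2 \<longrightarrow> 0 \<le> B \<longrightarrow>
       (\<forall>j<2. d \<le> e \<longrightarrow> max_abs w (x ` {..<2}) ^ (e - d) * w (g j x) \<le> B) \<longrightarrow>
       w (x i) ^ e \<le> arch_const w N * max_abs w S * B" by blast
  show ?thesis
  proof (intro exI ballI impI)
    fix x assume x: "x \<in> \<A>" and bx: "poly b x \<noteq> 0"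
    define q where "q = poly a x / poly b x"
    have abA: "poly a x \<in> \<A>" "poly b x \<in> \<A>" using alg_poly a b x by auto
    have qA: "q \<in> \<A>" unfolding q_def by (intro alg_divide abA)
    have loc: "max_abs w {x} ^ d \<le> arch_const w N * max_abs w S * (max_abs w {q} * w (poly b x))"
      if vw: "extends_place v w" for v w
    proof -
      define u where "u = (\<lambda>i::nat. if i = 0 then x else 1)"
      define M where "M = max_abs w {x}"
      define K where "K = arch_const w N * max_abs w S"
      have K: "K \<ge> 0" using arch_const_ge_1[OF N, of w] max_abs_ge(1)[OF S(1), of w] by (simp add: K_def)
      have "u ` {..<2} = {x, 1}" by (auto simp: u_def lessThan_nat_numeral)
      then have Mu: "max_abs w (u ` {..<2}) = M" by (simp add: M_def max_abs_def w_1[OF vw])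
      have M1: "M \<ge> 1" unfolding M_def by (rule max_abs_ge) simp
      have uA: "\<forall>i<2. u i \<in> \<A>" using x by (auto simp: u_def alg_closed_under)
      define G where "G = max (w (poly a x)) (w (poly b x))"
      have gu: "w (g j u) \<le> G" if "j < 2" for j
        using that by (auto simp: less_2_cases_iff ga gb u_def G_def)
      have G0: "G \<ge> 0" using w_nonneg[OF vw abA(1)] by (simp add: G_def le_max_iff_disj)
      \<comment> \<open>The coordinate 1 of \<open>u\<close> has absolute value 1, which the bound 0
        for \<open>e < d\<close> would contradict.\<close>
      have ed: "d \<le> e"
      proof (rule ccontr)
        assume "\<not> d \<le> e"
        then have "w (u 1) ^ e \<le> arch_const w N * max_abs w S * 0"
          using null[rule_format, of v w u 1 0] vw uA by auto
        then show False by (simp add: u_def w_1[OF vw])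
      qed
      have bd: "w (u i) ^ e \<le> K * (M ^ (e - d) * G)" if "i < 2" for i
      proof -
        have "\<forall>j<2. d \<le> e \<longrightarrow> max_abs w (u ` {..<2}) ^ (e - d) * w (g j u) \<le> M ^ (e - d) * G"
          unfolding Mu using gu M1 by (auto intro!: mult_left_mono)
        moreover have "0 \<le> M ^ (e - d) * G" using M1 G0 by simp
        ultimately show ?thesis unfolding K_def using null vw uA that by blast
      qed
      have "M = w (u 0) \<or> M = w (u 1)" by (auto simp: M_def max_abs_def u_def w_1[OF vw] max_def)
      then have "M ^ e \<le> K * (M ^ (e - d) * G)" using bd[of 0] bd[of 1] by auto
      moreover have "M ^ e = M ^ (e - d) * M ^ d" using ed by (simp flip: power_add)
      ultimately have "M ^ (e - d) * M ^ d \<le> M ^ (e - d) * (K * G)" by (simp add: mult_ac)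
      moreover have "M ^ (e - d) > 0" using M1 by (intro zero_less_power) simp
      ultimately have "M ^ d \<le> K * G" by (simp only: mult_le_cancel_left_pos)
      \<comment> \<open>Factoring out \<open>w (poly b x)\<close> turns the two values into
        \<open>w q\<close> and 1; the factor has global logarithmic sum 0.\<close>
      also have "G = max_abs w {q} * w (poly b x)"
      proof -
        have wb: "w (poly b x) > 0" using w_nonneg[OF vw abA(2)] w_0_iff[OF vw abA(2)] bx by (simp add: less_le)
        have wq: "w q * w (poly b x) = w (poly a x)" using w_mult[OF vw qA abA(2)] bx by (simp add: q_def)
        have "max_abs w {q} * w (poly b x) = max (w q * w (poly b x)) (1 * w (poly b x))"
          using wb by (simp only: max_abs_def) (simp add: max.commute max_mult_distrib_right)
        then show ?thesis by (simp add: wq G_def)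
      qed
      finally show ?thesis by (simp add: M_def K_def)
    qed
    note lx = local_term_height[of "{x}"] and lq = local_term_height[of "{q}"] and lS = local_term_height[OF S]
      and lN = local_term_arch[of "ln N"] and lb = product_formula[OF abA(2) bx]
    have lx: "local_term {x} (\<lambda>w. d * ln (max_abs w {x}))" using x by (intro local_term_cmult lx) auto
    have lq: "local_term {q} (\<lambda>w. ln (max_abs w {q}))" using qA by (intro lq) auto
    have "global_sum (\<lambda>w. d * ln (max_abs w {x})) \<le> 
      global_sum (\<lambda>w. ((if w 2 > 1 then ln N else 0) + ln (max_abs w S)) + (ln (max_abs w {q}) + ln (w (poly b x))))"
    proof (rule global_sum_mono[OF lx local_term_add[OF local_term_add[OF lN lS] local_term_add[OF lq lb(1)]]])
      fix v w assume vw: "extends_place v w"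
      have pos: "max_abs w {x} \<ge> 1" "max_abs w {q} \<ge> 1" "max_abs w S \<ge> 1" "arch_const w N \<ge> 1"
        using max_abs_ge(1) S(1) arch_const_ge_1 N by auto
      have wb: "w (poly b x) > 0" using w_nonneg[OF vw abA(2)] w_0_iff[OF vw abA(2)] bx by (simp add: less_le)
      have "d * ln (max_abs w {x}) = ln (max_abs w {x} ^ d)" using pos by (simp add: ln_realpow)
      also have "\<dots> \<le> ln (arch_const w N * max_abs w S * (max_abs w {q} * w (poly b x)))"
        using loc[OF vw] pos wb by (subst ln_le_cancel_iff) auto
      also have "\<dots> = (ln (arch_const w N) + ln (max_abs w S)) + (ln (max_abs w {q}) + ln (w (poly b x)))"
        using pos wb by (simp add: ln_mult)
      finally show "d * ln (max_abs w {x}) \<le> ((if w 2 > 1 then ln N else 0) + ln (max_abs w S)) + (ln (max_abs w {q}) + ln (w (poly b x)))"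
        by (simp only: ln_arch_const)
    qed
    also have "\<dots> = (ln N + height S) + (height {q} + 0)"
      unfolding global_sum_add[OF local_term_add[OF lN lS] local_term_add[OF lq lb(1)]]
        global_sum_add[OF lN lS] global_sum_add[OF lq lb(1)] global_sum_arch lb(2) height_def ..
    also have "global_sum (\<lambda>w. d * ln (max_abs w {x})) = d * height {x}"
      unfolding height_def by (rule global_sum_cmult[OF local_term_height]) (use x in auto)
    finally show "d * height {x} \<le> height {poly a x / poly b x} + (ln N + height S)" by (simp add: q_def)
  qed
qed

text \<open>Serves (R) and, with denominator 1, (P bar). A choice of preimages inside
  \<open>X\<close> is injective because each point is recovered from its preimage.\<close>

lemma rational_function_preimage_finite:
  assumes a: "\<And>i. coeff a i \<in> \<A>" and b: "\<And>i. coeff b i \<in> \<A>" and cop: "coprime a b"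
    and d: "max (degree a) (degree b) \<ge> 2" and X: "X \<subseteq> \<A>" "\<forall>x\<in>X. poly b x \<noteq> 0"
    and sub: "X \<subseteq> (\<lambda>x. poly a x / poly b x) ` X" and fin: "\<And>t. finite {x \<in> X. height {x} \<le> t}"
  shows "finite X"
proof -
  obtain c where c: "\<forall>x\<in>\<A>. poly b x \<noteq> 0 \<longrightarrow> 
    max (degree a) (degree b) * height {x} \<le> height {poly a x / poly b x} + c"
    using rational_function_height[OF a b cop refl] by blast
  have "\<forall>x\<in>X. \<exists>y\<in>X. x = poly a y / poly b y" using sub by blast
  then obtain T where T: "\<And>x. x \<in> X \<Longrightarrow> T x \<in> X" "\<And>x. x \<in> X \<Longrightarrow> x = poly a (T x) / poly b (T x)" by metis
  show ?thesis
  proof (rule injective_contraction_finite[where h = "\<lambda>x. height {x}" and b = 1 and c = c, OF fin])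
    show "T ` X \<subseteq> X" using T(1) by auto
    show "inj_on T X" using T(2) by (metis (no_types, lifting) inj_onI)
    fix x assume x: "x \<in> X"
    show "max (degree a) (degree b) * height {T x} \<le> 1 * height {x} + c"
      using c[rule_format, of "T x"] T(1)[OF x] T(2)[OF x, symmetric] X by auto
  qed (use d in auto)
qed

lemma northcott_property_R:
  assumes L: "is_subfield L" "L \<subseteq> \<A>" and N: "northcott L"
  shows "property_R L"
  unfolding property_R_def
proof (intro ballI impI, elim exE conjE)
  fix a b X
  assume a: "a \<in> polys_over L" and b: "b \<in> polys_over L" "b \<noteq> 0" and cop: "coprime a b"
    and X: "X \<subseteq> L" "infinite X" "\<forall>x\<in>X. poly b x \<noteq> 0" "(\<lambda>x. poly a x / poly b x) ` X = X"
  have ab: "coeff a i \<in> L" "coeff b i \<in> L" for i using a b by (auto simp: polys_over_def)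
  have "\<not> max (degree a) (degree b) \<ge> 2"
  proof
    assume "max (degree a) (degree b) \<ge> 2"
    moreover have "finite {x \<in> X. height {x} \<le> t}" for t
      by (rule finite_subset[OF _ northcott_height[OF N, of t]]) (use X in auto)
    ultimately have "finite X" using ab L(2) X 
      by (intro rational_function_preimage_finite[of a b X] cop) auto
    then show False using X by simp
  qed
  then have "degree a \<le> 1" "degree b \<le> 1" by auto
  then have eq: "a = [:coeff a 0, coeff a 1:]" "b = [:coeff b 0, coeff b 1:]"
    by (auto simp: poly_eq_iff coeff_pCons coeff_eq_0 split: nat.split)
  show "\<exists>\<alpha>\<in>L. \<exists>\<beta>\<in>L. \<exists>\<gamma>\<in>L. \<exists>\<delta>\<in>L. [:\<delta>, \<gamma>:] \<noteq> 0 \<and> Fract a b = Fract [:\<beta>, \<alpha>:] [:\<delta>, \<gamma>:]"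
    using ab eq b(2) by metis
qed

section \<open>Heights of the coefficients of a product of linear factors\<close>

lemma product_coeff_bound:
  assumes "extends_place v w" "set rs \<subseteq> \<A>"
  shows "coeff (\<Prod>r\<leftarrow>rs. [:- r, 1:]) k \<in> \<A> \<and> 
    w (coeff (\<Prod>r\<leftarrow>rs. [:- r, 1:]) k) \<le> arch_const w (2 ^ length rs) * (\<Prod>r\<leftarrow>rs. max_abs w {r})"
  using assms(2)
proof (induction rs arbitrary: k)
  case Nil
  then show ?case using w_0[OF assms(1)] w_1[OF assms(1)] 
    by (auto simp: coeff_1 alg_closed_under arch_const_def)
next
  case (Cons r rs)
  define p where "p = (\<Prod>r\<leftarrow>rs. [:- r, 1:])"
  define B where "B = arch_const w (2 ^ length rs) * (\<Prod>r\<leftarrow>rs. max_abs w {r})"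
  have p: "coeff p k \<in> \<A>" "w (coeff p k) \<le> B" for k using Cons unfolding p_def B_def by auto
  have rA: "r \<in> \<A>" using Cons by simp
  define M where "M = max_abs w {r}"
  have M: "w r \<le> M" "1 \<le> M" using max_abs_ge[of "{r}"] by (auto simp: M_def)
  have B0: "B \<ge> 0" using p(2)[of 0] w_nonneg[OF assms(1) p(1)[of 0]] by simp
  \<comment> \<open>Coefficient \<open>k\<close> of \<open>p\<close> multiplied by the variable,
    hence 0 for \<open>k = 0\<close>.\<close>
  define s where "s = (case k of 0 \<Rightarrow> 0 | Suc j \<Rightarrow> coeff p j)"
  have s: "s \<in> \<A>" "w s \<le> M * B"
  proof -
    show "s \<in> \<A>" using p by (auto simp: s_def alg_closed_under split: nat.split)
    have "w s \<le> B" using p B0 w_0[OF assms(1)] by (auto simp: s_def split: nat.split)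
    also have "B \<le> M * B" using M B0 by (simp add: mult_le_cancel_right1)
    finally show "w s \<le> M * B" .
  qed
  have t: "- r * coeff p k \<in> \<A>" "w (- r * coeff p k) \<le> M * B"
  proof -
    show "- r * coeff p k \<in> \<A>" using rA p by (intro alg_closed_under(4,5))
    have "w (- r * coeff p k) = w r * w (coeff p k)" 
      using rA p alg_closed_under(5)[OF rA] by (simp add: w_mult[OF assms(1)] w_minus[OF assms(1)] alg_closed_under del: mult_minus_left)
    also have "\<dots> \<le> M * B" using M p w_nonneg[OF assms(1) rA] w_nonneg[OF assms(1) p(1)] by (intro mult_mono) auto
    finally show "w (- r * coeff p k) \<le> M * B" .
  qed
  have eq: "coeff (\<Prod>r\<leftarrow>r # rs. [:- r, 1:]) k = - r * coeff p k + s"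
    by (simp add: p_def s_def coeff_pCons split: nat.split)
  \<comment> \<open>A coefficient of the longer product is a sum of two terms, so each factor
    contributes a 2 to \<open>2 ^ length rs\<close>.\<close>
  have "w (\<Sum>i\<in>{0, 1::nat}. if i = 0 then - r * coeff p k else s) \<le> arch_const w 2 * (M * B)"
    using s t M B0 by (intro w_sum_bound[OF assms(1)]) auto
  then have "w (- r * coeff p k + s) \<le> arch_const w (2 * 2 ^ length rs) * (M * (\<Prod>r\<leftarrow>rs. max_abs w {r}))"
    by (simp add: B_def arch_const_mult mult_ac)
  then show ?case unfolding eq using alg_closed_under(3)[OF t(1) s(1)] by (simp add: M_def)
qed

text \<open>Lists allow the roots of a polynomial to be counted with multiplicity.\<close>

lemma global_sum_list:
  assumes "set rs \<subseteq> \<A>"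
  shows "local_term (set rs) (\<lambda>w. \<Sum>r\<leftarrow>rs. ln (max_abs w {r}))"
    "global_sum (\<lambda>w. \<Sum>r\<leftarrow>rs. ln (max_abs w {r})) = (\<Sum>r\<leftarrow>rs. height {r})"
proof -
  have "local_term (set rs) (\<lambda>w. \<Sum>r\<leftarrow>rs. ln (max_abs w {r})) \<and>
    global_sum (\<lambda>w. \<Sum>r\<leftarrow>rs. ln (max_abs w {r})) = (\<Sum>r\<leftarrow>rs. height {r})"
    using assms
  proof (induction rs)
    case Nil
    have "local_term {} (\<lambda>w. 0)" by (simp add: local_term_def)
    then show ?case using global_sum_cmult[of "{}" "\<lambda>w. 0" 0] by simp
  next
    case (Cons r rs)
    then have lr: "local_term {r} (\<lambda>w. ln (max_abs w {r}))" by (intro local_term_height) auto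
    have IH: "local_term (set rs) (\<lambda>w. \<Sum>r\<leftarrow>rs. ln (max_abs w {r}))"
       "global_sum (\<lambda>w. \<Sum>r\<leftarrow>rs. ln (max_abs w {r})) = (\<Sum>r\<leftarrow>rs. height {r})" using Cons by auto
    show ?case using local_term_add[OF lr IH(1)] global_sum_add[OF lr IH(1)] IH(2) by (simp add: height_def)
  qed
  then show "local_term (set rs) (\<lambda>w. \<Sum>r\<leftarrow>rs. ln (max_abs w {r}))"
    "global_sum (\<lambda>w. \<Sum>r\<leftarrow>rs. ln (max_abs w {r})) = (\<Sum>r\<leftarrow>rs. height {r})" by auto
qed

lemma height_product_coeff:
  assumes rs: "set rs \<subseteq> \<A>"
  shows "height {coeff (\<Prod>r\<leftarrow>rs. [:- r, 1:]) k} \<le> length rs * ln 2 + (\<Sum>r\<leftarrow>rs. height {r})"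
proof -
  define c where "c = coeff (\<Prod>r\<leftarrow>rs. [:- r, 1:]) k"
  have "\<exists>v w. extends_place v w" using extends_place_extended[OF _ aut_id] by (auto simp: rational_places_def)
  then have cA: "c \<in> \<A>" using product_coeff_bound rs by (auto simp: c_def)
  note lc = local_term_height[of "{c}"] and ls = global_sum_list[OF rs] and lN = local_term_arch[of "ln (2 ^ length rs)"]
  have "height {c} \<le> global_sum (\<lambda>w. (if w 2 > 1 then ln (2 ^ length rs) else 0) + (\<Sum>r\<leftarrow>rs. ln (max_abs w {r})))"
    unfolding height_def
  proof (rule global_sum_mono[OF lc local_term_add[OF lN ls(1)]])
    fix v w assume vw: "extends_place v w"
    have pos: "arch_const w (2 ^ length rs) \<ge> 1" by (intro arch_const_ge_1) simp
    have prod: "(\<Prod>r\<leftarrow>rs. max_abs w {r}) \<ge> 1 \<and> ln (\<Prod>r\<leftarrow>rs. max_abs w {r}) = (\<Sum>r\<leftarrow>rs. ln (max_abs w {r}))" for rs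
    proof (induction rs)
      case (Cons r rs)
      have "max_abs w {r} \<ge> 1" by (rule max_abs_ge) simp
      then show ?case using Cons mult_mono[of 1 "max_abs w {r}" 1 "\<Prod>r\<leftarrow>rs. max_abs w {r}"] by (simp add: ln_mult)
    qed simp
    define P where "P = (\<Prod>r\<leftarrow>rs. max_abs w {r})"
    have P: "P \<ge> 1" "ln P = (\<Sum>r\<leftarrow>rs. ln (max_abs w {r}))" using prod[of rs] by (auto simp: P_def)
    have "1 \<le> arch_const w (2 ^ length rs) * P" using mult_mono[OF pos P(1)] pos by simp
    then have "max_abs w {c} \<le> arch_const w (2 ^ length rs) * P"
      using product_coeff_bound[OF vw rs, of k] by (intro max_abs_le) (auto simp: c_def P_def)
    moreover have "max_abs w {c} \<ge> 1" by (rule max_abs_ge) simp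
    ultimately have "ln (max_abs w {c}) \<le> ln (arch_const w (2 ^ length rs) * P)" by simp
    also have "\<dots> = ln (arch_const w (2 ^ length rs)) + ln P" using pos P(1) by (simp add: ln_mult)
    finally show "ln (max_abs w {c}) \<le> (if w 2 > 1 then ln (2 ^ length rs) else 0) + (\<Sum>r\<leftarrow>rs. ln (max_abs w {r}))"
      by (simp only: ln_arch_const P(2))
  qed (use cA in auto)
  also have "\<dots> = ln (2 ^ length rs) + (\<Sum>r\<leftarrow>rs. height {r})"
    unfolding global_sum_add[OF lN ls(1)] global_sum_arch ls(2) ..
  finally show ?thesis by (simp add: c_def ln_realpow)
qed

lemma finite_polys_bounded:
  assumes "finite C"
  shows "finite {p :: 'a::zero poly. degree p \<le> B \<and> (\<forall>i. coeff p i \<in> C)}"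
proof -
  have "{p. degree p \<le> B \<and> (\<forall>i. coeff p i \<in> C)} \<subseteq> Poly ` {cs. set cs \<subseteq> C \<and> length cs = Suc B}"
  proof clarify
    fix p :: "'a poly" assume p: "degree p \<le> B" "\<forall>i. coeff p i \<in> C"
    have "p = Poly (map (coeff p) [0..<Suc B])"
      using p(1) by (auto simp: poly_eq_iff coeff_Poly_eq nth_default_def coeff_eq_0 simp del: upt_Suc)
    moreover have "set (map (coeff p) [0..<Suc B]) \<subseteq> C" using p(2) by auto
    ultimately show "p \<in> Poly ` {cs. set cs \<subseteq> C \<and> length cs = Suc B}" 
      by (intro image_eqI[of _ _ "map (coeff p) [0..<Suc B]"]) (simp_all del: upt_Suc)
  qed
  then show ?thesis using finite_lists_length_eq[OF assms] by (meson finite_imageI finite_subset)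
qed

lemma alg_closure_subset:
  assumes "L \<subseteq> \<A>" shows "alg_closure_of L \<subseteq> \<A>"
  using alg_poly_root assms by (fastforce simp: alg_closure_of_def polys_over_def)

text \<open>The coefficients of the minimal polynomial over \<open>L\<close> are elements of \<open>L\<close> of bounded height.\<close>
lemma northcott_bounded_degree:
  assumes L: "is_subfield L" "L \<subseteq> \<A>" and N: "northcott L"
  shows "finite {x \<in> alg_closure_of L. degree_over L x \<le> B \<and> height {x} \<le> t}"
proof -
  \<comment> \<open>The bound of \<open>height_product_coeff\<close> for at most \<open>B\<close>
    roots; \<open>max 0 t\<close> keeps it increasing in the number of roots when \<open>t\<close>
    is negative.\<close>
  define C where "C = {y \<in> L. height {y} \<le> B * ln 2 + B * max 0 t}"
  define P where "P = {p. degree p \<le> B \<and> (\<forall>i. coeff p i \<in> C)} - {0}"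
  have "finite C" unfolding C_def by (rule northcott_height[OF N])
  then have "finite P" unfolding P_def using finite_polys_bounded by blast
  then have fin: "finite (\<Union>p\<in>P. {x. poly p x = 0})" by (auto simp: P_def poly_roots_finite)
  have "{x \<in> alg_closure_of L. degree_over L x \<le> B \<and> height {x} \<le> t} \<subseteq> (\<Union>p\<in>P. {x. poly p x = 0})"
  proof clarify
    fix x assume x: "x \<in> alg_closure_of L" "degree_over L x \<le> B" "height {x} \<le> t"
    have xA: "x \<in> \<A>" using x alg_closure_subset[OF L(2)] by blast
    have "\<exists>d. \<exists>p\<in>polys_over L. p \<noteq> 0 \<and> degree p = d \<and> poly p x = 0"
      using x(1) by (auto simp: alg_closure_of_def)
    then have "\<exists>p\<in>polys_over L. p \<noteq> 0 \<and> degree p = degree_over L x \<and> poly p x = 0"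
      unfolding degree_over_def by (rule LeastI_ex)
    then obtain p where p: "\<And>i. coeff p i \<in> L" "p \<noteq> 0" "degree p = degree_over L x" "poly p x = 0"
      by (auto simp: polys_over_def)
    have min: "degree p \<le> degree q" if "\<And>i. coeff q i \<in> L" "q \<noteq> 0" "poly q x = 0" for q
      unfolding p(3) degree_over_def using that by (intro Least_le) (auto simp: polys_over_def)
    \<comment> \<open>The coefficients of the monic multiple are given by the roots alone.\<close>
    define m where "m = smult (inverse (lead_coeff p)) p"
    obtain A where A: "size A = degree p" "p = smult (lead_coeff p) (\<Prod>x\<in>#A. [:- x, 1:])"
      using alg_closed_imp_factorization[OF p(2)] by blast
    obtain rs where rs: "mset rs = A" by (metis ex_mset)
    have prs: "p = smult (lead_coeff p) (\<Prod>r\<leftarrow>rs. [:- r, 1:])"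
      using A(2) rs by (metis mset_map prod_mset_prod_list)
    then have m: "m = (\<Prod>r\<leftarrow>rs. [:- r, 1:])" using p(2) unfolding m_def
      by (metis left_inverse leading_coeff_0_iff smult_1_left smult_smult)
    have len: "length rs = degree p" using A(1) rs by auto
    have "inverse (lead_coeff p) \<in> L" using p(1) L(1) by (simp add: is_subfield_def)
    then have mL: "coeff m i \<in> L" for i using p(1) L(1) by (simp add: m_def is_subfield_def)
    \<comment> \<open>Every root is conjugate to \<open>x\<close> over the rationals and so has the
      height of \<open>x\<close>.\<close>
    have root: "r \<in> conjugates x" if "r \<in> set rs" for r
    proof (rule minimal_poly_root_conjugate[OF L xA p(1,2,4)])
      have "[:- r, 1:] dvd (\<Prod>r\<leftarrow>rs. [:- r, 1:])" using that by (auto intro!: prod_list_dvd simp: )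
      then show "poly p r = 0" by (subst prs) (simp add: poly_eq_0_iff_dvd dvd_smult)
    qed (use min in auto)
    then have rsA: "set rs \<subseteq> \<A>" using conjugates_alg[OF xA] by blast
    have hr: "height {r} \<le> max 0 t" if "r \<in> set rs" for r
      using height_conjugate[OF xA root[OF that]] x(3) by simp
    have sm: "(\<Sum>r\<leftarrow>rs. height {r}) \<le> length rs * max 0 t"
      using sum_list_mono[of rs "\<lambda>r. height {r}" "\<lambda>r. max 0 t"] hr by (simp add: sum_list_triv)
    have "coeff m i \<in> C" for i
    proof -
      have "height {coeff m i} \<le> length rs * ln 2 + (\<Sum>r\<leftarrow>rs. height {r})"
        unfolding m by (rule height_product_coeff[OF rsA])
      also have "\<dots> \<le> length rs * ln 2 + length rs * max 0 t" using sm by simp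
      also have "\<dots> \<le> B * ln 2 + B * max 0 t" using len p(3) x(2) by (intro add_mono mult_right_mono) auto
      finally show ?thesis using mL by (simp add: C_def)
    qed
    moreover have "degree m \<le> B" using p(3) x(2) by (simp add: m_def)
    moreover have "m \<noteq> 0" "poly m x = 0" using p(2,4) by (simp_all add: m_def)
    ultimately show "x \<in> (\<Union>p\<in>P. {x. poly p x = 0})" unfolding P_def by blast
  qed
  then show ?thesis using fin by (rule finite_subset)
qed

lemma northcott_property_Pbar:
  assumes L: "is_subfield L" "L \<subseteq> \<A>" and N: "northcott L"
  shows "property_Pbar L"
  unfolding property_Pbar_def
proof (intro ballI allI impI, elim exE)
  fix f X B
  assume f: "f \<in> polys_over (alg_closure_of L)" "2 \<le> degree f" and X: "X \<subseteq> alg_closure_of L" "X \<subseteq> poly f ` X"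
    and B: "\<forall>x\<in>X. degree_over L x \<le> B"
  note AL = alg_closure_subset[OF L(2)]
  show "finite X"
  proof (rule rational_function_preimage_finite[of f 1])
    show "coeff f i \<in> \<A>" for i using f(1) AL by (auto simp: polys_over_def)
    show "coeff 1 i \<in> \<A>" for i by (simp add: coeff_1 alg_closed_under)
    show "finite {x \<in> X. height {x} \<le> t}" for t
      by (rule finite_subset[OF _ northcott_bounded_degree[OF L N, of B t]]) (use X B in auto)
  qed (use f X AL in auto)
qed

text \<open>Meaningful only if no variable other than \<open>0\<close> occurs in \<open>p\<close>.\<close>
definition univariate :: "'a::comm_semiring_1 mpoly \<Rightarrow> 'a poly" where
  "univariate p = (\<Sum>m\<in>Poly_Mapping.keys p. monom (Poly_Mapping.lookup p m) (Poly_Mapping.lookup m 0))"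

context
  fixes K :: "'a::field set" and p :: "'a mpoly"
  assumes p: "p \<in> mpolys_over K 1"
begin

lemma univariate_keys: "m \<in> Poly_Mapping.keys p \<Longrightarrow> Poly_Mapping.keys m \<subseteq> {0}"
  using p by (auto simp: mpolys_over_def)

lemma univariate_monom: 
  assumes "m \<in> Poly_Mapping.keys p" shows "m = Poly_Mapping.single 0 (Poly_Mapping.lookup m 0)"
proof (rule poly_mapping_eqI)
  fix i
  show "Poly_Mapping.lookup m i = Poly_Mapping.lookup (Poly_Mapping.single 0 (Poly_Mapping.lookup m 0)) i"
    using univariate_keys[OF assms] by (cases "i = 0") (auto simp: lookup_single when_def in_keys_iff)
qed

lemma poly_univariate: "poly (univariate p) (x 0) = eval_mpoly p x"
proof -
  have "(\<Prod>i\<in>Poly_Mapping.keys m. x i ^ Poly_Mapping.lookup m i) = x 0 ^ Poly_Mapping.lookup m 0"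
    if "m \<in> Poly_Mapping.keys p" for m
  proof -
    have "(\<Prod>i\<in>Poly_Mapping.keys m. x i ^ Poly_Mapping.lookup m i) = (\<Prod>i\<in>{0}. x i ^ Poly_Mapping.lookup m i)"
      using univariate_keys[OF that] by (intro prod.mono_neutral_left) (auto simp: in_keys_iff)
    then show ?thesis by simp
  qed
  then show ?thesis by (simp add: univariate_def eval_mpoly_def poly_sum poly_monom)
qed

lemma coeff_univariate: "coeff (univariate p) k = Poly_Mapping.lookup p (Poly_Mapping.single 0 k)"
proof -
  have "coeff (univariate p) k = (\<Sum>m\<in>Poly_Mapping.keys p. if m = Poly_Mapping.single 0 k then Poly_Mapping.lookup p m else 0)"
    unfolding univariate_def coeff_sum
  proof (intro sum.cong refl)
    fix m assume "m \<in> Poly_Mapping.keys p"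
    then have "Poly_Mapping.lookup m 0 = k \<longleftrightarrow> m = Poly_Mapping.single 0 k"
      using univariate_monom[of m] by (metis lookup_single_eq)
    then show "coeff (monom (Poly_Mapping.lookup p m) (Poly_Mapping.lookup m 0)) k = 
      (if m = Poly_Mapping.single 0 k then Poly_Mapping.lookup p m else 0)" by simp
  qed
  then show ?thesis by (simp add: in_keys_iff)
qed

lemma univariate_polys_over: "univariate p \<in> polys_over K"
  using p by (simp add: polys_over_def coeff_univariate mpolys_over_def)

lemma degree_univariate: assumes "total_degree p \<ge> 2" shows "degree (univariate p) \<ge> 2"
proof -
  have "total_degree p \<in> insert 0 (monom_degree ` Poly_Mapping.keys p)"
    unfolding total_degree_def by (rule Max_in) auto
  then obtain m where m: "m \<in> Poly_Mapping.keys p" "monom_degree m \<ge> 2" using assms by auto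
  define k where "k = Poly_Mapping.lookup m 0"
  have mk: "m = Poly_Mapping.single 0 k" unfolding k_def by (rule univariate_monom[OF m(1)])
  have "monom_degree m \<le> k" unfolding mk monom_degree_def by (cases "k = 0") auto
  moreover have "coeff (univariate p) k \<noteq> 0" using m(1) by (simp add: coeff_univariate mk in_keys_iff)
  ultimately show ?thesis using m(2) le_degree[of "univariate p" k] by simp
qed

end

text \<open>A one-dimensional point is a function on one index. Evaluation at 0 identifies
  \<open>X\<close> with a subset of \<open>K\<close> and the mapping with a polynomial in one
  variable.\<close>

lemma property_P_univariate:
  fixes K :: "'a::alg_closed_field set"
  assumes "\<And>q X. q \<in> polys_over K \<Longrightarrow> degree q \<ge> 2 \<Longrightarrow> X \<subseteq> K \<Longrightarrow> poly q ` X = X \<Longrightarrow> finite X"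
  shows "property_P K"
  unfolding property_P_def property_SP_dim_def
proof (intro allI impI)
  fix f X
  assume adm: "admissible K 1 f" and X: "X \<subseteq> affine_space K 1" "polynomial_map 1 f ` X = X"
  have f0: "f 0 \<in> mpolys_over K 1" "total_degree (f 0) \<ge> 2"
    using adm by (auto simp: admissible_def polynomial_tuple_def)
  have inj: "inj_on (\<lambda>x. x 0) X"
  proof (rule inj_onI)
    fix x y assume "x \<in> X" "y \<in> X" "x 0 = y 0"
    then show "x = y" using X(1) by (intro extensionalityI[of _ "{..<1}"]) (auto simp: affine_space_def PiE_def)
  qed
  have "(\<lambda>x. poly (univariate (f 0)) (x 0)) ` X = (\<lambda>x. x 0) ` (polynomial_map 1 f ` X)"
    unfolding image_image by (intro image_cong refl) (simp add: poly_univariate[OF f0(1)] polynomial_map_def)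
  then have "poly (univariate (f 0)) ` (\<lambda>x. x 0) ` X = (\<lambda>x. x 0) ` X" unfolding image_image X(2) .
  moreover have "(\<lambda>x. x 0) ` X \<subseteq> K" using X(1) by (auto simp: affine_space_def)
  ultimately have "finite ((\<lambda>x. x 0) ` X)"
    using assms[OF univariate_polys_over[OF f0(1)] degree_univariate[OF f0]] by blast
  then show "finite X" using inj by (rule finite_imageD)
qed

section \<open>Deducing (P) from (P bar) and from (R)\<close>

lemma subfield_subset_closure:
  fixes K :: "'a::alg_closed_field set"
  assumes K: "is_subfield K" and x: "x \<in> K"
  shows "x \<in> alg_closure_of K" "degree_over K x \<le> 1"
proof -
  have p: "[:- x, 1:] \<in> polys_over K" using K x by (auto simp: polys_over_def is_subfield_def coeff_pCons split: nat.split)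
  then show "x \<in> alg_closure_of K" unfolding alg_closure_of_def by (intro CollectI bexI[of _ "[:- x, 1:]"]) auto
  show "degree_over K x \<le> 1" unfolding degree_over_def
    by (intro Least_le bexI[OF _ p]) auto
qed

text \<open>Elements of \<open>K\<close> have degree at most 1 over \<open>K\<close>, so the degrees
  on \<open>X\<close> are bounded by 1.\<close>

lemma property_Pbar_imp_P:
  fixes K :: "'a::alg_closed_field set"
  assumes K: "is_subfield K" and "property_Pbar K"
  shows "property_P K"
proof (rule property_P_univariate)
  fix q X assume q: "q \<in> polys_over K" "2 \<le> degree q" and X: "X \<subseteq> K" "poly q ` X = X"
  note cl = subfield_subset_closure[OF K]
  have "q \<in> polys_over (alg_closure_of K)" using q(1) cl(1) by (auto simp: polys_over_def)
  moreover have "X \<subseteq> alg_closure_of K" "\<forall>x\<in>X. degree_over K x \<le> 1" using X cl by auto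
  ultimately show "finite X" using assms(2) q(2) X(2) unfolding property_Pbar_def by blast
qed

text \<open>With denominator 1, \<open>q\<close> would be linear fractional, and comparing degrees
  in \<open>q * [:\<delta>, \<gamma>:] = [:\<beta>, \<alpha>:]\<close> contradicts
  \<open>2 \<le> degree q\<close>.\<close>

lemma property_R_imp_P:
  fixes K :: "'a::alg_closed_field set"
  assumes K: "is_subfield K" and "property_R K"
  shows "property_P K"
proof (rule property_P_univariate, rule ccontr)
  fix q X assume q: "q \<in> polys_over K" "2 \<le> degree q" and X: "X \<subseteq> K" "poly q ` X = X" "infinite X"
  have one: "1 \<in> polys_over K" using K by (auto simp: polys_over_def is_subfield_def coeff_1)
  have ex: "\<exists>X\<subseteq>K. infinite X \<and> (\<forall>x\<in>X. poly 1 x \<noteq> 0) \<and> (\<lambda>x. poly q x / poly 1 x) ` X = X"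
    using X by (intro exI[of _ X]) simp
  have "\<exists>\<alpha>\<in>K. \<exists>\<beta>\<in>K. \<exists>\<gamma>\<in>K. \<exists>\<delta>\<in>K. [:\<delta>, \<gamma>:] \<noteq> 0 \<and> Fract q 1 = Fract [:\<beta>, \<alpha>:] [:\<delta>, \<gamma>:]"
    by (rule assms(2)[unfolded property_R_def, rule_format, OF q(1) one _ _ ex]) simp_all
  then obtain \<alpha> \<beta> \<gamma> \<delta> where nz: "[:\<delta>, \<gamma>:] \<noteq> 0" and eq: "Fract q 1 = Fract [:\<beta>, \<alpha>:] [:\<delta>, \<gamma>:]"
    by blast
  have "q * [:\<delta>, \<gamma>:] = [:\<beta>, \<alpha>:]" using eq nz by (simp add: eq_fract)
  moreover have "q \<noteq> 0" using q(2) by auto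
  ultimately have "degree q + degree [:\<delta>, \<gamma>:] = degree [:\<beta>, \<alpha>:]" using nz by (metis degree_mult_eq)
  moreover have "degree [:\<beta>, \<alpha>:] \<le> 1" by simp
  ultimately show False using q(2) by linarith
qed

theorem theorem6p8:
  shows "(\<forall>K :: 'a::alg_closed_field set. is_subfield K \<longrightarrow>
            (property_K K \<longrightarrow> property_SP K) \<and> (property_SP K \<longrightarrow> property_P K) \<and>
            (property_Pbar K \<longrightarrow> property_P K) \<and> (property_R K \<longrightarrow> property_P K)) \<and>
         (\<forall>L :: complex set. is_subfield L \<longrightarrow> L \<subseteq> algebraic_numbers \<longrightarrow> northcott L \<longrightarrow>
            property_K L \<and> property_SP L \<and> property_Pbar L \<and> property_R L \<and> property_P L)"
proof (intro conjI allI impI)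
  fix K :: "'a set" assume K: "is_subfield K"
  show "property_SP K" if "property_K K" by (rule property_K_imp_SP[OF K that])
  show "property_P K" if "property_SP K" by (rule property_SP_imp_P[OF that])
  show "property_P K" if "property_Pbar K" by (rule property_Pbar_imp_P[OF K that])
  show "property_P K" if "property_R K" by (rule property_R_imp_P[OF K that])
next
  fix L assume L: "is_subfield L" "L \<subseteq> \<A>" "northcott L"
  show "property_K L" by (rule northcott_property_K[OF L])
  then show "property_SP L" by (rule property_K_imp_SP[OF L(1)])
  then show "property_P L" by (rule property_SP_imp_P)
  show "property_Pbar L" by (rule northcott_property_Pbar[OF L])
  show "property_R L" by (rule northcott_property_R[OF L])
qed

end
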